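(* Let $(f,K)\in\mathscr A^{\mathrm{BD}}_+$ satisfy the weak isolation condition. Then for every $x\in K$ such that the limit $\chi(x)=\lim_{n\to\infty}\frac1n\log|(f^n)'(x)|$ exists and is finite, we have $\chi(x)\ge\chi_{\inf}$.
   Context: **Generalized multimodal maps.** Let $f$ be a $C^2$ map from an open subset of $\mathbb R$ into $\mathbb R$; a critical point is a zero of $f'$. A critical point $c$ is non-flat if near $c$ one has $f(x)=\pm|\phi(x)|^d+f(c)$ for some $d\ge2$ and some $C^2$ diffeomorphism $\phi$ of a neighborhood of $c$ with $\phi(c)=0$. We write $(f,K,\hat I_K,U)\in\mathscr A$ (abbreviated $(f,K)\in\mathscr A$) if: $f$ has finitely many critical points, all non-flat; $K\subset\mathbb R$ is an infinite compact set in the domain of $f$ with $f(K)=K$ and $f|_K$ topologically transitive (for all nonempty $V_1,V_2\subset K$ open in $K$ there is $n\ge1$ with $f^n(V_1)\cap V_2\neq\emptyset$); $\hat I_K=\bigcup_j\hat I_j\supset K$ is a finite union of pairwise disjoint closed intervals in the domain of $f$, with endpoints in $K$, such that $K$ is the maximal compact forward invariant set in $\hat I_K$; $\hat I_K\setminus K$ contains no critical points; $U=\bigcup_jU^j$ where the $U^j$ are pairwise disjoint neighborhoods of the $\hat I_j$ on which $f$ is $C^2$, and no $U^j\setminus K$ contains a critical point. The subscript $+$ means that $f|_K$ has positive topological entropy. **Bounded distortion.** For intervals $A\subset B$, $B$ is the $\varepsilon$-scaled neighborhood of $A$ if $B\setminus A$ has two components, each of length $\varepsilon|A|$. $(f,K)\in\mathscr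 A^{\mathrm{BD}}$ means: $(f,K)\in\mathscr A$ and there is $\delta>0$ such that for every $\varepsilon>0$ there is $C(\varepsilon)>0$ such that for every pair of intervals $I_1,I_2\subset U$ with $I_1\cap K\ne\emptyset$, $|I_2|\le\delta$, and every $n>0$ for which $f^n$ maps an interval $I_1'\supset I_1$ diffeomorphically onto the $\varepsilon$-scaled neighborhood $I_2'$ of $I_2$ (with $f^n(I_1)=I_2$), one has $\sup_{x,y\in I_1}|(f^n)'(x)|/|(f^n)'(y)|\le C(\varepsilon)$. **Weak isolation.** There exists an open set $U'$ with $K\subset U'\subset U$ such that every $f$-periodic orbit contained in $U'$ is contained in $K$. **Exponents of measures.** For an $f$-invariant Borel probability measure $\mu$ on $K$, $\chi(\mu)=\int\log|f'|\,d\mu$; $\chi_{\inf}$ is the infimum of $\chi(\mu)$ over all such $\mu$. *)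

theory Defs
  imports "HOL-Probability.Probability"
begin

text \<open>
  A map \<open>f\<close> with domain an open set \<open>D\<close> of reals is a total function \<open>f\<close> together with \<open>D\<close>;
  for \<open>K \<subseteq> D\<close> and \<open>f ` K = K\<close> the values of \<open>f\<close> outside \<open>D\<close> play no role below.
\<close>

section \<open>\<open>C\<^sup>2\<close> maps and non-flat critical points\<close>

text \<open>
  Derivatives are taken within \<open>S\<close>, so that on an interval that is not open they are one-sided
  at the end points it contains.
\<close>

definition C2_on :: "(real \<Rightarrow> real) \<Rightarrow> real set \<Rightarrow> bool" where
  "C2_on f S \<longleftrightarrow> (\<exists>f' f''.
      (\<forall>x\<in>S. (f has_real_derivative f' x) (at x within S)) \<and>
      (\<forall>x\<in>S. (f' has_real_derivative f'' x) (at x within S)) \<and>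
      continuous_on S f'')"

definition C2_diffeo :: "(real \<Rightarrow> real) \<Rightarrow> real set \<Rightarrow> real set \<Rightarrow> bool" where
  "C2_diffeo g A B \<longleftrightarrow> bij_betw g A B \<and> C2_on g A \<and> C2_on (the_inv_into A g) B"

definition critical_points :: "real set \<Rightarrow> (real \<Rightarrow> real) \<Rightarrow> real set" where
  "critical_points D f = {c \<in> D. deriv f c = 0}"

text \<open>
  The sign may depend on the point, so that inflection critical points such as that of \<open>x\<^sup>3\<close>
  are allowed besides turning points.
\<close>

definition non_flat :: "real set \<Rightarrow> (real \<Rightarrow> real) \<Rightarrow> real \<Rightarrow> bool" where
  "non_flat D f c \<longleftrightarrow> (\<exists>(d::real) \<phi> W W'.
      d \<ge> 2 \<and> open W \<and> c \<in> W \<and> W \<subseteq> D \<and> open W' \<and> C2_diffeo \<phi> W W' \<and> \<phi> c = 0 \<and>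
      (\<forall>x\<in>W. f x = \<bar>\<phi> x\<bar> powr d + f c \<or> f x = - (\<bar>\<phi> x\<bar> powr d) + f c))"

section \<open>Topological transitivity and entropy\<close>

definition transitive_on :: "('a::topological_space \<Rightarrow> 'a) \<Rightarrow> 'a set \<Rightarrow> bool" where
  "transitive_on f K \<longleftrightarrow>
     (\<forall>V\<^sub>1 V\<^sub>2. openin (top_of_set K) V\<^sub>1 \<and> openin (top_of_set K) V\<^sub>2 \<and> V\<^sub>1 \<noteq> {} \<and> V\<^sub>2 \<noteq> {} \<longrightarrow>
        (\<exists>n\<ge>1. (f ^^ n) ` V\<^sub>1 \<inter> V\<^sub>2 \<noteq> {}))"

definition dyn_separated :: "('a::metric_space \<Rightarrow> 'a) \<Rightarrow> nat \<Rightarrow> real \<Rightarrow> 'a set \<Rightarrow> bool" where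
  "dyn_separated f n \<epsilon> E \<longleftrightarrow>
     (\<forall>x\<in>E. \<forall>y\<in>E. x \<noteq> y \<longrightarrow> (\<exists>i<n. dist ((f ^^ i) x) ((f ^^ i) y) > \<epsilon>))"

text \<open>Bowen's definition of the topological entropy of \<open>f\<close> restricted to \<open>K\<close>.\<close>

definition topological_entropy :: "('a::metric_space \<Rightarrow> 'a) \<Rightarrow> 'a set \<Rightarrow> ereal" where
  "topological_entropy f K =
     (SUP \<epsilon>\<in>{0<..}. limsup (\<lambda>n.
        SUP E\<in>{E. E \<subseteq> K \<and> finite E \<and> E \<noteq> {} \<and> dyn_separated f n \<epsilon> E}.
          ereal (ln (real (card E)) / real n)))"

section \<open>Generalized multimodal maps\<close>

definition generalized_multimodal ::
  "real set \<Rightarrow> (real \<Rightarrow> real) \<Rightarrow> real set \<Rightarrow> real set \<Rightarrow> real set \<Rightarrow> bool" where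
  "generalized_multimodal D f K IK U \<longleftrightarrow>
     open D \<and> C2_on f D \<and>
     finite (critical_points D f) \<and> (\<forall>c\<in>critical_points D f. non_flat D f c) \<and>
     infinite K \<and> compact K \<and> K \<subseteq> D \<and> f ` K = K \<and> transitive_on f K \<and>
     K \<subseteq> IK \<and> IK \<subseteq> D \<and>
     (\<forall>L. compact L \<and> L \<subseteq> IK \<and> f ` L \<subseteq> L \<longrightarrow> L \<subseteq> K) \<and>
     critical_points D f \<inter> (IK - K) = {} \<and>
     (\<exists>(m::nat) (a::nat \<Rightarrow> real) (b::nat \<Rightarrow> real) (V::nat \<Rightarrow> real set).
        IK = (\<Union>j<m. {a j..b j}) \<and> U = (\<Union>j<m. V j) \<and>
        disjoint_family_on (\<lambda>j. {a j..b j}) {..<m} \<and> disjoint_family_on V {..<m} \<and>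
        (\<forall>j<m. a j \<le> b j \<and> a j \<in> K \<and> b j \<in> K \<and>
               {a j..b j} \<subseteq> interior (V j) \<and> V j \<subseteq> D \<and>
               critical_points D f \<inter> (V j - K) = {}))"

definition generalized_multimodal_pos_entropy ::
  "real set \<Rightarrow> (real \<Rightarrow> real) \<Rightarrow> real set \<Rightarrow> real set \<Rightarrow> real set \<Rightarrow> bool" where
  "generalized_multimodal_pos_entropy D f K IK U \<longleftrightarrow>
     generalized_multimodal D f K IK U \<and> topological_entropy f K > 0"

section \<open>Bounded distortion and weak isolation\<close>

definition scaled_nbhd :: "real \<Rightarrow> real set \<Rightarrow> real set \<Rightarrow> bool" where
  "scaled_nbhd \<epsilon> A B \<longleftrightarrow>
     is_interval A \<and> is_interval B \<and> bounded B \<and> A \<subseteq> B \<and>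
     card (components (B - A)) = 2 \<and>
     (\<forall>C\<in>components (B - A). measure lborel C = \<epsilon> * measure lborel A)"

text \<open>
  The sets \<open>I\<^sub>1'\<close> need not lie in \<open>U\<close>, only in the domain of the \<open>n\<close>-th iterate. Boundedness of
  \<open>I\<^sub>2\<close> is part of its length being at most \<open>\<delta>\<close>, because \<^const>\<open>measure\<close> is \<open>0\<close> on sets of
  infinite measure.
\<close>

definition bounded_distortion ::
  "real set \<Rightarrow> (real \<Rightarrow> real) \<Rightarrow> real set \<Rightarrow> real set \<Rightarrow> bool" where
  "bounded_distortion D f K U \<longleftrightarrow>
     (\<exists>\<delta>>0. \<forall>\<epsilon>>0. \<exists>C>0. \<forall>I\<^sub>1 I\<^sub>2 I\<^sub>1' I\<^sub>2' n.
        is_interval I\<^sub>1 \<and> is_interval I\<^sub>2 \<and> I\<^sub>1 \<subseteq> U \<and> I\<^sub>2 \<subseteq> U \<and> I\<^sub>1 \<inter> K \<noteq> {} \<and>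
        bounded I\<^sub>2 \<and> measure lborel I\<^sub>2 \<le> \<delta> \<and> n > 0 \<and>
        is_interval I\<^sub>1' \<and> I\<^sub>1 \<subseteq> I\<^sub>1' \<and> (\<forall>i<n. (f ^^ i) ` I\<^sub>1' \<subseteq> D) \<and>
        scaled_nbhd \<epsilon> I\<^sub>2 I\<^sub>2' \<and> C2_diffeo (f ^^ n) I\<^sub>1' I\<^sub>2' \<and> (f ^^ n) ` I\<^sub>1 = I\<^sub>2
        \<longrightarrow> (\<forall>x\<in>I\<^sub>1. \<forall>y\<in>I\<^sub>1. \<bar>deriv (f ^^ n) x\<bar> / \<bar>deriv (f ^^ n) y\<bar> \<le> C))"

definition weak_isolation :: "(real \<Rightarrow> real) \<Rightarrow> real set \<Rightarrow> real set \<Rightarrow> bool" where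
  "weak_isolation f K U \<longleftrightarrow>
     (\<exists>U'. open U' \<and> K \<subseteq> U' \<and> U' \<subseteq> U \<and>
        (\<forall>p n. n > 0 \<and> (f ^^ n) p = p \<and> (\<forall>i. (f ^^ i) p \<in> U') \<longrightarrow> (\<forall>i. (f ^^ i) p \<in> K)))"

section \<open>Lyapunov exponents\<close>

text \<open>The logarithm with \<open>log 0 = -\<infinity>\<close>; note that \<open>ln 0 = 0\<close> for the library function.\<close>

definition eln :: "real \<Rightarrow> ereal" where
  "eln r = (if r = 0 then -\<infinity> else ereal (ln r))"

definition invariant_prob_on :: "('a::topological_space \<Rightarrow> 'a) \<Rightarrow> 'a set \<Rightarrow> 'a measure \<Rightarrow> bool" where
  "invariant_prob_on f K \<mu> \<longleftrightarrow>
     prob_space \<mu> \<and> sets \<mu> = sets (restrict_space borel K) \<and>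
     f \<in> measurable \<mu> \<mu> \<and> distr \<mu> \<mu> f = \<mu>"

text \<open>
  The integral of \<open>log |f'|\<close> as the difference of the integrals of its positive and negative parts
  (\<^const>\<open>e2ennreal\<close> sends negative numbers to \<open>0\<close>). On a compact \<open>K\<close> the former is finite, so the
  difference is meaningful and lies in \<open>[-\<infinity>, \<infinity>)\<close>.
\<close>

definition measure_exponent :: "(real \<Rightarrow> real) \<Rightarrow> real measure \<Rightarrow> ereal" where
  "measure_exponent f \<mu> =
     enn2ereal (\<integral>\<^sup>+x. e2ennreal (eln \<bar>deriv f x\<bar>) \<partial>\<mu>)
     - enn2ereal (\<integral>\<^sup>+x. e2ennreal (- eln \<bar>deriv f x\<bar>) \<partial>\<mu>)"

definition chi_inf :: "(real \<Rightarrow> real) \<Rightarrow> real set \<Rightarrow> ereal" where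
  "chi_inf f K = (INF \<mu>\<in>{\<mu>. invariant_prob_on f K \<mu>}. measure_exponent f \<mu>)"

definition has_exponent_at :: "(real \<Rightarrow> real) \<Rightarrow> real \<Rightarrow> ereal \<Rightarrow> bool" where
  "has_exponent_at f x L \<longleftrightarrow>
     (\<lambda>n. eln \<bar>deriv (f ^^ n) x\<bar> / ereal (real n)) \<longlonglongrightarrow> L"

end

theory Submission
  imports Defs
begin

text \<open>
  Suppose \<open>\<chi>(x) < \<chi>\<^sub>i\<^sub>n\<^sub>f\<close>. It suffices to find a periodic orbit near \<open>K\<close> whose exponent is smaller than
  \<open>\<chi>\<^sub>i\<^sub>n\<^sub>f\<close>: by weak isolation it lies in \<open>K\<close> and carries an invariant measure. If \<open>\<chi>(x) < 0\<close>, a small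
  interval around \<open>x\<close> has short images forever, and transitivity forces a periodic orbit to pass through
  one of them.

  Let \<open>\<chi>(x) \<ge> 0\<close>. Because the limit exists, \<open>f'\<close> decays at most subexponentially along the orbit, so the
  interval \<open>J\<close> of radius \<open>e\<^bsup>-(\<chi>(x)+\<epsilon>)n\<^esup>\<close> around \<open>x\<close> is mapped by \<open>f\<^sup>n\<close> with bounded distortion onto a
  short interval. Let \<open>N \<ge> n\<close> be the first time at which \<open>f\<^sup>N(J)\<close> is longer than a fixed constant. An
  interval whose images stay short satisfies \<open>\<bar>(f\<^sup>N)'(z)\<bar> \<bar>J\<bar> \<le> e\<^bsup>\<theta>N+C\<^esup> \<bar>f\<^sup>N(J)\<bar>\<close> at \<^emph>\<open>every\<close> point \<open>z\<close>: a
  passage near a critical point costs a constant factor (non-flatness) and such passages are rare. Hence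
  every periodic point of period about \<open>N\<close> in \<open>J\<close> has exponent at most about \<open>\<chi>(x)\<close>, and it remains to
  return from the long interval \<open>f\<^sup>N(J)\<close> to \<open>J\<close> in \<open>O(\<epsilon>N)\<close> steps.

  If \<open>f\<^sup>N(J)\<close> contains a point of \<open>K\<close> away from its ends, transitivity gives a return in bounded time, as
  the images of an interval around a point of \<open>K\<close> cover all but finitely many points of \<open>K\<close>. Otherwise
  \<open>f\<^sup>N(J)\<close> is mostly a gap of \<open>K\<close>. By maximality of \<open>K\<close> in \<open>IK\<close> no gap stays in \<open>IK\<close> forever, so an
  end \<open>a\<close> of the gap is preperiodic or the images of the gap next to \<open>a\<close> eventually meet \<open>K\<close>. In the first
  case \<open>a\<close> falls on a repelling periodic orbit, whose expansion enlarges the exponentially small part of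
  \<open>f\<^sup>N(J)\<close> beyond \<open>a\<close> to a fixed size within \<open>O(\<epsilon>N)\<close> steps.
\<close>

section \<open>Iterates on the line\<close>

text \<open>What forces this route is that nothing controls the distortion of f^N on J once N
  exceeds n. So the derivative at the periodic point is never compared with the one at x beyond time
  n: it is bounded by the ratio of the lengths of f^(N-1)(J) and J, up to a subexponential factor,
  and \<Lambda> = \<chi>(x) enters only through |J|. The limit is used again at time N: a smaller
  interval inside J, of radius e^(-(\<Lambda>+6\<epsilon>)N), has an image containing the
  e^(-8\<epsilon>N)-neighbourhood of f^N(x). This is the only lower bound at hand when f^N(J) is
  mostly a gap.

  The case \<Lambda> \<ge> 0 is by contradiction: if all periodic orbits in \<open>K\<close> had
  exponent above some c > \<Lambda>, they would be repelling, no critical point would be periodic,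
  and the orbit of x would be infinite. These facts give the enlargement next to a gap, the rarity
  of passages near critical points, and the return to J. Since finitely many points of
  \<open>K\<close> may stay uncovered, J is centred not at x itself but at an iterate of x that is
  covered from all over \<open>K\<close>.\<close>

definition nbhd :: "real set \<Rightarrow> real \<Rightarrow> real set" where
  "nbhd K r = (\<Union>k\<in>K. ball k r)"

text \<open>
  The derivative of \<open>f\<^sup>n\<close> at \<open>x\<close> as long as the orbit of \<open>x\<close> stays in the domain of \<open>f\<close>. Unlike
  \<^term>\<open>deriv (f ^^ n)\<close>, it satisfies the chain rule unconditionally.
\<close>

definition dn :: "(real \<Rightarrow> real) \<Rightarrow> nat \<Rightarrow> real \<Rightarrow> real" where
  "dn f n x = (\<Prod>i<n. deriv f ((f ^^ i) x))"

lemma funpow_add_apply: "(f ^^ (m + n)) x = (f ^^ m) ((f ^^ n) x)"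
  by (simp add: funpow_add)

lemma dn_0 [simp]: "dn f 0 x = 1"
  by (simp add: dn_def)

lemma dn_add: "dn f (m + n) x = dn f n x * dn f m ((f ^^ n) x)"
proof (induction m)
  case (Suc m)
  have "dn f (Suc m + n) x = dn f (m + n) x * deriv f ((f ^^ (m + n)) x)"
    by (simp add: dn_def)
  then show ?case
    using Suc by (simp add: dn_def funpow_add_apply)
qed simp

lemma dn_Suc: "dn f (Suc n) x = dn f n x * deriv f ((f ^^ n) x)"
  by (simp add: dn_def)

lemma funpow_period: "(f ^^ s) p = p \<Longrightarrow> (f ^^ (s * j)) p = p"
  by (induction j) (simp_all add: funpow_add_apply)

lemma dn_period: "(f ^^ s) p = p \<Longrightarrow> dn f (s * j) p = dn f s p ^ j"
proof (induction j)
  case (Suc j)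
  then show ?case
    using funpow_period[OF Suc.prems, of j] by (simp add: dn_add)
qed simp

lemma has_derivative_funpow:
  assumes "\<And>x. x \<in> D \<Longrightarrow> (f has_real_derivative deriv f x) (at x)"
    and "\<And>i. i < n \<Longrightarrow> (f ^^ i) x \<in> D"
  shows "((f ^^ n) has_real_derivative dn f n x) (at x)"
  using assms(2)
proof (induction n)
  case 0
  then show ?case by (simp add: id_def)
next
  case (Suc n)
  have "((f \<circ> (f ^^ n)) has_real_derivative deriv f ((f ^^ n) x) * dn f n x) (at x)"
    using Suc assms(1) by (intro DERIV_chain) auto
  then show ?case by (simp add: dn_Suc mult.commute o_def)
qed

text \<open>Comparing derivatives along an orbit loses a constant factor. For the multiplier
  \<open>a\<close> of a periodic orbit the factor disappears on passing to \<open>j\<close> turns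
  and letting \<open>j\<close> grow.\<close>

lemma abs_le_exp_of_powers:
  assumes "\<And>j::nat. \<bar>a\<bar> ^ j \<le> C * exp (c * real j)"
  shows "\<bar>a\<bar> \<le> exp c"
proof (rule ccontr)
  assume "\<not> \<bar>a\<bar> \<le> exp c"
  then have "1 < \<bar>a\<bar> / exp c" by simp
  then obtain j where "C < (\<bar>a\<bar> / exp c) ^ j" using real_arch_pow by blast
  then have "C * exp (c * real j) < \<bar>a\<bar> ^ j"
    by (simp add: power_divide pos_less_divide_eq exp_of_nat_mult[symmetric] mult.commute)
  then show False using assms[of j] by simp
qed

text \<open>Between the last visit to one end value and the next visit to the other, the
  intermediate value theorem keeps \<open>g\<close> inside \<open>{c..d}\<close>. This turns
  "covers" into "is mapped exactly onto", which is what makes coverings composable.\<close>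

lemma exact_subinterval:
  fixes g :: "real \<Rightarrow> real"
  assumes "continuous_on {u..v} g" "{c..d} \<subseteq> g ` {u..v}" "c \<le> d"
  obtains u' v' where "u' \<le> v'" "{u'..v'} \<subseteq> {u..v}" "g ` {u'..v'} = {c..d}"
proof -
  have *: "\<exists>u' v'. u' \<le> v' \<and> {u'..v'} \<subseteq> {p..q} \<and> h ` {u'..v'} = {c..d}"
    if h: "continuous_on {p..q} h" and pq: "p \<le> q" "h p = c" "h q = d" for h :: "real \<Rightarrow> real" and p q
  proof -
    define A where "A = {t \<in> {p..q}. h t = c}"
    have "closed A" unfolding A_def
      by (rule continuous_closed_preimage_constant[OF h]) simp
    moreover have "p \<in> A" "bdd_above A" using pq by (auto simp: A_def)
    ultimately have sA: "Sup A \<in> A" using closed_contains_Sup by blast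
    \<comment> \<open>\<open>u'\<close> is the last time at which the value is \<open>c\<close>;
      \<open>v'\<close> below is the first later time at which it is \<open>d\<close>.\<close>
    define u' where "u' = Sup A"
    have u': "p \<le> u'" "u' \<le> q" "h u' = c" using sA by (auto simp: A_def u'_def)
    define B where "B = {t \<in> {u'..q}. h t = d}"
    have hu: "continuous_on {u'..q} h" using h u' continuous_on_subset by fastforce
    have "closed B" unfolding B_def
      by (rule continuous_closed_preimage_constant[OF hu]) simp
    moreover have "q \<in> B" "bdd_below B" using pq u' by (auto simp: B_def)
    ultimately have sB: "Inf B \<in> B" using closed_contains_Inf by blast
    define v' where "v' = Inf B"
    have v': "u' \<le> v'" "v' \<le> q" "h v' = d" using sB by (auto simp: B_def v'_def)
    have hv: "continuous_on {s..t} h" if "u' \<le> s" "t \<le> v'" for s t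
      using hu v' that continuous_on_subset[of "{u'..q}" h "{s..t}"] by auto
    have "h t \<in> {c..d}" if t: "t \<in> {u'..v'}" for t
    proof (rule ccontr)
      assume "h t \<notin> {c..d}"
      then consider "h t < c" | "d < h t" by fastforce
      then show False
      proof cases
        case 1
        have "\<exists>s\<ge>t. s \<le> v' \<and> h s = c"
          using IVT'[of h t c v'] 1 t v' \<open>c \<le> d\<close> hv[of t v'] by auto
        then obtain s where s: "t \<le> s" "s \<le> v'" "h s = c" by auto
        then have "s \<in> A" using t v' u' by (auto simp: A_def)
        then have "s \<le> u'" unfolding u'_def using \<open>bdd_above A\<close> cSup_upper by blast
        then have "t = u'" using s t by auto
        then show False using 1 u' by auto
      next
        case 2
        have "\<exists>s\<ge>u'. s \<le> t \<and> h s = d"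
          using IVT'[of h u' d t] 2 t u' \<open>c \<le> d\<close> hv[of u' t] by auto
        then obtain s where s: "u' \<le> s" "s \<le> t" "h s = d" by auto
        then have "s \<in> B" using t v' u' by (auto simp: B_def)
        then have "v' \<le> s" unfolding v'_def using \<open>bdd_below B\<close> cInf_lower by blast
        then have "t = v'" using s t by auto
        then show False using 2 v' by auto
      qed
    qed
    moreover have "\<exists>s\<in>{u'..v'}. h s = y" if "y \<in> {c..d}" for y
    proof -
      have "\<exists>s\<ge>u'. s \<le> v' \<and> h s = y"
        by (rule IVT') (use that u' v' hv[of u' v'] in auto)
      then show ?thesis by auto
    qed
    ultimately have "h ` {u'..v'} = {c..d}" by blast
    then show ?thesis using u' v' by (intro exI[of _ u'] exI[of _ v']) auto
  qed
  obtain p q where pq: "p \<in> {u..v}" "g p = c" "q \<in> {u..v}" "g q = d"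
  proof -
    have "c \<in> g ` {u..v}" "d \<in> g ` {u..v}" using assms(2,3) by auto
    then show ?thesis using that by blast
  qed
  show thesis
  proof (cases "p \<le> q")
    case True
    have "continuous_on {p..q} g" using assms(1) pq continuous_on_subset[of "{u..v}" g "{p..q}"] by auto
    from *[OF this True pq(2,4)] obtain u' v' where
      uv: "u' \<le> v'" "{u'..v'} \<subseteq> {p..q}" "g ` {u'..v'} = {c..d}" by blast
    have "{u'..v'} \<subseteq> {u..v}" using uv(2) pq by force
    then show thesis using that uv by blast
  next
    case False
    \<comment> \<open>If the value \<open>d\<close> comes first, reflect the line and use the same
      construction.\<close>
    have "continuous_on {-p..-q} (\<lambda>t. g (- t))"
      by (rule continuous_on_compose2[OF assms(1)]) (use pq in \<open>auto intro!: continuous_intros\<close>)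
    from *[OF this] False pq obtain u' v' where
      uv: "u' \<le> v'" "{u'..v'} \<subseteq> {-p..-q}" "(\<lambda>t. g (- t)) ` {u'..v'} = {c..d}" by fastforce
    have "{-v'..-u'} = uminus ` {u'..v'}" by simp
    then have "g ` {-v'..-u'} = {c..d}"
      using uv(3) by (simp only: image_image)
    moreover have "{-v'..-u'} \<subseteq> {u..v}" using uv(1,2) pq by auto
    ultimately show thesis using that[of "-v'" "-u'"] uv(1) by simp
  qed
qed

text \<open>The radius \<open>r\<close> is below the scale of weak isolation, so periodic orbits
  staying near \<open>K\<close> lie in \<open>K\<close>. The Lipschitz bound is asked only along
  segments because \<open>nbhd K r\<close> may be disconnected. \<open>1 \<le> M\<close> makes
  \<open>ln M\<close> a nonnegative cost per step of a return.\<close>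

locale multimodal_nbhd =
  fixes D :: "real set" and f :: "real \<Rightarrow> real" and K IK U :: "real set" and r M L :: real
  assumes gm: "generalized_multimodal D f K IK U"
    and r_pos: "0 < r" and M_ge: "1 \<le> M" and L_pos: "0 < L"
    and nbhd_subset_U: "nbhd K r \<subseteq> U"
    and isolated: "\<And>p n. n > 0 \<Longrightarrow> (f ^^ n) p = p \<Longrightarrow> (\<And>i. (f ^^ i) p \<in> nbhd K r) \<Longrightarrow> p \<in> K"
    and deriv_bound: "\<And>y. y \<in> nbhd K r \<Longrightarrow> \<bar>deriv f y\<bar> \<le> M"
    and deriv_lipschitz:
      "\<And>y z. closed_segment y z \<subseteq> nbhd K r \<Longrightarrow> \<bar>deriv f y - deriv f z\<bar> \<le> L * \<bar>y - z\<bar>"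

lemma C2_on_deriv:
  assumes "C2_on f D" "open D"
  shows "\<And>x. x \<in> D \<Longrightarrow> (f has_real_derivative deriv f x) (at x)"
    and "\<exists>f''. (\<forall>x\<in>D. (deriv f has_real_derivative f'' x) (at x)) \<and> continuous_on D f''"
proof -
  obtain f' f'' where *: "\<forall>x\<in>D. (f has_real_derivative f' x) (at x within D)"
      "\<forall>x\<in>D. (f' has_real_derivative f'' x) (at x within D)" "continuous_on D f''"
    using assms(1) unfolding C2_on_def by blast
  have f': "(f has_real_derivative f' x) (at x)" if "x \<in> D" for x
    using * that at_within_open[OF that assms(2)] by metis
  then have eq: "deriv f x = f' x" if "x \<in> D" for x
    using that DERIV_imp_deriv by blast
  show "(f has_real_derivative deriv f x) (at x)" if "x \<in> D" for x
    using f' eq that by simp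
  have "(deriv f has_real_derivative f'' x) (at x)" if "x \<in> D" for x
  proof -
    have "(f' has_real_derivative f'' x) (at x)"
      using * that at_within_open[OF that assms(2)] by metis
    then show ?thesis
      by (rule has_field_derivative_transform_within_open[OF _ assms(2) that]) (simp add: eq)
  qed
  then show "\<exists>f''. (\<forall>x\<in>D. (deriv f has_real_derivative f'' x) (at x)) \<and> continuous_on D f''"
    using * by blast
qed

lemma generalized_multimodalD:
  assumes "generalized_multimodal D f K IK U"
  shows "open D" "C2_on f D" "finite (critical_points D f)"
    "\<forall>c\<in>critical_points D f. non_flat D f c" "infinite K" "compact K" "K \<subseteq> D" "f ` K = K"
    "transitive_on f K" "K \<subseteq> IK" "IK \<subseteq> D"
    "\<forall>C. compact C \<and> C \<subseteq> IK \<and> f ` C \<subseteq> C \<longrightarrow> C \<subseteq> K"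
    "critical_points D f \<inter> (IK - K) = {}"
  using assms unfolding generalized_multimodal_def by - (elim conjE, assumption)+

lemma generalized_multimodal_intervals:
  assumes "generalized_multimodal D f K IK U"
  shows "\<exists>(m::nat) a b. IK = (\<Union>j<m. {a j..b j}) \<and> (\<forall>j<m. a j \<le> b j \<and> a j \<in> K \<and> b j \<in> K)"
    and "U \<subseteq> D" and "critical_points D f \<inter> U \<subseteq> K"
proof -
  from assms obtain m :: nat and a b :: "nat \<Rightarrow> real" and V where *:
    "IK = (\<Union>j<m. {a j..b j})" "U = (\<Union>j<m. V j)"
    "\<forall>j<m. a j \<le> b j \<and> a j \<in> K \<and> b j \<in> K \<and>
               {a j..b j} \<subseteq> interior (V j) \<and> V j \<subseteq> D \<and>
               critical_points D f \<inter> (V j - K) = {}"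
    unfolding generalized_multimodal_def by (elim conjE exE) (rule that)
  show "\<exists>(m::nat) a b. IK = (\<Union>j<m. {a j..b j}) \<and> (\<forall>j<m. a j \<le> b j \<and> a j \<in> K \<and> b j \<in> K)"
    using *(1,3) by (intro exI[of _ m] exI[of _ a] exI[of _ b]) simp
  show "U \<subseteq> D" using *(2,3) by auto
  show "critical_points D f \<inter> U \<subseteq> K"
  proof
    fix c assume c: "c \<in> critical_points D f \<inter> U"
    then obtain j where "j < m" "c \<in> V j" using *(2) by auto
    then show "c \<in> K" using *(3) c by blast
  qed
qed

text \<open>Weak isolation supplies an open set around the compact \<open>K\<close>. Half of an
  admissible radius leaves room for a compact set between \<open>nbhd K r\<close> and that open set,
  on which the first two derivatives are bounded.\<close>

lemma multimodal_nbhd_exists: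
  assumes gm: "generalized_multimodal D f K IK U" and wi: "weak_isolation f K U"
  obtains r M L where "multimodal_nbhd D f K IK U r M L"
proof -
  note * = generalized_multimodalD[OF gm]
  obtain U' where U': "open U'" "K \<subseteq> U'" "U' \<subseteq> U"
    "\<forall>p n. n > 0 \<and> (f ^^ n) p = p \<and> (\<forall>i. (f ^^ i) p \<in> U') \<longrightarrow> (\<forall>i. (f ^^ i) p \<in> K)"
    using wi unfolding weak_isolation_def by (elim exE conjE) (rule that)
  obtain e where e: "0 < e" "(\<Union>k\<in>K. ball k e) \<subseteq> U'"
    using compact_subset_open_imp_ball_epsilon_subset[OF *(6) U'(1,2)] by blast
  define r where "r = e / 2"
  \<comment> \<open>The closed \<open>r\<close>-thickening of \<open>K\<close>, written as a sum of
    two compact sets so that its compactness is immediate.\<close>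
  define C where "C = {x + y | x y. x \<in> K \<and> y \<in> cball 0 r}"
  have "compact C" unfolding C_def by (intro compact_sums *(6) compact_cball)
  have CU: "C \<subseteq> U'"
    using e unfolding C_def r_def by (force simp: dist_norm)
  have NC: "nbhd K r \<subseteq> C"
  proof
    fix y assume "y \<in> nbhd K r"
    then obtain k where "k \<in> K" "dist k y < r" by (auto simp: nbhd_def)
    then have "y = k + (y - k)" "y - k \<in> cball 0 r" by (auto simp: dist_norm)
    then show "y \<in> C" using \<open>k \<in> K\<close> unfolding C_def by blast
  qed
  have CD: "C \<subseteq> D" using CU U'(3) generalized_multimodal_intervals[OF gm] by blast
  obtain f'' where f'': "\<And>x. x \<in> D \<Longrightarrow> (deriv f has_real_derivative f'' x) (at x)" "continuous_on D f''"
    using C2_on_deriv(2)[OF *(2) *(1)] by blast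
  have cd: "continuous_on D (deriv f)"
    using f''(1) DERIV_isCont continuous_at_imp_continuous_on by blast
  obtain B1 where B1: "\<And>y. y \<in> C \<Longrightarrow> \<bar>deriv f y\<bar> \<le> B1"
    using compact_imp_bounded[OF compact_continuous_image[OF continuous_on_subset[OF cd CD] \<open>compact C\<close>]]
    by (auto simp: bounded_iff)
  obtain B2 where B2: "\<And>y. y \<in> C \<Longrightarrow> \<bar>f'' y\<bar> \<le> B2"
    using compact_imp_bounded[OF compact_continuous_image[OF continuous_on_subset[OF f''(2) CD] \<open>compact C\<close>]]
    by (auto simp: bounded_iff)
  have "multimodal_nbhd D f K IK U r (max 1 B1) (max 1 B2)"
  proof
    show "nbhd K r \<subseteq> U" using NC CU U'(3) by blast
    show "p \<in> K" if "n > 0" "(f ^^ n) p = p" "\<And>i. (f ^^ i) p \<in> nbhd K r" for p n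
    proof -
      have "\<forall>i. (f ^^ i) p \<in> U'" using that(3) NC CU by blast
      then have "(f ^^ 0) p \<in> K" using U'(4)[rule_format, of n p 0] that(1,2) by simp
      then show ?thesis by simp
    qed
    show "\<bar>deriv f y\<bar> \<le> max 1 B1" if "y \<in> nbhd K r" for y
      using B1 NC that by fastforce
    show "\<bar>deriv f y - deriv f z\<bar> \<le> max 1 B2 * \<bar>y - z\<bar>" if "closed_segment y z \<subseteq> nbhd K r" for y z
    proof -
      have "norm (deriv f y - deriv f z) \<le> max 1 B2 * norm (y - z)"
      proof (rule field_differentiable_bound[OF convex_closed_segment])
        show "(deriv f has_field_derivative f'' w) (at w within closed_segment y z)"
          if "w \<in> closed_segment y z" for w
          using f''(1) that \<open>closed_segment y z \<subseteq> nbhd K r\<close> NC CD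
          by (meson has_field_derivative_at_within subsetD)
        show "norm (f'' w) \<le> max 1 B2" if "w \<in> closed_segment y z" for w
          using B2 that \<open>closed_segment y z \<subseteq> nbhd K r\<close> NC by fastforce
      qed auto
      then show ?thesis by simp
    qed
  qed (use gm e(1) in \<open>simp_all add: r_def\<close>)
  then show thesis by (rule that)
qed

section \<open>Periodic orbits as invariant measures\<close>

text \<open>The sum runs around the orbit and closes up, so shifting it only moves the first term to
  the end. This is the invariance of the orbit measure below.\<close>

lemma Suc_mod_image:
  assumes "(f ^^ n) p = p"
  shows "(\<Sum>i<n. g ((f ^^ Suc i) p)) = (\<Sum>i<n. (g ((f ^^ i) p) :: 'b::comm_monoid_add))"
proof (cases n)
  case (Suc m)
  have "(\<Sum>i<Suc m. g ((f ^^ Suc i) p)) = (\<Sum>i<m. g ((f ^^ Suc i) p)) + g ((f ^^ n) p)"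
    by (simp add: Suc)
  also have "\<dots> = g ((f ^^ 0) p) + (\<Sum>i<m. g ((f ^^ Suc i) p))"
    using assms by (simp add: add.commute)
  also have "\<dots> = (\<Sum>i<Suc m. g ((f ^^ i) p))"
    by (simp only: sum.lessThan_Suc_shift)
  finally show ?thesis by (simp add: Suc)
qed simp

context multimodal_nbhd
begin

lemmas gmD = generalized_multimodalD[OF gm]
lemmas K_inf = gmD(5) and K_compact = gmD(6) and K_D = gmD(7)
  and f_K = gmD(8) and trans_K = gmD(9)

lemma nbhd_D: "nbhd K r \<subseteq> D"
  using nbhd_subset_U generalized_multimodal_intervals(2)[OF gm] by blast

lemma K_nbhd: "K \<subseteq> nbhd K r"
  using r_pos by (auto simp: nbhd_def)

lemma open_nbhd: "open (nbhd K r)"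
  by (auto simp: nbhd_def)

lemma ball_nbhd: "k \<in> K \<Longrightarrow> \<bar>y - k\<bar> < r \<Longrightarrow> y \<in> nbhd K r"
  by (auto simp: nbhd_def dist_real_def abs_minus_commute)

lemma iter_K: "x \<in> K \<Longrightarrow> (f ^^ i) x \<in> K"
  using f_K by (induction i) auto

lemma iter_K_D: "x \<in> K \<Longrightarrow> (f ^^ i) x \<in> D"
  using iter_K K_D by blast

lemma f_deriv: "x \<in> D \<Longrightarrow> (f has_real_derivative deriv f x) (at x)"
  using C2_on_deriv(1)[OF gmD(2,1)] .

lemma deriv_cont: "continuous_on D (deriv f)"
proof -
  obtain f'' where "\<And>x. x \<in> D \<Longrightarrow> (deriv f has_real_derivative f'' x) (at x)"
    using C2_on_deriv(2)[OF gmD(2,1)] by blast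
  then show ?thesis
    using DERIV_isCont continuous_at_imp_continuous_on by blast
qed

lemma iter_deriv:
  assumes "\<And>i. i < n \<Longrightarrow> (f ^^ i) x \<in> D"
  shows "((f ^^ n) has_real_derivative dn f n x) (at x)"
  using has_derivative_funpow[of D f n x] f_deriv assms by blast

lemma iter_cont:
  assumes "\<And>i. i < n \<Longrightarrow> (f ^^ i) ` S \<subseteq> D"
  shows "continuous_on S (f ^^ n)"
proof (rule continuous_at_imp_continuous_on, rule ballI)
  fix x assume "x \<in> S"
  then have "\<And>i. i < n \<Longrightarrow> (f ^^ i) x \<in> D" using assms by blast
  then show "isCont (f ^^ n) x" by (rule DERIV_isCont[OF iter_deriv])
qed

lemma f_cont: "continuous_on D f"
  using f_deriv DERIV_isCont continuous_at_imp_continuous_on by blast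


text \<open>The measure equidistributed along the orbit has exponent
  \<open>ln \<bar>dn f n p\<bar> / n\<close>, read as minus infinity when the orbit meets a critical
  point.\<close>

lemma chi_inf_le_periodic:
  assumes p: "p \<in> K" and n: "n > 0" and per: "(f ^^ n) p = p"
    and le: "\<bar>dn f n p\<bar> \<le> exp (c * real n)"
  shows "chi_inf f K \<le> ereal c"
proof -
  define O' where "O' = restrict_space (borel :: real measure) K"
  have spO: "space O' = K" by (simp add: O'_def space_restrict_space)
  define g where "g = (\<lambda>i. (f ^^ i) p)"
  have gK: "g i \<in> K" for i using iter_K[OF p] by (simp add: g_def)
  \<comment> \<open>Uniform on times rather than on points: \<open>n\<close> need not be the least
    period, so points of the orbit may be repeated.\<close>
  define P where "P = uniform_count_measure {..<n}"
  have psP: "prob_space P"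
    unfolding P_def by (rule prob_space_uniform_count_measure) (use n in auto)
  have setsP: "sets P = Pow {..<n}" "space P = {..<n}"
    by (simp_all add: P_def sets_uniform_count_measure space_uniform_count_measure)
  define \<mu> where "\<mu> = distr P O' g"
  have gm': "g \<in> measurable P O'"
    by (rule measurableI) (use gK spO setsP in auto)
  interpret P: prob_space P by (rule psP)
  have ps: "prob_space \<mu>" unfolding \<mu>_def by (rule P.prob_space_distr[OF gm'])
  have nnP: "(\<integral>\<^sup>+i. h i \<partial>P) = (\<Sum>i<n. h i) / of_nat n" for h :: "nat \<Rightarrow> ennreal"
  proof -
    have "(\<integral>\<^sup>+i. h i \<partial>P) = (\<Sum>i<n. ennreal (1 / real n) * h i)"
      unfolding P_def uniform_count_measure_def
      by (subst nn_integral_point_measure_finite) (simp_all add: mult.commute)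
    also have "\<dots> = ennreal (1 / real n) * (\<Sum>i<n. h i)"
      by (simp add: sum_distrib_left)
    also have "ennreal (1 / real n) = 1 / of_nat n"
      using n by (simp add: ennreal_of_nat_eq_real_of_nat divide_ennreal[symmetric] flip: ennreal_1)
    finally show ?thesis by (simp add: divide_ennreal_def mult.commute)
  qed
  have nn: "(\<integral>\<^sup>+x. h x \<partial>\<mu>) = (\<Sum>i<n. h (g i)) / of_nat n" if "h \<in> borel_measurable O'" for h
    unfolding \<mu>_def using nn_integral_distr[OF gm', of h] that nnP by simp
  have fm: "f \<in> measurable O' O'"
  proof -
    have "continuous_on K f" using f_cont K_D continuous_on_subset by blast
    then have "f \<in> borel_measurable O'"
      unfolding O'_def by (rule borel_measurable_continuous_on_restrict)
    then show ?thesis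
      unfolding O'_def by (intro measurable_restrict_space2) (use f_K in \<open>auto simp: space_restrict_space\<close>)
  qed
  have inv: "distr \<mu> \<mu> f = \<mu>"
  proof (rule measure_eqI)
    show "sets (distr \<mu> \<mu> f) = sets \<mu>" by simp
    fix A assume "A \<in> sets (distr \<mu> \<mu> f)"
    then have A: "A \<in> sets O'" by (simp add: \<mu>_def)
    have fm': "f \<in> measurable \<mu> \<mu>" using fm by (simp add: \<mu>_def)
    have pre: "f -` A \<inter> space \<mu> \<in> sets O'"
      using measurable_sets[OF fm A] by (simp add: \<mu>_def)
    have e: "emeasure \<mu> B = (\<Sum>i<n. indicator B (g i)) / of_nat n" if "B \<in> sets O'" for B
    proof -
      have "emeasure \<mu> B = (\<integral>\<^sup>+x. indicator B x \<partial>\<mu>)"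
        using that by (simp add: \<mu>_def)
      also have "\<dots> = (\<Sum>i<n. indicator B (g i)) / of_nat n"
        using that by (intro nn) auto
      finally show ?thesis .
    qed
    have "emeasure (distr \<mu> \<mu> f) A = emeasure \<mu> (f -` A \<inter> space \<mu>)"
      by (rule emeasure_distr[OF fm']) (use A in \<open>simp add: \<mu>_def\<close>)
    also have "\<dots> = (\<Sum>i<n. indicator (f -` A \<inter> space \<mu>) (g i)) / of_nat n"
      by (rule e[OF pre])
    also have "(\<Sum>i<n. indicator (f -` A \<inter> space \<mu>) (g i)) = (\<Sum>i<n. indicator A ((f ^^ Suc i) p) :: ennreal)"
      using gK spO by (intro sum.cong) (auto simp: g_def \<mu>_def indicator_def)
    also have "\<dots> = (\<Sum>i<n. indicator A (g i))"
      unfolding g_def by (rule Suc_mod_image[OF per])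
    also have "\<dots> / of_nat n = emeasure \<mu> A" using e[OF A] by simp
    finally show "emeasure (distr \<mu> \<mu> f) A = emeasure \<mu> A" .
  qed
  have inv_prob: "invariant_prob_on f K \<mu>"
    unfolding invariant_prob_on_def using ps inv fm by (auto simp: \<mu>_def O'_def)
  have dm: "deriv f \<in> borel_measurable O'"
    unfolding O'_def by (rule borel_measurable_continuous_on_restrict)
      (use deriv_cont K_D continuous_on_subset in blast)
  have em: "(\<lambda>x. eln \<bar>deriv f x\<bar>) \<in> borel_measurable O'"
    unfolding eln_def using dm by measurable
  define u where "u = (\<lambda>i. \<bar>deriv f (g i)\<bar>)"
  have pos: "(\<integral>\<^sup>+x. e2ennreal (eln \<bar>deriv f x\<bar>) \<partial>\<mu>) = (\<Sum>i<n. e2ennreal (eln (u i))) / of_nat n"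
    unfolding u_def by (rule nn) (use em in measurable)
  have neg: "(\<integral>\<^sup>+x. e2ennreal (- eln \<bar>deriv f x\<bar>) \<partial>\<mu>) = (\<Sum>i<n. e2ennreal (- eln (u i))) / of_nat n"
    unfolding u_def by (rule nn) (use em in measurable)
  have prod_u: "(\<Prod>i<n. u i) = \<bar>dn f n p\<bar>"
    by (simp add: u_def g_def dn_def abs_prod)
  have "measure_exponent f \<mu> \<le> ereal c"
  proof (cases "\<exists>i<n. u i = 0")
    case True
    \<comment> \<open>The orbit meets a critical point: the negative part of the integral is
      infinite and the positive part finite, so the exponent is minus infinity.\<close>
    then obtain i where i: "i < n" "u i = 0" by blast
    have "(\<Sum>i<n. e2ennreal (- eln (u i))) = \<infinity>"
      using i by (auto simp: eln_def ennreal_sum_eq_top intro!: bexI[of _ i])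
    then have N: "(\<Sum>i<n. e2ennreal (- eln (u i))) / of_nat n = \<infinity>"
      by (simp only: infinity_ennreal_def ennreal_top_divide) simp
    have "(\<Sum>i<n. e2ennreal (eln (u i))) \<noteq> \<infinity>"
      by (auto simp: eln_def ennreal_sum_eq_top e2ennreal_neg)
    then have "(\<Sum>i<n. e2ennreal (eln (u i))) / of_nat n \<noteq> \<infinity>"
      using n by (simp add: ennreal_divide_eq_top_iff)
    then show ?thesis
      unfolding measure_exponent_def pos neg N
      by (cases "(\<Sum>i<n. e2ennreal (eln (u i))) / of_nat n") auto
  next
    case False
    then have up: "0 < u i" if "i < n" for i using that by (auto simp: u_def)
    define A B where "A = (\<Sum>i<n. max 0 (ln (u i)))" and "B = (\<Sum>i<n. max 0 (- ln (u i)))"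
    have AB: "0 \<le> A" "0 \<le> B" by (auto simp: A_def B_def intro!: sum_nonneg)
    have e: "e2ennreal (ereal t) = ennreal (max 0 t)" for t
      by (simp add: e2ennreal_ereal max_def ennreal_neg)
    have "(\<Sum>i<n. e2ennreal (eln (u i))) = (\<Sum>i<n. ennreal (max 0 (ln (u i))))"
      by (rule sum.cong) (auto simp: eln_def e dest: up)
    also have "\<dots> = ennreal A"
      unfolding A_def by (rule sum_ennreal) simp
    finally have PA: "(\<Sum>i<n. e2ennreal (eln (u i))) / of_nat n = ennreal (A / real n)"
      using n AB by (simp add: ennreal_of_nat_eq_real_of_nat divide_ennreal)
    have "(\<Sum>i<n. e2ennreal (- eln (u i))) = (\<Sum>i<n. ennreal (max 0 (- ln (u i))))"
      by (rule sum.cong) (auto simp: eln_def e dest: up)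
    also have "\<dots> = ennreal B"
      unfolding B_def by (rule sum_ennreal) simp
    finally have PB: "(\<Sum>i<n. e2ennreal (- eln (u i))) / of_nat n = ennreal (B / real n)"
      using n AB by (simp add: ennreal_of_nat_eq_real_of_nat divide_ennreal)
    \<comment> \<open>Positive and negative parts recombine to the logarithm of the product of the
      derivatives along the orbit.\<close>
    have "A - B = (\<Sum>i<n. ln (u i))"
      unfolding A_def B_def sum_subtractf[symmetric] by (rule sum.cong) auto
    also have "\<dots> = ln (\<Prod>i<n. u i)"
      by (subst ln_prod) (auto dest: up)
    also have "\<dots> \<le> ln (exp (c * real n))"
    proof (rule ln_mono)
      show "0 < (\<Prod>i<n. u i)" by (rule prod_pos) (auto dest: up)
    qed (use le prod_u in simp_all)
    finally have "(A - B) / real n \<le> c" using n by (simp add: pos_divide_le_eq)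
    then show ?thesis
      unfolding measure_exponent_def pos neg PA PB
      using AB n by (simp add: diff_divide_distrib)
  qed
  then show ?thesis
    unfolding chi_inf_def using inv_prob by (meson INF_lower2 mem_Collect_eq)
qed

end

section \<open>Expansion near non-flat critical points\<close>

text \<open>A lower bound for the variation of a power with the larger argument in the factor; no
  derivative is taken, so \<open>a = 0\<close> is allowed.\<close>

lemma powr_diff_ge:
  fixes a b d :: real
  assumes "0 \<le> a" "a \<le> b" "1 \<le> d"
  shows "b powr (d - 1) * (b - a) \<le> b powr d - a powr d"
proof -
  have *: "x powr d = x powr (d - 1) * x" if "0 \<le> x" for x :: real
    using that powr_mult_base[of x "d - 1"] by (cases "x = 0") (auto simp: mult.commute)
  have "a powr (d - 1) * a \<le> b powr (d - 1) * a"
    using assms by (intro mult_right_mono powr_mono2) auto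
  then show ?thesis using assms by (simp add: * algebra_simps)
qed

text \<open>The inverse is differentiable as well, so the chain rule for the composition, which is
  the identity, excludes a zero.\<close>

lemma diffeo_deriv_nonzero:
  assumes "C2_diffeo \<phi> W W'" "open W" "open W'" "c \<in> W"
  shows "deriv \<phi> c \<noteq> 0"
proof
  assume 0: "deriv \<phi> c = 0"
  from assms(1) have bij: "bij_betw \<phi> W W'" and C: "C2_on \<phi> W" "C2_on (the_inv_into W \<phi>) W'"
    by (auto simp: C2_diffeo_def)
  have "\<phi> c \<in> W'" using bij assms(4) by (auto simp: bij_betw_def)
  then have "((the_inv_into W \<phi> \<circ> \<phi>) has_real_derivative deriv (the_inv_into W \<phi>) (\<phi> c) * deriv \<phi> c) (at c)"
    using C2_on_deriv(1)[OF C(1) assms(2,4)] C2_on_deriv(1)[OF C(2) assms(3)] by (intro DERIV_chain) auto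
  moreover have "((the_inv_into W \<phi> \<circ> \<phi>) has_real_derivative 1) (at c)"
    by (rule has_field_derivative_transform_within_open[OF DERIV_ident assms(2,4)])
      (use bij in \<open>auto simp: bij_betw_def the_inv_into_f_f\<close>)
  ultimately show False using DERIV_unique 0 by fastforce
qed

text \<open>The diffeomorphism is multiplied by the sign of its derivative at \<open>c\<close> to
  become increasing, and the neighbourhood is shrunk until that derivative varies by less than half
  of its value at \<open>c\<close>; hence the factor 3 between the bounds.\<close>

lemma non_flat_local_form:
  assumes "non_flat D f c"
  obtains d g a \<rho> where "2 \<le> d" "0 < a" "0 < \<rho>" "ball c \<rho> \<subseteq> D" "g c = 0"
    "\<forall>x\<in>ball c \<rho>. \<bar>f x - f c\<bar> = \<bar>g x\<bar> powr d"
    "\<forall>x\<in>ball c \<rho>. \<exists>g'. (g has_real_derivative g') (at x) \<and> a \<le> g' \<and> g' \<le> 3 * a"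
proof -
  from assms obtain d \<phi> W W' where *: "2 \<le> d" "open W" "c \<in> W" "W \<subseteq> D" "open W'"
    "C2_diffeo \<phi> W W'" "\<phi> c = 0"
    "\<forall>x\<in>W. f x = \<bar>\<phi> x\<bar> powr d + f c \<or> f x = - (\<bar>\<phi> x\<bar> powr d) + f c"
    unfolding non_flat_def by (elim exE conjE) (rule that)
  have C: "C2_on \<phi> W" using *(6) by (simp add: C2_diffeo_def)
  note der = C2_on_deriv(1)[OF C *(2)]
  obtain \<phi>'' where "\<And>x. x \<in> W \<Longrightarrow> (deriv \<phi> has_real_derivative \<phi>'' x) (at x)"
    using C2_on_deriv(2)[OF C *(2)] by blast
  then have "isCont (deriv \<phi>) c" using *(3) DERIV_isCont by blast
  define A where "A = \<bar>deriv \<phi> c\<bar>"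
  have A: "0 < A" using diffeo_deriv_nonzero[OF *(6,2,5,3)] by (simp add: A_def)
  obtain \<rho>1 where r1: "0 < \<rho>1" "\<And>x. dist x c < \<rho>1 \<Longrightarrow> dist (deriv \<phi> x) (deriv \<phi> c) < A / 2"
    using \<open>isCont (deriv \<phi>) c\<close> A unfolding continuous_at_eps_delta by (meson half_gt_zero)
  obtain \<rho>2 where r2: "0 < \<rho>2" "ball c \<rho>2 \<subseteq> W" using *(2,3) open_contains_ball by blast
  define \<rho> where "\<rho> = min \<rho>1 \<rho>2"
  define s where "s = sgn (deriv \<phi> c)"
  have s: "s * deriv \<phi> c = A" "\<bar>s\<bar> = 1" using A by (auto simp: s_def A_def sgn_if)
  show thesis
  proof (rule that[of d "A / 2" \<rho> "\<lambda>x. s * \<phi> x"])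
    show "\<forall>x\<in>ball c \<rho>. \<bar>f x - f c\<bar> = \<bar>s * \<phi> x\<bar> powr d"
      using *(8) r2 s(2) by (force simp: \<rho>_def abs_mult)
    have "\<exists>g'. ((\<lambda>x. s * \<phi> x) has_real_derivative g') (at x) \<and> A / 2 \<le> g' \<and> g' \<le> 3 * (A / 2)"
      if x: "x \<in> ball c \<rho>" for x
    proof (intro exI conjI)
      have "x \<in> W" using x r2 by (auto simp: \<rho>_def)
      then show "((\<lambda>x. s * \<phi> x) has_real_derivative s * deriv \<phi> x) (at x)"
        by (intro DERIV_cmult der)
      have "\<bar>s * deriv \<phi> x - s * deriv \<phi> c\<bar> = \<bar>deriv \<phi> x - deriv \<phi> c\<bar>"
        using s(2) by (simp add: right_diff_distrib[symmetric] abs_mult)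
      also have "\<dots> < A / 2"
        using r1(2)[of x] x by (simp add: \<rho>_def dist_real_def abs_minus_commute)
      finally show "A / 2 \<le> s * deriv \<phi> x" "s * deriv \<phi> x \<le> 3 * (A / 2)"
        unfolding s(1) by linarith+
    qed
    then show "\<forall>x\<in>ball c \<rho>. \<exists>g'. ((\<lambda>x. s * \<phi> x) has_real_derivative g') (at x) \<and> A / 2 \<le> g' \<and> g' \<le> 3 * (A / 2)"
      by blast
  qed (use * r1 r2 A in \<open>auto simp: \<rho>_def\<close>)
qed

text \<open>Here |f'| is at most of order |g|^(d-1). The end of \<open>{u..v}\<close> farthest from
  \<open>c\<close> bounds |g| on the whole interval up to a constant, and the value of
  \<open>f\<close> there differs from that at another point of the interval by the amount needed.
  The interval may contain \<open>c\<close>.\<close>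

lemma non_flat_expansion:
  assumes nf: "non_flat D f c" and f': "\<And>x. x \<in> D \<Longrightarrow> (f has_real_derivative deriv f x) (at x)"
    and crit: "deriv f c = 0"
  obtains K\<^sub>0 \<rho> where "1 \<le> K\<^sub>0" "0 < \<rho>" "ball c \<rho> \<subseteq> D"
    "\<forall>u v z. u \<le> v \<longrightarrow> {u..v} \<subseteq> ball c \<rho> \<longrightarrow> z \<in> {u..v} \<longrightarrow>
      (\<exists>s\<in>{u..v}. \<exists>t\<in>{u..v}. \<bar>deriv f z\<bar> * (v - u) \<le> K\<^sub>0 * \<bar>f s - f t\<bar>)"
proof -
  obtain d g a \<rho> where g0: "2 \<le> d" "0 < a" "0 < \<rho>" "ball c \<rho> \<subseteq> D" "g c = 0"
    "\<forall>x\<in>ball c \<rho>. \<bar>f x - f c\<bar> = \<bar>g x\<bar> powr d"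
    "\<forall>x\<in>ball c \<rho>. \<exists>g'. (g has_real_derivative g') (at x) \<and> a \<le> g' \<and> g' \<le> 3 * a"
    by (rule non_flat_local_form[OF nf])
  note g = g0(1-5) bspec[OF g0(6)] bspec[OF g0(7)]
  have g_mono: "a * (y - x) \<le> g y - g x \<and> g y - g x \<le> 3 * a * (y - x)"
    if xy: "x \<in> ball c \<rho>" "y \<in> ball c \<rho>" "x \<le> y" for x y
  proof (cases "x = y")
    case False
    have sub: "{x..y} \<subseteq> ball c \<rho>" using xy by (auto simp: dist_real_def)
    define g' where "g' t = (SOME g'. (g has_real_derivative g') (at t) \<and> a \<le> g' \<and> g' \<le> 3 * a)" for t
    have g': "(g has_real_derivative g' t) (at t) \<and> a \<le> g' t \<and> g' t \<le> 3 * a" if "t \<in> {x..y}" for t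
      unfolding g'_def by (rule someI_ex) (use g(7) sub that in blast)
    obtain \<xi> where "x < \<xi>" "\<xi> < y" "g y - g x = (y - x) * g' \<xi>"
      using MVT2[of x y g g'] g' xy False by force
    then show ?thesis using g'[of \<xi>] xy
      by (auto simp: mult.commute intro!: mult_left_mono)
  qed simp
  have g_abs: "a * \<bar>x - c\<bar> \<le> \<bar>g x\<bar> \<and> \<bar>g x\<bar> \<le> 3 * a * \<bar>x - c\<bar> \<and> sgn (g x) = sgn (x - c)"
    if x: "x \<in> ball c \<rho>" for x
  proof -
    have c: "c \<in> ball c \<rho>" using g(3) by simp
    consider "x = c" | "c < x" | "x < c" by linarith
    then show ?thesis
    proof cases
      case 2
      then have "a * (x - c) \<le> g x" "g x \<le> 3 * a * (x - c)" "0 < a * (x - c)"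
        using g_mono[OF c x] g(2,5) by auto
      then show ?thesis using 2 by auto
    next
      case 3
      then have "a * (c - x) \<le> - g x" "- g x \<le> 3 * a * (c - x)" "0 < a * (c - x)"
        using g_mono[OF x c] g(2,5) by auto
      then show ?thesis using 3 by auto
    qed (use g in auto)
  qed
  have f'_le: "\<bar>deriv f z\<bar> \<le> d * (3 * a) * \<bar>g z\<bar> powr (d - 1)" if z: "z \<in> ball c \<rho>" for z
  proof (cases "z = c")
    case False
    \<comment> \<open>\<open>\<tau>\<close> and \<open>\<sigma>\<close> fix the side of
      \<open>c\<close> and the sign of \<open>f - f c\<close>. On the open set \<open>Y\<close>
      where both are constant, the absolute values disappear and \<open>f\<close> can be
      differentiated through the formula in \<open>eq\<close>.\<close>
    define \<tau> where "\<tau> = sgn (z - c)"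
    define \<sigma> where "\<sigma> = sgn (f z - f c)"
    define X where "X = ball c \<rho> \<inter> {y. 0 < \<tau> * (y - c)}"
    define Y where "Y = X \<inter> (\<lambda>y. \<sigma> * (f y - f c)) -` {0<..}"
    have "open X" unfolding X_def by (intro open_Int open_ball open_Collect_less continuous_intros)
    have "continuous_on X (\<lambda>y. \<sigma> * (f y - f c))"
    proof (intro continuous_intros)
      show "continuous_on X f"
        using f' g(4) DERIV_isCont unfolding X_def
        by (intro continuous_at_imp_continuous_on) blast
    qed
    then have "open Y" unfolding Y_def
      using \<open>open X\<close> by (intro continuous_open_preimage) auto
    have gz: "0 < \<bar>g z\<bar>"
    proof -
      have "0 < a * \<bar>z - c\<bar>" using g(2) False by simp
      then show ?thesis using g_abs[OF z] by linarith
    qed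
    then have "f z \<noteq> f c" using g(6)[OF z] by auto
    then have s: "\<bar>\<sigma>\<bar> = 1" "0 < \<sigma> * (f z - f c)" by (auto simp: \<sigma>_def sgn_if)
    have t: "\<bar>\<tau>\<bar> = 1" "0 < \<tau> * (z - c)" using False by (auto simp: \<tau>_def sgn_if)
    have zY: "z \<in> Y" using s t z by (auto simp: Y_def X_def)
    have eq: "\<sigma> * (\<tau> * g y) powr d + f c = f y" if "y \<in> Y" for y
    proof -
      have y: "y \<in> ball c \<rho>" "0 < \<tau> * (y - c)" "0 < \<sigma> * (f y - f c)" using that by (auto simp: Y_def X_def)
      have "\<tau> = sgn (y - c)" using t(1) y(2) unfolding \<tau>_def sgn_if by (auto split: if_splits)
      then have "\<tau> * g y = \<bar>g y\<bar>" using g_abs[OF y(1)] by (metis sgn_mult_abs mult.commute abs_sgn)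
      moreover have "\<sigma> * \<bar>f y - f c\<bar> = f y - f c"
        using y(3) s(1) by (auto simp: abs_if zero_less_mult_iff split: if_splits)
      ultimately show ?thesis using g(6)[OF y(1)] by simp
    qed
    obtain g' where g': "(g has_real_derivative g') (at z)" "a \<le> g'" "g' \<le> 3 * a" using g(7)[OF z] by blast
    have tg: "0 < \<tau> * g z"
      using g_abs[OF z] gz False unfolding \<tau>_def by (metis abs_sgn mult.commute)
    have "((\<lambda>y. \<sigma> * (\<tau> * g y) powr d + f c) has_real_derivative \<sigma> * (d * (\<tau> * g z) powr (d - 1) * (\<tau> * g'))) (at z)"
      using tg g'(1) by (auto intro!: derivative_eq_intros)
    then have "(f has_real_derivative \<sigma> * (d * (\<tau> * g z) powr (d - 1) * (\<tau> * g'))) (at z)"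
      by (rule has_field_derivative_transform_within_open[OF _ \<open>open Y\<close> zY eq])
    then have "deriv f z = \<sigma> * (d * (\<tau> * g z) powr (d - 1) * (\<tau> * g'))"
      by (rule DERIV_imp_deriv)
    moreover have "\<tau> * g z = \<bar>g z\<bar>" using tg t(1) by (metis abs_mult abs_of_pos mult_1)
    ultimately have "\<bar>deriv f z\<bar> = d * \<bar>g z\<bar> powr (d - 1) * \<bar>g'\<bar>"
      using s(1) t(1) g(1) by (simp add: abs_mult)
    also have "\<dots> \<le> d * \<bar>g z\<bar> powr (d - 1) * (3 * a)"
      using g' g(1,2) by (intro mult_left_mono) auto
    finally show ?thesis by (simp add: mult_ac)
  qed (use crit g in simp)
  \<comment> \<open>The factor 3 from the derivative of \<open>g\<close>,
    \<open>3 powr (d - 1)\<close> from comparing \<open>g z\<close> with \<open>g w\<close>, and 2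
    from \<open>v - u \<le> 2 * \<bar>w - t\<bar>\<close>.\<close>
  define K\<^sub>0 where "K\<^sub>0 = 6 * d * 3 powr (d - 1)"
  have p3: "1 \<le> (3::real) powr (d - 1)" using g(1) by (intro ge_one_powr_ge_zero) auto
  have K0: "1 \<le> K\<^sub>0" using g(1) p3 unfolding K\<^sub>0_def
    using mult_mono[of 1 "6 * d" 1 "3 powr (d - 1)"] by simp
  show thesis
  proof (rule that[OF K0 g(3,4)], intro allI impI)
    fix u v z assume uv: "u \<le> v" "{u..v} \<subseteq> ball c \<rho>" and z: "z \<in> {u..v}"
    \<comment> \<open>\<open>w\<close> is the end farther from \<open>c\<close>. \<open>t\<close> is
      \<open>c\<close> when the interval contains it and the other end otherwise, so
      \<open>t\<close> lies between \<open>c\<close> and \<open>w\<close>, and at least half of the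
      interval lies between \<open>t\<close> and \<open>w\<close>.\<close>
    define w where "w = (if \<bar>u - c\<bar> \<le> \<bar>v - c\<bar> then v else u)"
    define t where "t = (if c \<in> {u..v} then c else if w = v then u else v)"
    have w: "w \<in> {u..v}" "\<bar>z - c\<bar> \<le> \<bar>w - c\<bar>" using uv z by (auto simp: w_def)
    have t: "t \<in> {u..v}" "v - u \<le> 2 * \<bar>w - t\<bar>" "(c \<le> t \<and> t \<le> w) \<or> (w \<le> t \<and> t \<le> c)"
      using uv by (auto simp: t_def w_def split: if_splits)
    have b: "z \<in> ball c \<rho>" "w \<in> ball c \<rho>" "t \<in> ball c \<rho>" using uv z w(1) t(1) by blast+
    have gwt: "a * \<bar>w - t\<bar> \<le> \<bar>g w\<bar> - \<bar>g t\<bar>"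
    proof -
      have cb: "c \<in> ball c \<rho>" using g(3) by simp
      from t(3) show ?thesis
      proof
        assume A: "c \<le> t \<and> t \<le> w"
        then have "0 \<le> a * (t - c)" "0 \<le> a * (w - t)" using g(2) by auto
        then show ?thesis using A g_mono[OF cb b(3)] g_mono[OF b(3,2)] g(5) by auto
      next
        assume A: "w \<le> t \<and> t \<le> c"
        then have "0 \<le> a * (c - t)" "0 \<le> a * (t - w)" using g(2) by auto
        then show ?thesis using A g_mono[OF b(3) cb] g_mono[OF b(2,3)] g(5) by auto
      qed
    qed
    have gz: "\<bar>g z\<bar> \<le> 3 * \<bar>g w\<bar>"
    proof -
      have "\<bar>g z\<bar> \<le> 3 * (a * \<bar>z - c\<bar>)" using g_abs[OF b(1)] by simp
      also have "\<dots> \<le> 3 * (a * \<bar>w - c\<bar>)" using w(2) g(2) by simp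
      also have "\<dots> \<le> 3 * \<bar>g w\<bar>" using g_abs[OF b(2)] by simp
      finally show ?thesis .
    qed
    define G where "G = \<bar>g w\<bar> powr (d - 1)"
    have "\<bar>deriv f z\<bar> \<le> d * (3 * a) * \<bar>g z\<bar> powr (d - 1)" by (rule f'_le[OF b(1)])
    also have "\<dots> \<le> d * (3 * a) * (3 * \<bar>g w\<bar>) powr (d - 1)"
      using g(1,2) gz by (intro mult_left_mono powr_mono2) auto
    also have "\<dots> = d * (3 * a) * 3 powr (d - 1) * G" by (simp add: G_def powr_mult)
    finally have 1: "\<bar>deriv f z\<bar> \<le> d * (3 * a) * 3 powr (d - 1) * G" .
    have "G * (a * \<bar>w - t\<bar>) \<le> G * (\<bar>g w\<bar> - \<bar>g t\<bar>)"
      using gwt by (intro mult_left_mono) (auto simp: G_def)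
    also have "\<dots> \<le> \<bar>g w\<bar> powr d - \<bar>g t\<bar> powr d"
    proof -
      have "0 \<le> a * \<bar>w - t\<bar>" using g(2) by simp
      then show ?thesis
        unfolding G_def using gwt g(1) by (intro powr_diff_ge) linarith+
    qed
    also have "\<dots> = \<bar>f w - f c\<bar> - \<bar>f t - f c\<bar>" using g(6) b by simp
    also have "\<dots> \<le> \<bar>f w - f t\<bar>" by linarith
    finally have 2: "G * (a * \<bar>w - t\<bar>) \<le> \<bar>f w - f t\<bar>" .
    have "\<bar>deriv f z\<bar> * (v - u) \<le> (d * (3 * a) * 3 powr (d - 1) * G) * (2 * \<bar>w - t\<bar>)"
      by (rule mult_mono[OF 1 t(2)]) (use uv g(1,2) in \<open>auto simp: G_def\<close>)
    also have "\<dots> = K\<^sub>0 * (G * (a * \<bar>w - t\<bar>))" by (simp add: K\<^sub>0_def)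
    also have "\<dots> \<le> K\<^sub>0 * \<bar>f w - f t\<bar>" using K0 by (intro mult_left_mono[OF 2]) simp
    finally show "\<exists>s\<in>{u..v}. \<exists>t\<in>{u..v}. \<bar>deriv f z\<bar> * (v - u) \<le> K\<^sub>0 * \<bar>f s - f t\<bar>"
      using w(1) t(1) by blast
  qed
qed

section \<open>Growth of short intervals\<close>

text \<open>Elements at least \<open>m\<close> apart have different quotients by
  \<open>m\<close>.\<close>

lemma card_sparse_le:
  fixes A :: "nat set"
  assumes "A \<subseteq> {..<k}" "0 < m" "\<And>i j. i \<in> A \<Longrightarrow> j \<in> A \<Longrightarrow> i < j \<Longrightarrow> i + m \<le> j"
  shows "card A \<le> k div m + 1"
proof -
  have "inj_on (\<lambda>i. i div m) A"
  proof (rule linorder_inj_onI)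
    fix i j assume ij: "i < j" "i \<in> A" "j \<in> A"
    have "i div m < (i + m) div m" using assms(2) by simp
    also have "\<dots> \<le> j div m" using assms(3) ij by (intro div_le_mono) auto
    finally show "i div m \<noteq> j div m" by simp
  qed auto
  moreover have "(\<lambda>i. i div m) ` A \<subseteq> {..k div m}" using assms(1) by (auto intro!: div_le_mono)
  ultimately have "card A \<le> card {..k div m}" by (intro card_inj_on_le) auto
  then show ?thesis by simp
qed

lemma image_funpow_Suc: "(f ^^ Suc i) ` S = f ` ((f ^^ i) ` S)"
  by (simp add: image_comp)

lemma abs_diff_le_diameter:
  fixes S :: "real set"
  shows "bounded S \<Longrightarrow> x \<in> S \<Longrightarrow> y \<in> S \<Longrightarrow> \<bar>x - y\<bar> \<le> diameter S"
  using diameter_bounded_bound[of S x y] by (simp add: dist_real_def)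

context multimodal_nbhd
begin

definition crit :: "real set" where
  "crit = {c \<in> K. deriv f c = 0}"

lemma finite_crit: "finite crit"
proof -
  have "crit \<subseteq> critical_points D f" using K_D by (auto simp: crit_def critical_points_def)
  then show ?thesis using gmD(3) finite_subset by blast
qed

lemma crit_K: "c \<in> crit \<Longrightarrow> c \<in> K"
  by (simp add: crit_def)

lemma critI: "z \<in> nbhd K r \<Longrightarrow> deriv f z = 0 \<Longrightarrow> z \<in> crit"
  using generalized_multimodal_intervals(2,3)[OF gm] nbhd_subset_U
  by (auto simp: crit_def critical_points_def)

lemma iter_interval:
  assumes "u \<le> v" "\<And>i. i < n \<Longrightarrow> (f ^^ i) ` {u..v} \<subseteq> D"
  shows "\<exists>a b. a \<le> b \<and> (f ^^ n) ` {u..v} = {a..b}"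
  using continuous_image_closed_interval[OF assms(1) iter_cont[OF assms(2)]] by blast

text \<open>By induction, since only when the earlier images lie in the domain is the next one known
  to be a compact interval, whose diameter then bounds the distance to the orbit of a point of
  \<open>K\<close>.\<close>

lemma short_orbit:
  assumes uv: "u \<le> v" "{u..v} \<inter> K \<noteq> {}" and sh: "\<And>i. i < k \<Longrightarrow> diameter ((f ^^ i) ` {u..v}) < r"
  shows "i < k \<Longrightarrow> (f ^^ i) ` {u..v} \<subseteq> nbhd K r"
proof (induction i rule: less_induct)
  case (less i)
  obtain \<kappa> where \<kappa>: "\<kappa> \<in> K" "\<kappa> \<in> {u..v}" using uv(2) by blast
  have "\<And>j. j < i \<Longrightarrow> (f ^^ j) ` {u..v} \<subseteq> D"
    using less nbhd_D by (meson less_trans subset_trans)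
  then obtain a b where ab: "(f ^^ i) ` {u..v} = {a..b}" using iter_interval[OF uv(1), of i] by blast
  show ?case
  proof
    fix y assume y: "y \<in> (f ^^ i) ` {u..v}"
    have "\<bar>y - (f ^^ i) \<kappa>\<bar> \<le> diameter ((f ^^ i) ` {u..v})"
      using y \<kappa> by (intro abs_diff_le_diameter) (simp add: ab, assumption, blast)
    then show "y \<in> nbhd K r"
      using sh[OF less.prems] by (intro ball_nbhd[OF iter_K[OF \<kappa>(1), of i]]) auto
  qed
qed

lemma diameter_image_ge:
  assumes "{u..v} \<subseteq> D" "s \<in> {u..v}" "t \<in> {u..v}"
  shows "\<bar>f s - f t\<bar> \<le> diameter (f ` {u..v})"
proof -
  have "compact (f ` {u..v})"
    by (rule compact_continuous_image[OF continuous_on_subset[OF f_cont assms(1)]]) simp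
  then show ?thesis using assms by (intro abs_diff_le_diameter compact_imp_bounded) auto
qed

text \<open>Constants uniform over the finitely many critical points: the largest factor and the
  smallest radius. The inserted 1 covers the case of no critical points.\<close>

lemma near_crit_step:
  obtains K\<^sub>0 \<rho> where "1 \<le> K\<^sub>0" "0 < \<rho>"
    "\<forall>c\<in>crit. \<forall>u v z. u \<le> v \<longrightarrow> {u..v} \<subseteq> ball c \<rho> \<longrightarrow> z \<in> {u..v} \<longrightarrow>
      \<bar>deriv f z\<bar> * (v - u) \<le> K\<^sub>0 * diameter (f ` {u..v})"
proof -
  have "\<forall>c\<in>crit. \<exists>p. 1 \<le> fst p \<and> 0 < snd p \<and> (\<forall>u v z. u \<le> v \<longrightarrow> {u..v} \<subseteq> ball c (snd p) \<longrightarrow> z \<in> {u..v} \<longrightarrow>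
      \<bar>deriv f z\<bar> * (v - u) \<le> fst p * diameter (f ` {u..v}))"
  proof
    fix c assume c: "c \<in> crit"
    then have nf: "non_flat D f c"
      using gmD(4) K_D by (auto simp: crit_def critical_points_def)
    have 0: "deriv f c = 0" using c by (simp add: crit_def)
    obtain K\<^sub>0 \<rho> where *: "1 \<le> K\<^sub>0" "0 < \<rho>" "ball c \<rho> \<subseteq> D"
      "\<forall>u v z. u \<le> v \<longrightarrow> {u..v} \<subseteq> ball c \<rho> \<longrightarrow> z \<in> {u..v} \<longrightarrow>
      (\<exists>s\<in>{u..v}. \<exists>t\<in>{u..v}. \<bar>deriv f z\<bar> * (v - u) \<le> K\<^sub>0 * \<bar>f s - f t\<bar>)"
      by (rule non_flat_expansion[OF nf f_deriv 0])
    have "\<bar>deriv f z\<bar> * (v - u) \<le> K\<^sub>0 * diameter (f ` {u..v})"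
      if uv: "u \<le> v" "{u..v} \<subseteq> ball c \<rho>" "z \<in> {u..v}" for u v z
    proof -
      obtain s t where st: "s \<in> {u..v}" "t \<in> {u..v}" "\<bar>deriv f z\<bar> * (v - u) \<le> K\<^sub>0 * \<bar>f s - f t\<bar>"
        using *(4)[rule_format, OF uv] by blast
      have "\<bar>f s - f t\<bar> \<le> diameter (f ` {u..v})"
        by (rule diameter_image_ge) (use uv *(3) st in auto)
      then have "K\<^sub>0 * \<bar>f s - f t\<bar> \<le> K\<^sub>0 * diameter (f ` {u..v})" using *(1) by simp
      then show ?thesis using st(3) by linarith
    qed
    then show "\<exists>p. 1 \<le> fst p \<and> 0 < snd p \<and> (\<forall>u v z. u \<le> v \<longrightarrow> {u..v} \<subseteq> ball c (snd p) \<longrightarrow> z \<in> {u..v} \<longrightarrow>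
      \<bar>deriv f z\<bar> * (v - u) \<le> fst p * diameter (f ` {u..v}))"
      using *(1,2) by (intro exI[of _ "(K\<^sub>0, \<rho>)"]) simp
  qed
  from bchoice[OF this] obtain p where p: "\<And>c. c \<in> crit \<Longrightarrow> 1 \<le> fst (p c) \<and> 0 < snd (p c) \<and>
      (\<forall>u v z. u \<le> v \<longrightarrow> {u..v} \<subseteq> ball c (snd (p c)) \<longrightarrow> z \<in> {u..v} \<longrightarrow>
      \<bar>deriv f z\<bar> * (v - u) \<le> fst (p c) * diameter (f ` {u..v}))" by blast
  define K\<^sub>0 where "K\<^sub>0 = Max (insert 1 ((\<lambda>c. fst (p c)) ` crit))"
  define \<rho> where "\<rho> = Min (insert 1 ((\<lambda>c. snd (p c)) ` crit))"
  show thesis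
  proof (rule that[of K\<^sub>0 \<rho>])
    show "1 \<le> K\<^sub>0" unfolding K\<^sub>0_def using finite_crit by (intro Max_ge) auto
    show "0 < \<rho>" unfolding \<rho>_def using finite_crit p by (subst Min_gr_iff) auto
    have "\<bar>deriv f z\<bar> * (v - u) \<le> K\<^sub>0 * diameter (f ` {u..v})"
      if c: "c \<in> crit" and uv: "u \<le> v" "{u..v} \<subseteq> ball c \<rho>" "z \<in> {u..v}" for c u v z
    proof -
      have 1: "\<rho> \<le> snd (p c)" unfolding \<rho>_def using finite_crit c by (intro Min_le) auto
      have 2: "fst (p c) \<le> K\<^sub>0" unfolding K\<^sub>0_def using finite_crit c by (intro Max_ge) auto
      have "{u..v} \<subseteq> ball c (snd (p c))" using uv(2) 1 by force
      then have "\<bar>deriv f z\<bar> * (v - u) \<le> fst (p c) * diameter (f ` {u..v})" using p[OF c] uv by blast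
      also have "\<dots> \<le> K\<^sub>0 * diameter (f ` {u..v})"
      proof (rule mult_right_mono[OF 2])

        show "0 \<le> diameter (f ` {u..v})"
        proof (cases "u = v")
          case False
          then have "0 \<le> \<bar>deriv f z\<bar> * (v - u)" using uv(1) by simp
          then have "0 \<le> fst (p c) * diameter (f ` {u..v})"
            using \<open>\<bar>deriv f z\<bar> * (v - u) \<le> fst (p c) * diameter (f ` {u..v})\<close> by linarith
          then show ?thesis using p[OF c] by (simp add: zero_le_mult_iff)
        qed simp
      qed
      finally show ?thesis .
    qed
    then show "\<forall>c\<in>crit. \<forall>u v z. u \<le> v \<longrightarrow> {u..v} \<subseteq> ball c \<rho> \<longrightarrow> z \<in> {u..v} \<longrightarrow>
      \<bar>deriv f z\<bar> * (v - u) \<le> K\<^sub>0 * diameter (f ` {u..v})" by blast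
  qed
qed

text \<open>Off the balls around the critical points |f'| is bounded below on \<open>K\<close> by
  compactness. On intervals short compared with this bound f' is nearly constant, and the mean value
  theorem loses only the factor \<open>exp \<eta>\<close>.\<close>

lemma away_crit_step:
  assumes \<eta>: "0 < \<eta>" and \<rho>: "0 < \<rho>"
  obtains r\<^sub>1 where "0 < r\<^sub>1"
    "\<forall>u v z. u \<le> v \<longrightarrow> {u..v} \<subseteq> nbhd K r \<longrightarrow> {u..v} \<inter> K \<noteq> {} \<longrightarrow>
      (\<forall>c\<in>crit. {u..v} \<inter> ball c \<rho> = {}) \<longrightarrow> v - u \<le> r\<^sub>1 \<longrightarrow> z \<in> {u..v} \<longrightarrow>
      \<bar>deriv f z\<bar> * (v - u) \<le> exp \<eta> * diameter (f ` {u..v})"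
proof -
  define A where "A = K - (\<Union>c\<in>crit. ball c \<rho>)"
  have "compact A" unfolding A_def using K_compact by (intro compact_diff) auto
  moreover have "continuous_on A (\<lambda>x. \<bar>deriv f x\<bar>)"
    by (intro continuous_intros continuous_on_subset[OF deriv_cont]) (use K_D in \<open>auto simp: A_def\<close>)
  moreover have "0 < \<bar>deriv f x\<bar>" if "x \<in> A" for x
    using that \<rho> by (force simp: A_def crit_def)
  ultimately obtain m where m: "0 < m" "\<And>x. x \<in> A \<Longrightarrow> m \<le> \<bar>deriv f x\<bar>"
  proof (cases "A = {}")
    case False
    then obtain x where "x \<in> A" "\<And>y. y \<in> A \<Longrightarrow> \<bar>deriv f x\<bar> \<le> \<bar>deriv f y\<bar>"
      using continuous_attains_inf[OF \<open>compact A\<close> False \<open>continuous_on A (\<lambda>x. \<bar>deriv f x\<bar>)\<close>] by blast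
    then show ?thesis using that[of "\<bar>deriv f x\<bar>"] \<open>\<And>x. x \<in> A \<Longrightarrow> 0 < \<bar>deriv f x\<bar>\<close> by blast
  qed (use that[of 1] in auto)
  \<comment> \<open>The first bound keeps |f'| above \<open>m / 2\<close> on the interval, the
    second makes its variation at most \<open>\<eta>\<close> times that.\<close>
  define r\<^sub>1 where "r\<^sub>1 = min (m / (2 * L)) (\<eta> * m / (2 * L))"
  have r1: "0 < r\<^sub>1" "L * r\<^sub>1 \<le> m / 2" "L * r\<^sub>1 \<le> \<eta> * (m / 2)"
  proof -
    show "0 < r\<^sub>1" using m \<eta> L_pos by (simp add: r\<^sub>1_def)
    have "L * r\<^sub>1 \<le> L * (m / (2 * L))" using L_pos by (intro mult_left_mono) (auto simp: r\<^sub>1_def)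
    then show "L * r\<^sub>1 \<le> m / 2" using L_pos by simp
    have "L * r\<^sub>1 \<le> L * (\<eta> * m / (2 * L))" using L_pos by (intro mult_left_mono) (auto simp: r\<^sub>1_def)
    then show "L * r\<^sub>1 \<le> \<eta> * (m / 2)" using L_pos by simp
  qed
  show thesis
  proof (rule that[OF r1(1)], intro allI impI)
    fix u v z assume uv: "u \<le> v" "{u..v} \<subseteq> nbhd K r" "{u..v} \<inter> K \<noteq> {}"
      "\<forall>c\<in>crit. {u..v} \<inter> ball c \<rho> = {}" "v - u \<le> r\<^sub>1" "z \<in> {u..v}"
    have lip: "\<bar>deriv f x - deriv f y\<bar> \<le> L * r\<^sub>1" if "x \<in> {u..v}" "y \<in> {u..v}" for x y
    proof -
      have "closed_segment x y \<subseteq> {u..v}" using that by (auto simp: closed_segment_eq_real_ivl)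
      then have "\<bar>deriv f x - deriv f y\<bar> \<le> L * \<bar>x - y\<bar>" using uv(2) by (intro deriv_lipschitz) auto
      also have "\<dots> \<le> L * r\<^sub>1" using that uv(5) L_pos by (intro mult_left_mono) auto
      finally show ?thesis .
    qed
    show "\<bar>deriv f z\<bar> * (v - u) \<le> exp \<eta> * diameter (f ` {u..v})"
    proof (cases "u = v")
      case False
      then obtain \<xi> where \<xi>: "u < \<xi>" "\<xi> < v" "f v - f u = (v - u) * deriv f \<xi>"
        using MVT2[of u v f "deriv f"] f_deriv uv(1,2) nbhd_D by force
      obtain \<kappa> where \<kappa>: "\<kappa> \<in> K" "\<kappa> \<in> {u..v}" using uv(3) by blast
      then have "m \<le> \<bar>deriv f \<kappa>\<bar>" using uv(4) by (intro m) (unfold A_def, blast)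
      then have 1: "m / 2 \<le> \<bar>deriv f \<xi>\<bar>" using lip[of \<kappa> \<xi>] \<kappa> \<xi> r1(2) by auto
      have "\<bar>deriv f z\<bar> \<le> \<bar>deriv f \<xi>\<bar> + L * r\<^sub>1" using lip[of z \<xi>] uv(6) \<xi> by auto
      also have "\<dots> \<le> \<bar>deriv f \<xi>\<bar> + \<eta> * \<bar>deriv f \<xi>\<bar>"
        using r1(3) mult_left_mono[OF 1, of \<eta>] \<eta> by linarith
      also have "\<dots> = (1 + \<eta>) * \<bar>deriv f \<xi>\<bar>" by (simp add: algebra_simps)
      also have "\<dots> \<le> exp \<eta> * \<bar>deriv f \<xi>\<bar>" by (intro mult_right_mono exp_ge_add_one_self) auto
      finally have "\<bar>deriv f z\<bar> * (v - u) \<le> exp \<eta> * \<bar>deriv f \<xi>\<bar> * (v - u)"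
        using uv(1) by (intro mult_right_mono) auto
      also have "\<dots> = exp \<eta> * \<bar>f v - f u\<bar>" using uv(1) by (simp add: \<xi>(3) abs_mult mult_ac)
      also have "\<dots> \<le> exp \<eta> * diameter (f ` {u..v})"
        using uv nbhd_D by (intro mult_left_mono diameter_image_ge) auto
      finally show ?thesis .
    qed simp
  qed
qed

text \<open>A critical point that is not periodic is moved off itself by each of the finitely many
  iterates below \<open>m\<close>, and by continuity so are its neighbours. The factor 2 leaves room
  for an interval of length \<open>\<rho>\<close>.\<close>

lemma crit_no_return:
  assumes nonper: "\<And>c n. c \<in> crit \<Longrightarrow> 0 < n \<Longrightarrow> (f ^^ n) c \<noteq> c" and "0 < \<rho>\<^sub>1"
  obtains \<rho> where "0 < \<rho>" "\<rho> \<le> \<rho>\<^sub>1"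
    "\<forall>c j y. c \<in> crit \<longrightarrow> 0 < j \<longrightarrow> j < m \<longrightarrow> \<bar>y - c\<bar> < \<rho> \<longrightarrow> 2 * \<rho> \<le> \<bar>(f ^^ j) y - c\<bar>"
proof -
  \<comment> \<open>Stated for all smaller radii, so that the minimum over the finitely many pairs
    still works.\<close>
  have "\<forall>p\<in>crit \<times> {0<..<m}. \<exists>\<rho>>0. \<forall>\<rho>'\<le>\<rho>. \<forall>y. \<bar>y - fst p\<bar> < \<rho>' \<longrightarrow> 2 * \<rho>' \<le> \<bar>(f ^^ snd p) y - fst p\<bar>"
  proof
    fix p assume "p \<in> crit \<times> {0<..<m}"
    then obtain c j where p: "p = (c, j)" "c \<in> crit" "0 < j" by auto
    define \<delta> where "\<delta> = \<bar>(f ^^ j) c - c\<bar>"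
    have \<delta>: "0 < \<delta>" using nonper[OF p(2,3)] by (simp add: \<delta>_def)
    have "isCont (f ^^ j) c"
      by (rule DERIV_isCont[OF iter_deriv]) (use iter_K_D crit_K[OF p(2)] in blast)
    then obtain \<rho>' where r': "0 < \<rho>'" "\<And>y. dist y c < \<rho>' \<Longrightarrow> dist ((f ^^ j) y) ((f ^^ j) c) < \<delta> / 2"
      using \<delta> unfolding continuous_at_eps_delta by (meson half_gt_zero)
    show "\<exists>\<rho>>0. \<forall>\<rho>'\<le>\<rho>. \<forall>y. \<bar>y - fst p\<bar> < \<rho>' \<longrightarrow> 2 * \<rho>' \<le> \<bar>(f ^^ snd p) y - fst p\<bar>"
    proof (intro exI[of _ "min \<rho>' (\<delta> / 4)"] conjI allI impI)
      fix \<rho>'' y assume *: "\<rho>'' \<le> min \<rho>' (\<delta> / 4)" "\<bar>y - fst p\<bar> < \<rho>''"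
      then have "\<bar>(f ^^ j) y - (f ^^ j) c\<bar> < \<delta> / 2" using r'(2)[of y] p by (auto simp: dist_real_def)
      moreover have "\<delta> \<le> \<bar>(f ^^ j) y - (f ^^ j) c\<bar> + \<bar>(f ^^ j) y - c\<bar>" unfolding \<delta>_def by linarith
      ultimately have "\<delta> / 2 \<le> \<bar>(f ^^ j) y - c\<bar>" by linarith
      then show "2 * \<rho>'' \<le> \<bar>(f ^^ snd p) y - fst p\<bar>" using * p by simp
    qed (use \<delta> r' in auto)
  qed
  from bchoice[OF this] obtain q where q0: "\<forall>p\<in>crit \<times> {0<..<m}. 0 < q p \<and>
    (\<forall>\<rho>'\<le>q p. \<forall>y. \<bar>y - fst p\<bar> < \<rho>' \<longrightarrow> 2 * \<rho>' \<le> \<bar>(f ^^ snd p) y - fst p\<bar>)" ..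
  note q = q0[rule_format]
  have fin: "finite (crit \<times> {0<..<m})" using finite_crit by auto
  define \<rho> where "\<rho> = Min (insert \<rho>\<^sub>1 (q ` (crit \<times> {0<..<m})))"
  show thesis
  proof (rule that[of \<rho>], goal_cases)
    case 1 show "0 < \<rho>" unfolding \<rho>_def using fin q0 assms(2) by (subst Min_gr_iff) auto
  next
    case 2 show "\<rho> \<le> \<rho>\<^sub>1" unfolding \<rho>_def using fin by (intro Min_le) auto
  next
    case 3 show ?case
    proof (intro allI impI)
      fix c j y assume c: "c \<in> crit" "0 < j" "j < m" "\<bar>y - c\<bar> < \<rho>"
      have "\<rho> \<le> q (c, j)" unfolding \<rho>_def using fin c by (intro Min_le) auto
      then show "2 * \<rho> \<le> \<bar>(f ^^ j) y - c\<bar>" using q[of "(c, j)"] c by auto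
    qed
  qed
qed

text \<open>
  Away from the critical points \<open>f'\<close> is almost constant on a short interval. Near a critical point the
  estimate loses a constant factor, but a critical point that is not periodic is visited at most once in
  any \<open>m\<close> consecutive steps.
\<close>

lemma growth:
  assumes nonper: "\<And>c n. c \<in> crit \<Longrightarrow> 0 < n \<Longrightarrow> (f ^^ n) c \<noteq> c" and \<theta>: "0 < \<theta>"
  obtains r\<^sub>1 C where "0 < r\<^sub>1" "r\<^sub>1 < r"
    "\<forall>u v k z. u \<le> v \<longrightarrow> {u..v} \<inter> K \<noteq> {} \<longrightarrow> (\<forall>i<k. diameter ((f ^^ i) ` {u..v}) \<le> r\<^sub>1) \<longrightarrow>
      z \<in> {u..v} \<longrightarrow> \<bar>dn f k z\<bar> * (v - u) \<le> exp (\<theta> * real k + C) * diameter ((f ^^ k) ` {u..v})"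
proof -
  obtain K\<^sub>0 \<rho>\<^sub>0 where K0: "1 \<le> K\<^sub>0" "0 < \<rho>\<^sub>0"
    "\<forall>c\<in>crit. \<forall>u v z. u \<le> v \<longrightarrow> {u..v} \<subseteq> ball c \<rho>\<^sub>0 \<longrightarrow> z \<in> {u..v} \<longrightarrow>
      \<bar>deriv f z\<bar> * (v - u) \<le> K\<^sub>0 * diameter (f ` {u..v})"
    by (rule near_crit_step)
  \<comment> \<open>The logarithmic loss caused by one visit to each critical point. Below,
    \<open>m\<close> is so large that this loss, spread over \<open>m\<close> steps, costs at most
    \<open>\<theta> / 2\<close> per step.\<close>
  define C where "C = ln K\<^sub>0 * real (card crit)"
  have C0: "0 \<le> C" using K0(1) by (simp add: C_def)
  obtain m :: nat where m: "0 < m" "C / real m \<le> \<theta> / 2"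
  proof -
    obtain m :: nat where "2 * C / \<theta> < real m" using reals_Archimedean2 by blast
    then show thesis using that[of "Suc m"] \<theta> by (simp add: field_simps)
  qed
  obtain \<rho> where \<rho>: "0 < \<rho>" "\<rho> \<le> \<rho>\<^sub>0 / 2"
    "\<forall>c j y. c \<in> crit \<longrightarrow> 0 < j \<longrightarrow> j < m \<longrightarrow> \<bar>y - c\<bar> < \<rho> \<longrightarrow> 2 * \<rho> \<le> \<bar>(f ^^ j) y - c\<bar>"
    by (rule crit_no_return[OF nonper, of "\<rho>\<^sub>0 / 2" m]) (use K0(2) in simp_all)
  obtain r' where r': "0 < r'"
    "\<forall>u v z. u \<le> v \<longrightarrow> {u..v} \<subseteq> nbhd K r \<longrightarrow> {u..v} \<inter> K \<noteq> {} \<longrightarrow>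
      (\<forall>c\<in>crit. {u..v} \<inter> ball c \<rho> = {}) \<longrightarrow> v - u \<le> r' \<longrightarrow> z \<in> {u..v} \<longrightarrow>
      \<bar>deriv f z\<bar> * (v - u) \<le> exp (\<theta> / 2) * diameter (f ` {u..v})"
    by (rule away_crit_step[of "\<theta> / 2" \<rho>]) (use \<theta> \<rho>(1) in simp_all)
  \<comment> \<open>With \<open>r\<^sub>1 \<le> \<rho> \<le> \<rho>\<^sub>0 / 2\<close>, an image
    that meets the \<open>\<rho>\<close>-ball of a critical point lies in its
    \<open>\<rho>\<^sub>0\<close>-ball, so one of the two local estimates always applies.\<close>
  define r\<^sub>1 where "r\<^sub>1 = min (min \<rho> r') (r / 2)"
  have r1: "0 < r\<^sub>1" "r\<^sub>1 < r" "r\<^sub>1 \<le> \<rho>" "r\<^sub>1 \<le> r'" using \<rho>(1) r'(1) r_pos by (auto simp: r\<^sub>1_def)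
  show thesis
  proof (rule that[OF r1(1,2)], intro allI impI)
    fix u v k z assume uv: "u \<le> v" "{u..v} \<inter> K \<noteq> {}"
      and sh0: "\<forall>i<k. diameter ((f ^^ i) ` {u..v}) \<le> r\<^sub>1" and z: "z \<in> {u..v}"
    note sh = sh0[rule_format]
    define S where "S i = (f ^^ i) ` {u..v}" for i
    have SN: "S i \<subseteq> nbhd K r" if "i < k" for i
      unfolding S_def by (rule short_orbit[OF uv _ that]) (use sh r1 in fastforce)
    have S_ivl: "\<exists>a b. a \<le> b \<and> S i = {a..b}" if "i \<le> k" for i
      unfolding S_def using SN nbhd_D that
      by (intro iter_interval[OF uv(1), of i]) (auto simp: S_def dest: less_le_trans)
    have SK: "S i \<inter> K \<noteq> {}" for i
      using uv(2) iter_K unfolding S_def by blast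
    have S_Suc: "S (Suc i) = f ` S i" for i unfolding S_def by (rule image_funpow_Suc)
    define near where "near i \<longleftrightarrow> (\<exists>c\<in>crit. S i \<inter> ball c \<rho> \<noteq> {})" for i
    define \<Lambda> where "\<Lambda> i = exp (\<theta> / 2) * (if near i then K\<^sub>0 else 1)" for i
    have \<Lambda>0: "0 \<le> \<Lambda> i" for i using K0(1) by (simp add: \<Lambda>_def)
    have step: "\<bar>deriv f w\<bar> * diameter (S i) \<le> \<Lambda> i * diameter (S (Suc i))" if i: "i < k" and w: "w \<in> S i" for i w
    proof -
      obtain a b where ab: "a \<le> b" "S i = {a..b}" using S_ivl i by (meson less_imp_le)
      have dS: "diameter (S i) = b - a" using ab by (simp add: diameter_closed_interval)
      have len: "b - a \<le> r\<^sub>1" using sh[OF i] dS by (simp add: S_def)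
      show ?thesis
      proof (cases "near i")
        case True
        then obtain c y where c: "c \<in> crit" "y \<in> S i" "dist c y < \<rho>" by (auto simp: near_def)
        have "{a..b} \<subseteq> ball c \<rho>\<^sub>0"
        proof
          fix x assume "x \<in> {a..b}"
          then have "\<bar>x - y\<bar> \<le> r\<^sub>1" using c(2) ab(2) len by auto
          then show "x \<in> ball c \<rho>\<^sub>0" using c(3) r1(3) \<rho>(2) by (auto simp: dist_real_def)
        qed
        then have "\<bar>deriv f w\<bar> * (b - a) \<le> K\<^sub>0 * diameter (S (Suc i))"
          using K0(3)[rule_format, OF c(1) ab(1)] w ab(2) S_Suc by simp
        also have "\<dots> \<le> \<Lambda> i * diameter (S (Suc i))"
        proof (rule mult_right_mono)
          show "K\<^sub>0 \<le> \<Lambda> i" using True K0(1) \<theta> by (simp add: \<Lambda>_def)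
          obtain a' b' where "a' \<le> b'" "S (Suc i) = {a'..b'}" using S_ivl[of "Suc i"] i by auto
          then show "0 \<le> diameter (S (Suc i))" by (simp add: diameter_closed_interval)
        qed
        finally show ?thesis using dS by simp
      next
        case False
        have "\<bar>deriv f w\<bar> * (b - a) \<le> exp (\<theta> / 2) * diameter (f ` {a..b})"
          by (rule r'(2)[rule_format]) (use ab SN[OF i] SK[of i] False len r1 w in \<open>auto simp: near_def\<close>)
        then show ?thesis using False dS S_Suc ab(2) by (simp add: \<Lambda>_def)
      qed
    qed
    have "\<bar>dn f i z\<bar> * (v - u) \<le> (\<Prod>l<i. \<Lambda> l) * diameter (S i)" if "i \<le> k" for i
      using that
    proof (induction i)
      case 0
      then show ?case using uv(1) by (simp add: S_def diameter_closed_interval)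
    next
      case (Suc i)
      define w where "w = (f ^^ i) z"
      have w: "w \<in> S i" using z by (simp add: w_def S_def)
      have "\<bar>dn f (Suc i) z\<bar> * (v - u) = (\<bar>dn f i z\<bar> * (v - u)) * \<bar>deriv f w\<bar>"
        by (simp add: dn_Suc abs_mult w_def)
      also have "\<dots> \<le> ((\<Prod>l<i. \<Lambda> l) * diameter (S i)) * \<bar>deriv f w\<bar>"
        using Suc by (intro mult_right_mono) auto
      also have "\<dots> = (\<Prod>l<i. \<Lambda> l) * (\<bar>deriv f w\<bar> * diameter (S i))" by simp
      also have "\<dots> \<le> (\<Prod>l<i. \<Lambda> l) * (\<Lambda> i * diameter (S (Suc i)))"
        using step[of i w] w Suc.prems \<Lambda>0 by (intro mult_left_mono prod_nonneg) auto
      finally show ?case by (simp add: mult_ac)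
    qed
    then have main: "\<bar>dn f k z\<bar> * (v - u) \<le> (\<Prod>l<k. \<Lambda> l) * diameter (S k)" by simp
    \<comment> \<open>The costly steps are counted separately for each critical point: two visits
      less than \<open>m\<close> steps apart contradict the choice of \<open>\<rho>\<close>.\<close>
    define A where "A = {l. l < k \<and> near l}"
    have "card A \<le> card crit * (k div m + 1)"
    proof -
      define B where "B c = {l. l < k \<and> S l \<inter> ball c \<rho> \<noteq> {}}" for c
      have "A = (\<Union>c\<in>crit. B c)" by (auto simp: A_def B_def near_def)
      then have "card A \<le> (\<Sum>c\<in>crit. card (B c))" using card_UN_le[OF finite_crit, of B] by simp
      also have "\<dots> \<le> (\<Sum>c\<in>crit. k div m + 1)"
      proof (rule sum_mono)
        fix c assume c: "c \<in> crit"
        show "card (B c) \<le> k div m + 1"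
        proof (rule card_sparse_le[OF _ m(1)])
          show "B c \<subseteq> {..<k}" by (auto simp: B_def)
          fix i j assume ij: "i \<in> B c" "j \<in> B c" "i < j"
          show "i + m \<le> j"
          proof (rule ccontr)
            assume "\<not> i + m \<le> j"
            then have jm: "0 < j - i" "j - i < m" using ij by auto
            obtain y y' where y: "y \<in> S i" "\<bar>y - c\<bar> < \<rho>" "y' \<in> S j" "\<bar>y' - c\<bar> < \<rho>"
              using ij by (auto simp: B_def dist_real_def abs_minus_commute)
            \<comment> \<open>The image of \<open>y\<close> and the second nearby point
              \<open>y'\<close> lie in one interval of length at most \<open>\<rho>\<close>, so that
              image is within \<open>2 * \<rho>\<close> of \<open>c\<close>.\<close>
            have "(f ^^ (j - i)) y \<in> S j"
            proof -
              obtain w where "w \<in> {u..v}" "y = (f ^^ i) w" using y(1) by (auto simp: S_def)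
              then have "(f ^^ (j - i)) y = (f ^^ j) w"
                using ij(3) funpow_add_apply[of "j - i" i f w] by simp
              then show ?thesis using \<open>w \<in> {u..v}\<close> by (simp add: S_def)
            qed
            moreover obtain a b where "a \<le> b" "S j = {a..b}" using S_ivl[of j] ij by (auto simp: B_def)
            ultimately have "\<bar>(f ^^ (j - i)) y - y'\<bar> \<le> diameter (S j)"
              using y(3) by (intro abs_diff_le_diameter) auto
            also have "\<dots> \<le> \<rho>" using sh[of j] ij r1 by (auto simp: B_def S_def)
            finally have "\<bar>(f ^^ (j - i)) y - c\<bar> < 2 * \<rho>" using y(4) by linarith
            then show False using \<rho>(3)[rule_format, OF c jm y(2)] by simp
          qed
        qed
      qed
      finally show ?thesis by simp
    qed
    then have cA: "real (card A) \<le> real (card crit) * (real k / real m + 1)"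
    proof -
      assume "card A \<le> card crit * (k div m + 1)"
      then have "real (card A) \<le> real (card crit * (k div m + 1))" by (simp only: of_nat_le_iff)
      also have "\<dots> = real (card crit) * (real (k div m) + 1)" by (simp add: algebra_simps)
      also have "\<dots> \<le> real (card crit) * (real k / real m + 1)"
        using of_nat_div_le_of_nat[of k m] by (intro mult_left_mono) auto
      finally show ?thesis .
    qed
    have "(\<Prod>l<k. \<Lambda> l) = exp (\<theta> / 2) ^ k * (\<Prod>l<k. if near l then K\<^sub>0 else 1)"
      by (simp add: \<Lambda>_def prod.distrib)
    also have "(\<Prod>l<k. if near l then K\<^sub>0 else 1) = K\<^sub>0 ^ card A"
    proof -
      have "A = {..<k} \<inter> {l. near l}" by (auto simp: A_def)
      then show ?thesis by (simp add: prod.If_cases)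
    qed
    also have "exp (\<theta> / 2) ^ k * K\<^sub>0 ^ card A = exp (\<theta> / 2 * real k + ln K\<^sub>0 * real (card A))"
    proof -
      have "K\<^sub>0 ^ card A = exp (real (card A) * ln K\<^sub>0)" using K0(1) by (simp add: exp_of_nat_mult)
      moreover have "exp (\<theta> / 2) ^ k = exp (real k * (\<theta> / 2))" by (simp only: exp_of_nat_mult)
      ultimately show ?thesis by (simp add: exp_add mult.commute)
    qed
    also have "\<dots> \<le> exp (\<theta> * real k + C)"
    proof -
      have "ln K\<^sub>0 * real (card A) \<le> ln K\<^sub>0 * (real (card crit) * (real k / real m + 1))"
        using cA K0(1) by  (intro mult_left_mono) auto
      also have "\<dots> = real k * (C / real m) + C" by (simp add: C_def algebra_simps)
      also have "\<dots> \<le> real k * (\<theta> / 2) + C" using m(2) by (intro add_mono mult_left_mono) auto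
      finally show ?thesis by (simp add: mult.commute)
    qed
    finally have "(\<Prod>l<k. \<Lambda> l) \<le> exp (\<theta> * real k + C)" .
    moreover have "0 \<le> diameter (S k)"
    proof -
      obtain a b where "a \<le> b" "S k = {a..b}" using S_ivl[of k] by auto
      then show ?thesis by (simp add: diameter_closed_interval)
    qed
    ultimately have "(\<Prod>l<k. \<Lambda> l) * diameter (S k) \<le> exp (\<theta> * real k + C) * diameter (S k)"
      by (rule mult_right_mono)
    then show "\<bar>dn f k z\<bar> * (v - u) \<le> exp (\<theta> * real k + C) * diameter ((f ^^ k) ` {u..v})"
      using main by (simp add: S_def)
  qed
qed


section \<open>Recurrent intervals and covering relations\<close>

lemma transD:
  assumes "openin (top_of_set K) V\<^sub>1" "openin (top_of_set K) V\<^sub>2" "V\<^sub>1 \<noteq> {}" "V\<^sub>2 \<noteq> {}"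
  obtains n y where "1 \<le> n" "y \<in> V\<^sub>1" "(f ^^ n) y \<in> V\<^sub>2"
  using assms trans_K unfolding transitive_on_def by (metis disjoint_iff imageE)

lemma openin_K: "open T \<Longrightarrow> openin (top_of_set K) (K \<inter> T)"
  by (rule openin_open_Int)

lemma bounded_nbhd: "bounded (nbhd K r)"
proof -
  obtain B where B: "\<And>k. k \<in> K \<Longrightarrow> \<bar>k\<bar> \<le> B"
    using compact_imp_bounded[OF K_compact] by (auto simp: bounded_iff)
  show ?thesis
  proof (rule boundedI)
    fix y assume "y \<in> nbhd K r"
    then obtain k where "k \<in> K" "\<bar>k - y\<bar> < r" by (auto simp: nbhd_def dist_real_def)
    then show "norm y \<le> B + r" using B[of k] by auto
  qed
qed

lemma isCont_iter: "q \<in> K \<Longrightarrow> isCont (f ^^ n) q"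
  by (rule DERIV_isCont[OF iter_deriv]) (rule iter_K_D)

lemma periodic_in_K:
  assumes "0 < n" "(f ^^ n) p = p" "\<And>i. i < n \<Longrightarrow> (f ^^ i) p \<in> nbhd K r"
  shows "p \<in> K"
proof (rule isolated[OF assms(1,2)])
  fix i
  have "(f ^^ i) p = (f ^^ (i mod n)) p"
  proof -
    have "(f ^^ i) p = (f ^^ (i mod n + n * (i div n))) p" by simp
    also have "\<dots> = (f ^^ (i mod n)) p"
      by (simp only: funpow_add_apply funpow_period[OF assms(2)])
    finally show ?thesis .
  qed
  then show "(f ^^ i) p \<in> nbhd K r" using assms(1,3) by simp
qed

lemma connected_chain:
  fixes T :: "nat \<Rightarrow> 'b::topological_space set"
  assumes "\<And>k. connected (T k)" "\<And>k. T k \<inter> T (Suc k) \<noteq> {}"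
  shows "connected (\<Union>k. T k)"
proof -
  have c: "connected (\<Union>k\<le>n. T k)" for n
  proof (induction n)
    case (Suc n)
    have "(\<Union>k\<le>Suc n. T k) = (\<Union>k\<le>n. T k) \<union> T (Suc n)" by (simp add: atMost_Suc Un_commute)
    moreover have "(\<Union>k\<le>n. T k) \<inter> T (Suc n) \<noteq> {}" using assms(2)[of n] by blast
    ultimately show ?case using connected_Un[OF Suc assms(1)] by simp
  qed (simp add: assms(1))
  have "connected (\<Union>n. \<Union>k\<le>n. T k)"
  proof (rule connected_Union)
    show "connected S" if "S \<in> range (\<lambda>n. \<Union>k\<le>n. T k)" for S using c that by blast
    show "\<Inter> (range (\<lambda>n. \<Union>k\<le>n. T k)) \<noteq> {}"
      using assms(2)[of 0] by blast
  qed
  moreover have "(\<Union>n. \<Union>k\<le>n. T k) = (\<Union>k. T k)" by blast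
  ultimately show ?thesis by simp
qed

text \<open>
  Let \<open>V = K \<inter> {u<..<v}\<close> return to itself under \<open>f\<^sup>s\<close>. The images of \<open>{u..v}\<close> under the powers of \<open>f\<^sup>s\<close> form
  an interval \<open>F\<close>. If \<open>f\<^sup>s\<close> had no fixed point in \<open>F\<close>, it would move all points of \<open>F\<close> towards the same end
  point \<open>q\<close> of \<open>F\<close>, and points of \<open>K\<close> close to \<open>q\<close> would never come back from the orbit of \<open>q\<close>.
\<close>

lemma recurrent_interval_periodic:
  assumes uv: "{u<..<v} \<inter> K \<noteq> {}" and orb: "\<And>i. (f ^^ i) ` {u..v} \<subseteq> nbhd K r"
  obtains k s p where "0 < s" "p \<in> (f ^^ k) ` {u..v}" "(f ^^ s) p = p" "p \<in> K"
proof -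
  define V where "V = K \<inter> {u<..<v}"
  have V: "openin (top_of_set K) V" "V \<noteq> {}" using uv by (auto simp: V_def openin_K)
  \<comment> \<open>Transitivity from \<open>V\<close> to itself: \<open>f ^^ s\<close> maps a point
    \<open>w\<close> of \<open>{u..v}\<close> back into \<open>{u..v}\<close>, so consecutive images
    under the powers of \<open>f ^^ s\<close> overlap.\<close>
  obtain s w where s: "1 \<le> s" and w: "w \<in> V" "(f ^^ s) w \<in> V"
    using transD[OF V(1,1) V(2,2)] .
  define T where "T k = (f ^^ (s * k)) ` {u..v}" for k
  define F where "F = (\<Union>k. T k)"
  have orbD: "(f ^^ i) ` {u..v} \<subseteq> D" for i using orb nbhd_D by blast
  have "connected F" unfolding F_def
  proof (rule connected_chain)
    show "connected (T k)" for k
      unfolding T_def by (rule connected_continuous_image[OF iter_cont]) (use orbD in auto)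
    show "T k \<inter> T (Suc k) \<noteq> {}" for k
    proof -
      have "(f ^^ (s * k)) ((f ^^ s) w) \<in> T k" using w(2) by (auto simp: T_def V_def)
      moreover have "(f ^^ (s * k)) ((f ^^ s) w) = (f ^^ (s * Suc k)) w"
        by (simp add: funpow_add_apply[symmetric] add.commute)
      moreover have "(f ^^ (s * Suc k)) w \<in> T (Suc k)"
        unfolding T_def using w(1) by (intro imageI) (auto simp: V_def)
      ultimately show ?thesis by auto
    qed
  qed
  have FN: "F \<subseteq> nbhd K r" unfolding F_def T_def using orb by blast
  have F_iter: "(f ^^ (s * a)) y \<in> F" if yF: "y \<in> F" for y a
  proof -
    obtain k z where z: "z \<in> {u..v}" "y = (f ^^ (s * k)) z" using yF unfolding F_def T_def by blast
    have "(f ^^ (s * a)) y = (f ^^ (s * (a + k))) z"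
      by (simp add: z(2) funpow_add_apply[symmetric] distrib_left)
    then show ?thesis unfolding F_def T_def using z(1) by blast
  qed
  have F_orb: "(f ^^ i) y \<in> nbhd K r" if yF: "y \<in> F" for y i
  proof -
    obtain k z where z: "z \<in> {u..v}" "y = (f ^^ (s * k)) z" using yF unfolding F_def T_def by blast
    have "(f ^^ i) y = (f ^^ (i + s * k)) z" by (simp add: z(2) funpow_add_apply)
    then show ?thesis using orb z(1) by blast
  qed
  show thesis
  proof (cases "\<exists>p\<in>F. (f ^^ s) p = p")
    case True
    then obtain p k where p: "p \<in> F" "(f ^^ s) p = p" "p \<in> (f ^^ (s * k)) ` {u..v}"
      unfolding F_def T_def by blast
    have "p \<in> K" by (rule periodic_in_K[OF _ p(2)]) (use s F_orb[OF p(1)] in auto)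
    then show thesis using that[OF _ p(3,2)] s by simp
  next
    case False
    have wF: "w \<in> F" using w unfolding F_def T_def V_def by (intro UN_I[of 0]) auto
    have "continuous_on F (\<lambda>y. (f ^^ s) y - y)"
      by (intro continuous_intros iter_cont) (use F_orb nbhd_D in blast)
    then have conn: "connected ((\<lambda>y. (f ^^ s) y - y) ` F)"
      using \<open>connected F\<close> connected_continuous_image by blast
    \<comment> \<open>Without a fixed point on the connected set \<open>F\<close>, the displacement
      has one sign; multiplying by \<open>\<sigma>\<close> treats both directions at once.\<close>
    have "\<exists>\<sigma>. \<bar>\<sigma>\<bar> = 1 \<and> (\<forall>y\<in>F. 0 < \<sigma> * ((f ^^ s) y - y))"
    proof (rule ccontr)
      assume *: "\<nexists>\<sigma>. \<bar>\<sigma>\<bar> = 1 \<and> (\<forall>y\<in>F. 0 < \<sigma> * ((f ^^ s) y - y))"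
      have "\<not> (\<forall>y\<in>F. 0 < (f ^^ s) y - y)" using *[simplified, rule_format, of 1] by auto
      moreover have "\<not> (\<forall>y\<in>F. (f ^^ s) y - y < 0)" using *[simplified, rule_format, of "-1"] by auto
      ultimately obtain y y' where y: "y \<in> F" "(f ^^ s) y - y \<le> 0" "y' \<in> F" "0 \<le> (f ^^ s) y' - y'"
        by (meson not_less)
      then have "0 \<in> (\<lambda>y. (f ^^ s) y - y) ` F"
        using conn connectedD_interval[of "(\<lambda>y. (f ^^ s) y - y) ` F" "(f ^^ s) y - y" "(f ^^ s) y' - y'" 0]
        by blast
      then show False using False by auto
    qed
    then obtain \<sigma> where \<sigma>: "\<bar>\<sigma>\<bar> = 1" "\<And>y. y \<in> F \<Longrightarrow> 0 < \<sigma> * ((f ^^ s) y - y)" by blast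
    have \<sigma>\<sigma>: "\<sigma> * (\<sigma> * t) = t" for t using \<sigma>(1) by (auto simp: abs_if split: if_splits)
    have mono: "\<sigma> * y \<le> \<sigma> * (f ^^ (s * a)) y" if "y \<in> F" for y a
    proof (induction a)
      case (Suc a)
      have "(f ^^ (s * Suc a)) y = (f ^^ s) ((f ^^ (s * a)) y)"
        by (simp add: funpow_add_apply[symmetric])
      then show ?case using \<sigma>(2)[OF F_iter[OF that, of a]] Suc by (simp add: right_diff_distrib)
    qed simp
    \<comment> \<open>The orbit of \<open>w\<close> under \<open>f ^^ s\<close> is bounded and
      monotone in direction \<open>\<sigma>\<close>. Its limit \<open>q\<close> is a fixed point of
      \<open>f ^^ s\<close> in \<open>K\<close>, hence outside \<open>F\<close>, so \<open>F\<close>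
      lies on one side of it.\<close>
    define x where "x k = (f ^^ (s * k)) w" for k
    have xF: "x k \<in> F" for k unfolding x_def by (rule F_iter[OF wF])
    have xK: "x k \<in> K" for k unfolding x_def using w(1) by (intro iter_K) (simp add: V_def)
    have x_Suc: "x (Suc k) = (f ^^ s) (x k)" for k
      by (simp add: x_def funpow_add_apply[symmetric])
    have x_less: "\<sigma> * x k < \<sigma> * x (Suc k)" for k
      using \<sigma>(2)[OF xF] by (simp add: x_Suc right_diff_distrib)
    have inc: "incseq (\<lambda>k. \<sigma> * x k)" by (rule incseq_SucI) (use x_less less_imp_le in blast)
    obtain B where B: "\<And>y. y \<in> nbhd K r \<Longrightarrow> \<bar>y\<bar> \<le> B" using bounded_nbhd by (auto simp: bounded_iff)
    have "\<sigma> * x k \<le> B" for k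
    proof -
      have "\<sigma> * x k \<le> \<bar>\<sigma> * x k\<bar>" by simp
      also have "\<dots> = \<bar>x k\<bar>" using \<sigma>(1) by (simp add: abs_mult)
      also have "\<dots> \<le> B" using B xF FN by blast
      finally show ?thesis .
    qed
    then obtain l where l: "(\<lambda>k. \<sigma> * x k) \<longlonglongrightarrow> l" "\<And>k. \<sigma> * x k \<le> l"
      using incseq_convergent[OF inc, of B] by auto
    define q where "q = \<sigma> * l"
    have "(\<lambda>k. \<sigma> * (\<sigma> * x k)) \<longlonglongrightarrow> \<sigma> * l" by (intro tendsto_intros l)
    then have xq: "x \<longlonglongrightarrow> q" by (simp add: \<sigma>\<sigma> q_def)
    have lq: "\<sigma> * q = l" by (simp add: q_def \<sigma>\<sigma>)
    have qK: "q \<in> K"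
      using closed_sequentially[OF compact_imp_closed[OF K_compact] _ xq] xK by blast
    have fq: "(f ^^ s) q = q"
    proof (rule LIMSEQ_unique)
      show "(\<lambda>k. (f ^^ s) (x k)) \<longlonglongrightarrow> (f ^^ s) q"
        by (rule isCont_tendsto_compose[OF isCont_iter[OF qK] xq])
      show "(\<lambda>k. (f ^^ s) (x k)) \<longlonglongrightarrow> q"
        using LIMSEQ_Suc[OF xq] by (simp add: x_Suc)
    qed
    have qF: "q \<notin> F" using False fq by blast
    have F_lt: "\<sigma> * y < \<sigma> * q" if "y \<in> F" for y
    proof (rule ccontr)
      assume "\<not> \<sigma> * y < \<sigma> * q"
      then have A: "\<sigma> * q \<le> \<sigma> * y" "\<sigma> * x 0 \<le> \<sigma> * q" using l(2) lq by auto
      then have "q \<in> F"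
        using connectedD_interval[OF \<open>connected F\<close> that xF, of q 0]
          connectedD_interval[OF \<open>connected F\<close> xF that, of 0 q] \<sigma>(1)
        by (auto simp: abs_if split: if_splits)
      then show False using qF by blast
    qed
    define P where "P = (\<lambda>i. (f ^^ i) q) ` {..<s}"
    have "finite P" by (simp add: P_def)
    then have "\<not> K \<subseteq> P" using K_inf finite_subset by blast
    \<comment> \<open>A point of the infinite set \<open>K\<close> off the finite orbit of
      \<open>q\<close>. Transitivity sends points close to \<open>q\<close> near \<open>z\<close>,
      which monotone motion towards \<open>q\<close> will forbid.\<close>
    then obtain z where z: "z \<in> K" "z \<notin> P" by blast
    obtain e where e: "0 < e" "\<And>y. y \<in> P \<Longrightarrow> 2 * e \<le> \<bar>z - y\<bar>"
    proof -
      have "open (- P)" using \<open>finite P\<close> finite_imp_closed by blast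
      then obtain e where "0 < e" "ball z e \<subseteq> - P" using z(2) open_contains_ball by (metis ComplI)
      then show thesis by (intro that[of "e / 2"]) (force simp: dist_real_def)+
    qed
    obtain \<delta> where \<delta>: "0 < \<delta>" "\<And>i y. i < s \<Longrightarrow> \<bar>y - q\<bar> < \<delta> \<Longrightarrow> \<bar>(f ^^ i) y - (f ^^ i) q\<bar> < e"
    proof -
      have "\<forall>i. \<exists>\<delta>>0. \<forall>y. \<bar>y - q\<bar> < \<delta> \<longrightarrow> \<bar>(f ^^ i) y - (f ^^ i) q\<bar> < e"
        using isCont_iter[OF qK] e(1) unfolding continuous_at_eps_delta dist_real_def by blast
      then obtain \<delta> where \<delta>: "\<And>i. 0 < \<delta> i \<and> (\<forall>y. \<bar>y - q\<bar> < \<delta> i \<longrightarrow> \<bar>(f ^^ i) y - (f ^^ i) q\<bar> < e)" by metis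
      define \<delta>' where "\<delta>' = Min (insert 1 (\<delta> ` {..<s}))"
      have "0 < \<delta>'" unfolding \<delta>'_def using \<delta> by (subst Min_gr_iff) auto
      moreover have "\<delta>' \<le> \<delta> i" if "i < s" for i unfolding \<delta>'_def using that by (intro Min_le) auto
      ultimately show thesis using that[of \<delta>'] \<delta> by (meson less_le_trans)
    qed
    obtain k where k: "\<bar>x k - q\<bar> < \<delta>"
      using xq \<delta>(1) unfolding LIMSEQ_iff by (metis order_refl real_norm_def)
    \<comment> \<open>These points lie in \<open>F\<close>, and under \<open>f ^^ s\<close> they
      stay between \<open>x k\<close> and \<open>q\<close>; at every time they are therefore within
      \<open>e\<close> of the orbit of \<open>q\<close>.\<close>
    define V\<^sub>1 where "V\<^sub>1 = K \<inter> {y. \<sigma> * x k < \<sigma> * y \<and> \<sigma> * y < \<sigma> * q}"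
    have V1: "openin (top_of_set K) V\<^sub>1" unfolding V\<^sub>1_def
      by (intro openin_K open_Collect_conj open_Collect_less continuous_intros)
    have V1F: "y \<in> F" if "y \<in> V\<^sub>1" for y
    proof -
      have "\<forall>\<^sub>F j in sequentially. \<sigma> * y < \<sigma> * x j"
        using order_tendstoD(1)[OF l(1)] that lq by (auto simp: V\<^sub>1_def)
      then obtain j where j: "\<sigma> * y < \<sigma> * x j" using eventually_happens by fastforce
      have "\<sigma> * x k < \<sigma> * y" using that by (simp add: V\<^sub>1_def)
      then show ?thesis
        using j connectedD_interval[OF \<open>connected F\<close> xF xF, of k y j]
          connectedD_interval[OF \<open>connected F\<close> xF xF, of j y k] \<sigma>(1)
        by (auto simp: abs_if split: if_splits)
    qed
    have "x (Suc k) \<in> V\<^sub>1" using x_less[of k] F_lt[OF xF] xK by (simp add: V\<^sub>1_def)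
    then have V1n: "V\<^sub>1 \<noteq> {}" by blast
    have V2: "openin (top_of_set K) (K \<inter> ball z e)" "K \<inter> ball z e \<noteq> {}"
      using z(1) e(1) by (auto intro: openin_K)
    obtain n y where n: "1 \<le> n" "y \<in> V\<^sub>1" "(f ^^ n) y \<in> K \<inter> ball z e"
      using transD[OF V1 V2(1) V1n V2(2)] .
    define y' where "y' = (f ^^ (s * (n div s))) y"
    have y': "(f ^^ n) y = (f ^^ (n mod s)) y'"
      by (simp add: y'_def funpow_add_apply[symmetric])
    have "\<sigma> * x k < \<sigma> * y'" "\<sigma> * y' < \<sigma> * q"
      using mono[OF V1F[OF n(2)], of "n div s"] F_lt[OF F_iter[OF V1F[OF n(2)]]] n(2)
      by (auto simp: V\<^sub>1_def y'_def)
    then have "\<bar>y' - q\<bar> < \<delta>" using k \<sigma>(1) by (auto simp: abs_if split: if_splits)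
    then have "\<bar>(f ^^ n) y - (f ^^ (n mod s)) q\<bar> < e" unfolding y' using s by (intro \<delta>(2)) auto
    moreover have "2 * e \<le> \<bar>z - (f ^^ (n mod s)) q\<bar>" using s by (intro e(2)) (auto simp: P_def)
    moreover have "\<bar>z - (f ^^ n) y\<bar> < e" using n(3) by (simp add: dist_real_def)
    ultimately show thesis by linarith
  qed
qed

text \<open>The image is exactly \<open>B\<close> rather than a superset, and all earlier images
  stay near \<open>K\<close>. Thus coverings compose with times added, and a self-covering contains
  a periodic point to which weak isolation applies.\<close>

definition covers :: "nat \<Rightarrow> real set \<Rightarrow> real set \<Rightarrow> bool" where
  "covers n A B \<longleftrightarrow> (\<exists>u v. u \<le> v \<and> {u..v} \<subseteq> A \<and> (\<forall>i<n. (f ^^ i) ` {u..v} \<subseteq> nbhd K r) \<and> (f ^^ n) ` {u..v} = B)"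

lemma covers_mono: "covers n A B \<Longrightarrow> A \<subseteq> A' \<Longrightarrow> covers n A' B"
  unfolding covers_def by blast

lemma coversI:
  assumes "u \<le> v" "{u..v} \<subseteq> A" "\<And>i. i < n \<Longrightarrow> (f ^^ i) ` {u..v} \<subseteq> nbhd K r"
    and "c \<le> d" "{c..d} \<subseteq> (f ^^ n) ` {u..v}"
  shows "covers n A {c..d}"
proof -
  have "continuous_on {u..v} (f ^^ n)"
    by (rule iter_cont) (use assms(3) nbhd_D in blast)
  then obtain u' v' where *: "u' \<le> v'" "{u'..v'} \<subseteq> {u..v}" "(f ^^ n) ` {u'..v'} = {c..d}"
    using exact_subinterval[OF _ assms(5,4)] by metis
  have "(f ^^ i) ` {u'..v'} \<subseteq> nbhd K r" if "i < n" for i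
    using assms(3)[OF that] *(2) by blast
  then show ?thesis unfolding covers_def using * assms(2) by blast
qed

lemma covers_subset:
  assumes "covers n A B" "{c..d} \<subseteq> B" "c \<le> d"
  shows "covers n A {c..d}"
proof -
  obtain u v where *: "u \<le> v" "{u..v} \<subseteq> A" "\<forall>i<n. (f ^^ i) ` {u..v} \<subseteq> nbhd K r" "(f ^^ n) ` {u..v} = B"
    using assms(1) unfolding covers_def by blast
  show ?thesis by (rule coversI[OF *(1,2) _ assms(3)]) (use * assms(2) in auto)
qed

text \<open>The first covering is shrunk to one whose image is exactly the interval used by the
  second.\<close>

lemma covers_trans:
  assumes AB: "covers m A B" and BC: "covers n B C"
  shows "covers (n + m) A C"
proof -
  obtain u v where uv: "u \<le> v" "{u..v} \<subseteq> B" "\<forall>i<n. (f ^^ i) ` {u..v} \<subseteq> nbhd K r" "(f ^^ n) ` {u..v} = C"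
    using BC unfolding covers_def by blast
  obtain a b where ab: "a \<le> b" "{a..b} \<subseteq> A" "\<forall>i<m. (f ^^ i) ` {a..b} \<subseteq> nbhd K r" "(f ^^ m) ` {a..b} = {u..v}"
    using covers_subset[OF AB uv(2,1)] unfolding covers_def by blast
  have eq: "(f ^^ (i + m)) ` {a..b} = (f ^^ i) ` {u..v}" for i
    by (simp only: funpow_add image_comp[symmetric] ab(4))
  have "(f ^^ i) ` {a..b} \<subseteq> nbhd K r" if "i < n + m" for i
  proof (cases "i < m")
    case False
    then show ?thesis using eq[of "i - m"] uv(3) that by simp
  qed (use ab in simp)
  then show ?thesis unfolding covers_def using ab eq[of n] uv(4) by blast
qed

lemma covers_self_periodic:
  assumes "covers n {a..b} {a..b}" "0 < n"
  obtains p where "p \<in> {a..b}" "(f ^^ n) p = p" "p \<in> K"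
proof -
  obtain u v where *: "u \<le> v" "{u..v} \<subseteq> {a..b}" "\<forall>i<n. (f ^^ i) ` {u..v} \<subseteq> nbhd K r" "(f ^^ n) ` {u..v} = {a..b}"
    using assms(1) unfolding covers_def by blast
  have cont: "continuous_on {u..v} (\<lambda>y. (f ^^ n) y - y)"
    by (intro continuous_intros iter_cont) (use *(3) nbhd_D in blast)
  then have conn: "connected ((\<lambda>y. (f ^^ n) y - y) ` {u..v})"
    using connected_continuous_image connected_Icc by blast
  have "a \<le> b" using *(1,2) by auto
  then have "a \<in> (f ^^ n) ` {u..v}" "b \<in> (f ^^ n) ` {u..v}" using *(4) by auto
  then obtain y y' where y: "y \<in> {u..v}" "(f ^^ n) y = a" "y' \<in> {u..v}" "(f ^^ n) y' = b" by blast
  then have "(f ^^ n) y - y \<le> 0" "0 \<le> (f ^^ n) y' - y'" using *(2) by auto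
  then have "0 \<in> (\<lambda>y. (f ^^ n) y - y) ` {u..v}"
    using y conn connectedD_interval[of "(\<lambda>y. (f ^^ n) y - y) ` {u..v}" "(f ^^ n) y - y" "(f ^^ n) y' - y'" 0]
    by blast
  then obtain p where p: "p \<in> {u..v}" "(f ^^ n) p = p" by auto
  have "p \<in> K" by (rule periodic_in_K[OF assms(2) p(2)]) (use *(3) p(1) in blast)
  then show thesis using that[of p] p *(2) by blast
qed

end

section \<open>Points reached from an interval\<close>

text \<open>\<open>P\<close> consists of the vertices of a path. For \<open>d = d'\<close> every
  vertex of it has a successor in it, the form in which recurrence is used below.\<close>

lemma trancl_finite_path:
  assumes "(d, d') \<in> E\<^sup>+"
  shows "\<exists>P. finite P \<and> d \<in> P \<and> d' \<in> P \<and> (\<exists>e'\<in>P. (d, e') \<in> E) \<and> (\<forall>e\<in>P - {d'}. \<exists>e'\<in>P. (e, e') \<in> E)"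
  using assms
proof (induction rule: trancl_induct)
  case (base y)
  then show ?case by (intro exI[of _ "{d, y}"]) auto
next
  case (step y z)
  then obtain P where P: "finite P" "d \<in> P" "y \<in> P" "\<exists>e'\<in>P. (d, e') \<in> E" "\<forall>e\<in>P - {y}. \<exists>e'\<in>P. (e, e') \<in> E"
    by blast
  then show ?case using step(2) by (intro exI[of _ "insert z P"]) blast
qed

text \<open>Outside \<open>B\<close> a vertex has at most one successor, so the cycle through a
  recurrent vertex confines the walk from it until it enters \<open>B\<close>. Every reachable
  vertex thus lies in \<open>B\<close> or on one of finitely many finite walks that start at a
  successor of a vertex of \<open>B\<close>.\<close>

lemma finite_reachable_of_recurrent:
  assumes B: "finite B" "b\<^sub>0 \<in> B" and fin: "\<And>b. b \<in> B \<Longrightarrow> finite (E `` {b})"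
    and single: "\<And>c d d'. c \<notin> B \<Longrightarrow> (c, d) \<in> E \<Longrightarrow> (c, d') \<in> E \<Longrightarrow> d = d'"
    and rec: "\<And>c. (b\<^sub>0, c) \<in> E\<^sup>* \<Longrightarrow> (c, c) \<in> E\<^sup>+"
  shows "finite (E\<^sup>* `` {b\<^sub>0})"
proof -
  define E' where "E' = {(c, d) \<in> E. c \<notin> B}"
  define T where "T = E\<^sup>* `` {b\<^sub>0}"
  have finT: "finite (E'\<^sup>* `` {d})" if "d \<in> T" for d
  proof -
    have "(d, d) \<in> E\<^sup>+" using rec that by (simp add: T_def)
    then obtain P where P: "finite P" "d \<in> P" "\<And>e. e \<in> P \<Longrightarrow> \<exists>e'\<in>P. (e, e') \<in> E"
      using trancl_finite_path[of d d E] by blast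
    \<comment> \<open>\<open>P\<close> contains a successor of each of its vertices, and outside
      \<open>B\<close> that successor is the only one.\<close>
    have "e \<in> P" if "(d, e) \<in> E'\<^sup>*" for e
      using that
    proof (induction rule: rtrancl_induct)
      case (step y z)
      then have y: "y \<notin> B" "(y, z) \<in> E" by (auto simp: E'_def)
      then show ?case using P(3)[OF step(3)] single by blast
    qed (rule P(2))
    then have "E'\<^sup>* `` {d} \<subseteq> P" by blast
    then show ?thesis using P(1) finite_subset by blast
  qed
  have "c \<in> B \<union> (\<Union>b\<in>B \<inter> T. \<Union>d\<in>E `` {b}. E'\<^sup>* `` {d})" if "(b\<^sub>0, c) \<in> E\<^sup>*" for c
    using that
  proof (induction rule: rtrancl_induct)
    case (step y z)
    show ?case
    proof (cases "y \<in> B")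
      case True
      then show ?thesis using step(1,2) by (auto simp: T_def)
    next
      case False
      then obtain b d where "b \<in> B \<inter> T" "(b, d) \<in> E" "(d, y) \<in> E'\<^sup>*" using step(3) by blast
      moreover have "(y, z) \<in> E'" using step(2) False by (simp add: E'_def)
      ultimately show ?thesis by (blast intro: rtrancl_into_rtrancl)
    qed
  qed (use B in blast)
  then have "T \<subseteq> B \<union> (\<Union>b\<in>B \<inter> T. \<Union>d\<in>E `` {b}. E'\<^sup>* `` {d})" by (auto simp: T_def)
  moreover have "finite (B \<union> (\<Union>b\<in>B \<inter> T. \<Union>d\<in>E `` {b}. E'\<^sup>* `` {d}))"
  proof -
    have "d \<in> T" if "b \<in> B \<inter> T" "d \<in> E `` {b}" for b d
      using that by (auto simp: T_def intro: rtrancl_into_rtrancl)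
    then show ?thesis using B(1) fin finT by auto
  qed
  ultimately show ?thesis unfolding T_def using finite_subset by blast
qed

lemma closure_connected_real:
  fixes C :: "real set"
  assumes "connected C" "e \<in> closure C" "e \<notin> C"
  shows "e = Inf C \<or> e = Sup C"
proof -
  have ne: "C \<noteq> {}" using assms(2) by auto
  have "(\<forall>y\<in>C. y < e) \<or> (\<forall>y\<in>C. e < y)"
    using connectedD_interval[OF assms(1)] assms(3) by (meson linorder_not_le order.order_iff_strict)
  then show ?thesis
  proof
    assume A: "\<forall>y\<in>C. y < e"
    have "Sup C = e"
    proof (rule cSup_eq_non_empty[OF ne])
      show "x \<le> e" if "x \<in> C" for x using A that by force
      fix y assume "\<And>x. x \<in> C \<Longrightarrow> x \<le> y"
      then have "closure C \<subseteq> {..y}" by (intro closure_minimal) auto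
      then show "e \<le> y" using assms(2) by auto
    qed
    then show ?thesis by simp
  next
    assume A: "\<forall>y\<in>C. e < y"
    have "Inf C = e"
    proof (rule cInf_eq_non_empty[OF ne])
      show "e \<le> x" if "x \<in> C" for x using A that by force
      fix y assume "\<And>x. x \<in> C \<Longrightarrow> y \<le> x"
      then have "closure C \<subseteq> {y..}" by (intro closure_minimal) auto
      then show "y \<le> e" using assms(2) by auto
    qed
    then show ?thesis by simp
  qed
qed

context multimodal_nbhd
begin

text \<open>\<open>K\<close> has no isolated points: by transitivity such a point would return to
  itself, and its finite orbit could not visit the rest of the infinite set
  \<open>K\<close>.\<close>

lemma openK_infinite:
  assumes V: "openin (top_of_set K) V" "V \<noteq> {}"
  shows "infinite V"
proof
  assume fin: "finite V"
  obtain y where y: "y \<in> V" using V(2) by blast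
  obtain T where T: "open T" "V = K \<inter> T" using V(1) openin_open by blast
  have "open (T - (V - {y}))" using T(1) fin by (intro open_Diff finite_imp_closed) auto
  moreover have "K \<inter> (T - (V - {y})) = {y}" using T(2) y by blast
  ultimately have oy: "openin (top_of_set K) {y}" using openin_K by metis
  obtain n y' where n: "1 \<le> n" "y' \<in> {y}" "(f ^^ n) y' \<in> {y}" using transD[OF oy oy] by blast
  then have per: "(f ^^ n) y = y" by simp
  define P where "P = (\<lambda>i. (f ^^ i) y) ` {..<n}"
  have "finite P" by (simp add: P_def)
  then have "\<not> K \<subseteq> P" using K_inf finite_subset by blast
  then have ne: "K \<inter> (- P) \<noteq> {}" by blast
  have oP: "openin (top_of_set K) (K \<inter> (- P))"
    using \<open>finite P\<close> by (intro openin_K) (simp add: finite_imp_closed open_Compl)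
  obtain m y'' where m: "y'' \<in> {y}" "(f ^^ m) y'' \<in> K \<inter> (- P)" using transD[OF oy oP _ ne] by blast
  have "(f ^^ m) y = (f ^^ (m mod n + n * (m div n))) y" by simp
  also have "\<dots> = (f ^^ (m mod n)) y" by (simp only: funpow_add_apply funpow_period[OF per])
  finally have "(f ^^ m) y \<in> P" using n(1) by (simp add: P_def)
  then show False using m by simp
qed

lemma limit_point_witness:
  assumes V: "openin (top_of_set K) V" "v \<in> V" and ev: "eventually P (at v)"
  obtains y where "y \<in> V" "y \<noteq> v" "P y"
proof -
  obtain d where d: "0 < d" "\<And>y. y \<noteq> v \<Longrightarrow> dist y v < d \<Longrightarrow> P y" using ev unfolding eventually_at by auto
  obtain T where T: "open T" "V = K \<inter> T" using V(1) openin_open by blast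
  have "openin (top_of_set K) (K \<inter> (T \<inter> ball v d))" using T(1) by (intro openin_K) auto
  moreover have "v \<in> K \<inter> (T \<inter> ball v d)" using V(2) T(2) d(1) by auto
  ultimately have "infinite (K \<inter> (T \<inter> ball v d))" using openK_infinite by blast
  then have "\<not> K \<inter> (T \<inter> ball v d) \<subseteq> {v}" using finite_subset by blast
  then obtain y where "y \<in> K \<inter> (T \<inter> ball v d)" "y \<noteq> v" by blast
  then show thesis using that[of y] d(2)[of y] T(2) by (auto simp: dist_commute)
qed

section \<open>Orbit segments avoiding a finite set\<close>

lemma dn_nonzero: "v \<in> K \<Longrightarrow> (\<And>i. i < n \<Longrightarrow> (f ^^ i) v \<notin> crit) \<Longrightarrow> dn f n v \<noteq> 0"
  using iter_K by (auto simp: dn_def crit_def)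

text \<open>As long as the orbit of \<open>v\<close> avoids critical points, \<open>f ^^ n\<close>
  has nonzero derivative at \<open>v\<close>, so a small move of \<open>v\<close> within
  \<open>K\<close> takes its image off the finite set \<open>Z\<close>.\<close>

lemma generic_point:
  assumes V: "openin (top_of_set K) V" "V \<noteq> {}" and Z: "finite Z" "crit \<subseteq> Z"
  shows "\<exists>v\<in>V. \<forall>i<n. (f ^^ i) v \<notin> Z"
proof (induction n)
  case 0
  then show ?case using V(2) by auto
next
  case (Suc n)
  then obtain v where v: "v \<in> V" "\<And>i. i < n \<Longrightarrow> (f ^^ i) v \<notin> Z" by blast
  have vK: "v \<in> K" using v(1) V(1) openin_subset by fastforce
  have "dn f n v \<noteq> 0" using v(2) Z(2) by (intro dn_nonzero[OF vK]) blast
  moreover have "((\<lambda>y. ((f ^^ n) y - (f ^^ n) v) / (y - v)) \<longlongrightarrow> dn f n v) (at v)"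
    using iter_deriv[of n v] iter_K_D[OF vK] by (simp add: has_field_derivative_iff)
  ultimately have "\<forall>\<^sub>F y in at v. ((f ^^ n) y - (f ^^ n) v) / (y - v) \<noteq> 0"
    using tendsto_imp_eventually_ne by blast
  then have 1: "\<forall>\<^sub>F y in at v. (f ^^ n) y \<noteq> (f ^^ n) v"
    by (rule eventually_mono) auto
  \<comment> \<open>Continuity avoids every point of \<open>Z\<close> other than the current value
    \<open>(f ^^ n) v\<close>; that value is avoided because of the nonzero derivative.\<close>
  have ev: "\<forall>\<^sub>F y in at v. (f ^^ i) y \<notin> Z - {(f ^^ n) v}" if "i \<le> n" for i
  proof -
    have "(f ^^ i) v \<in> - (Z - {(f ^^ n) v})" using v(2) that by (cases "i = n") auto
    moreover have "open (- (Z - {(f ^^ n) v}))" using Z(1) by (intro open_Compl finite_imp_closed) auto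
    moreover have "((f ^^ i) \<longlongrightarrow> (f ^^ i) v) (at v)" using isCont_iter[OF vK] by (simp add: isCont_def)
    ultimately have "\<forall>\<^sub>F y in at v. (f ^^ i) y \<in> - (Z - {(f ^^ n) v})"
      using topological_tendstoD[of "f ^^ i" "(f ^^ i) v" "at v" "- (Z - {(f ^^ n) v})"] by blast
    then show ?thesis by (rule eventually_mono) blast
  qed
  have ev2: "\<forall>\<^sub>F y in at v. (f ^^ i) y \<notin> Z" if "i < n" for i
  proof -
    have "(f ^^ i) v \<in> - Z" using v(2) that by auto
    moreover have "open (- Z)" using Z(1) by (intro open_Compl finite_imp_closed) auto
    moreover have "((f ^^ i) \<longlongrightarrow> (f ^^ i) v) (at v)" using isCont_iter[OF vK] by (simp add: isCont_def)
    ultimately have "\<forall>\<^sub>F y in at v. (f ^^ i) y \<in> - Z"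
      using topological_tendstoD[of "f ^^ i" "(f ^^ i) v" "at v" "- Z"] by blast
    then show ?thesis by simp
  qed
  have "\<forall>\<^sub>F y in at v. \<forall>i\<in>{..<n}. (f ^^ i) y \<notin> Z"
    by (intro eventually_ball_finite) (use ev2 in auto)
  moreover have "\<forall>\<^sub>F y in at v. (f ^^ n) y \<notin> Z"
    using ev[of n] 1 by (auto elim: eventually_elim2)
  ultimately have "\<forall>\<^sub>F y in at v. \<forall>i<Suc n. (f ^^ i) y \<notin> Z"
    by (rule eventually_elim2) (auto simp: less_Suc_eq)
  from limit_point_witness[OF V(1) v(1) this] show ?case by blast
qed

text \<open>Choose the start generically in the open set of those points of \<open>V\<^sub>1\<close>
  that are in \<open>V\<^sub>2\<close> at one fixed time \<open>n\<close>.\<close>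

lemma generic_path:
  assumes V: "openin (top_of_set K) V\<^sub>1" "openin (top_of_set K) V\<^sub>2" "V\<^sub>1 \<noteq> {}" "V\<^sub>2 \<noteq> {}"
    and Z: "finite Z" "crit \<subseteq> Z"
  obtains n v where "1 \<le> n" "v \<in> V\<^sub>1" "(f ^^ n) v \<in> V\<^sub>2" "\<And>i. i < n \<Longrightarrow> (f ^^ i) v \<notin> Z"
proof -
  obtain n y where n: "1 \<le> n" "y \<in> V\<^sub>1" "(f ^^ n) y \<in> V\<^sub>2" using transD[OF V] by blast
  define V where "V = V\<^sub>1 \<inter> (K \<inter> (f ^^ n) -` V\<^sub>2)"
  have "continuous_on K (f ^^ n)"
    by (intro continuous_at_imp_continuous_on ballI isCont_iter)
  then have "openin (top_of_set K) (K \<inter> (f ^^ n) -` V\<^sub>2)"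
    by (rule continuous_openin_preimage[OF _ _ V(2)]) (use iter_K in auto)
  then have oV: "openin (top_of_set K) V" using V(1) unfolding V_def by blast
  have "y \<in> K" using n(2) V(1) openin_subset by fastforce
  then have "V \<noteq> {}" using n by (auto simp: V_def)
  from generic_point[OF oV this Z, of n] obtain v where "v \<in> V" "\<forall>i<n. (f ^^ i) v \<notin> Z" by blast
  then show thesis using that[of n v] n(1) by (auto simp: V_def)
qed

text \<open>Being interior to a covered interval makes the set open and lets \<open>f\<close>
  propagate it wherever the derivative is not zero.\<close>

definition reach :: "real set \<Rightarrow> real set" where
  "reach Q = {y. \<exists>n c d. c < y \<and> y < d \<and> covers n Q {c..d}}"

lemma open_reach: "open (reach Q)"
proof -
  have "reach Q = (\<Union>(c, d)\<in>{(c, d). \<exists>n. covers n Q {c..d}}. {c<..<d})"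
    by (force simp: reach_def)
  then show ?thesis by auto
qed

text \<open>A nonzero derivative makes \<open>f\<close> take values on both sides of
  \<open>f y\<close> near \<open>y\<close>, so \<open>f y\<close> is again interior to a covered
  interval. At a turning point this can fail.\<close>

lemma reach_step:
  assumes y: "y \<in> reach Q" "y \<in> nbhd K r" "deriv f y \<noteq> 0"
  shows "f y \<in> reach Q"
proof -
  obtain n c d where cov: "c < y" "y < d" "covers n Q {c..d}" using y(1) by (auto simp: reach_def)
  obtain e where e: "0 < e" "ball y e \<subseteq> nbhd K r" using y(2) open_nbhd open_contains_ball by blast
  define h where "h = min (e / 2) (min (y - c) (d - y))"
  have h: "0 < h" "{y - h..y + h} \<subseteq> {c..d}" using e cov by (auto simp: h_def)
  have hN: "{y - h..y + h} \<subseteq> nbhd K r"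
  proof
    fix t assume "t \<in> {y - h..y + h}"
    then have "\<bar>y - t\<bar> \<le> h" by auto
    then have "t \<in> ball y e" using e(1) by (auto simp: h_def dist_real_def)
    then show "t \<in> nbhd K r" using e(2) by blast
  qed
  have der: "(f has_real_derivative deriv f y) (at y)" using f_deriv y(2) nbhd_D by blast
  have "\<exists>y1\<in>{y - h..y + h}. \<exists>y2\<in>{y - h..y + h}. f y1 < f y \<and> f y < f y2"
  proof (cases "0 < deriv f y")
    case True
    obtain d1 where d1: "0 < d1" "\<And>h. 0 < h \<Longrightarrow> h < d1 \<Longrightarrow> f y < f (y + h)"
      using DERIV_pos_inc_right[OF der True] by blast
    obtain d2 where d2: "0 < d2" "\<And>h. 0 < h \<Longrightarrow> h < d2 \<Longrightarrow> f (y - h) < f y"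
      using DERIV_pos_inc_left[OF der True] by blast
    define t where "t = min h (min d1 d2) / 2"
    have t: "0 < t" "t < d1" "t < d2" "t \<le> h" using h(1) d1(1) d2(1) by (auto simp: t_def min_def)
    then show ?thesis using d1(2)[of t] d2(2)[of t] by (intro bexI[of _ "y - t"] bexI[of _ "y + t"]) auto
  next
    case False
    then have neg: "deriv f y < 0" using y(3) by simp
    obtain d1 where d1: "0 < d1" "\<And>h. 0 < h \<Longrightarrow> h < d1 \<Longrightarrow> f (y + h) < f y"
      using DERIV_neg_dec_right[OF der neg] by blast
    obtain d2 where d2: "0 < d2" "\<And>h. 0 < h \<Longrightarrow> h < d2 \<Longrightarrow> f y < f (y - h)"
      using DERIV_neg_dec_left[OF der neg] by blast
    define t where "t = min h (min d1 d2) / 2"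
    have t: "0 < t" "t < d1" "t < d2" "t \<le> h" using h(1) d1(1) d2(1) by (auto simp: t_def min_def)
    then show ?thesis using d1(2)[of t] d2(2)[of t] by (intro bexI[of _ "y + t"] bexI[of _ "y - t"]) auto
  qed
  then obtain y1 y2 where y12: "y1 \<in> {y - h..y + h}" "y2 \<in> {y - h..y + h}" "f y1 < f y" "f y < f y2" by blast
  have "connected (f ` {y - h..y + h})"
    by (rule connected_continuous_image[OF continuous_on_subset[OF f_cont]]) (use hN nbhd_D in auto)
  then have "{f y1..f y2} \<subseteq> f ` {y - h..y + h}"
    using y12 connected_contains_Icc by (metis imageI)
  then have "covers 1 {y - h..y + h} {f y1..f y2}"
    using h(1) hN y12 by (intro coversI[of "y - h" "y + h"]) auto
  moreover have "covers n Q {y - h..y + h}" using covers_subset[OF cov(3) h(2)] h(1) by simp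
  ultimately have "covers (1 + n) Q {f y1..f y2}" by (rule covers_trans[rotated])
  then show ?thesis unfolding reach_def using y12 by blast
qed

text \<open>A grid of step \<open>r / 2\<close> together with the critical points: an interval that
  contains a point of \<open>K\<close> and leaves \<open>nbhd K r\<close> must pass a grid point.
  Components avoiding \<open>Z\<close> and meeting \<open>K\<close> therefore lie where
  \<open>f\<close> is controlled and has no critical point.\<close>

lemma grid:
  obtains Z where "finite Z" "crit \<subseteq> Z" "\<And>X. connected X \<Longrightarrow> X \<inter> Z = {} \<Longrightarrow> X \<inter> K \<noteq> {} \<Longrightarrow> X \<subseteq> nbhd K r"
proof -
  obtain B where B: "\<And>k. k \<in> K \<Longrightarrow> \<bar>k\<bar> \<le> B" using compact_imp_bounded[OF K_compact] by (auto simp: bounded_iff)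
  define s where "s = r / 2"
  have s: "0 < s" using r_pos by (simp add: s_def)
  define N where "N = \<lceil>(B + r) / s\<rceil>"
  define G where "G = (\<lambda>l. real_of_int l * s) ` {-N..N}"
  have G: "real_of_int l * s \<in> G" if "\<bar>real_of_int l * s\<bar> \<le> B + r" for l
  proof -
    have "\<bar>real_of_int l\<bar> * s \<le> B + r" using that s by (simp add: abs_mult)
    then have "\<bar>real_of_int l\<bar> \<le> (B + r) / s" using s by (simp add: pos_le_divide_eq)
    also have "\<dots> \<le> real_of_int N" by (simp add: N_def)
    finally have "l \<in> {-N..N}" by auto
    then show ?thesis unfolding G_def by (rule imageI)
  qed
  show thesis
  proof (rule that[of "crit \<union> G"])
    fix X assume X: "connected X" "X \<inter> (crit \<union> G) = {}" "X \<inter> K \<noteq> {}"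
    then obtain \<kappa> where \<kappa>: "\<kappa> \<in> X" "\<kappa> \<in> K" by blast
    show "X \<subseteq> nbhd K r"
    proof
      fix y assume y: "y \<in> X"
      show "y \<in> nbhd K r"
      proof (rule ccontr)
        assume "y \<notin> nbhd K r"
        then have far: "r \<le> \<bar>y - \<kappa>\<bar>" using ball_nbhd[OF \<kappa>(2)] by (meson not_less)
        have "\<exists>l. \<bar>real_of_int l * s - \<kappa>\<bar> \<le> s \<and> real_of_int l * s \<in> X"
        proof (cases "\<kappa> < y")
          case True
          define l where "l = \<lfloor>\<kappa> / s\<rfloor> + 1"
          have "\<kappa> / s < real_of_int l" "real_of_int l \<le> \<kappa> / s + 1" unfolding l_def by linarith+
          then have "\<kappa> < real_of_int l * s" "real_of_int l * s \<le> \<kappa> + s"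
            using s by (simp_all add: field_simps)
          moreover have "real_of_int l * s \<in> X"
            by (rule connectedD_interval[OF X(1) \<kappa>(1) y]) (use calculation True far s_def r_pos in auto)
          ultimately show ?thesis by (intro exI[of _ l]) auto
        next
          case False
          define l where "l = \<lceil>\<kappa> / s\<rceil> - 1"
          have "real_of_int l < \<kappa> / s" "\<kappa> / s - 1 \<le> real_of_int l" unfolding l_def by linarith+
          then have "real_of_int l * s < \<kappa>" "\<kappa> - s \<le> real_of_int l * s"
            using s by (simp_all add: field_simps)
          moreover have "real_of_int l * s \<in> X"
            by (rule connectedD_interval[OF X(1) y \<kappa>(1)]) (use calculation False far s_def r_pos in auto)
          ultimately show ?thesis by (intro exI[of _ l]) auto
        qed
        then obtain l where l: "\<bar>real_of_int l * s - \<kappa>\<bar> \<le> s" "real_of_int l * s \<in> X" by blast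
        have "s \<le> r" using r_pos by (simp add: s_def)
        then have "\<bar>real_of_int l * s\<bar> \<le> B + r" using l(1) B[OF \<kappa>(2)] by linarith
        then show False using G l(2) X(2) by blast
      qed
    qed
  qed (use finite_crit in \<open>auto simp: G_def\<close>)
qed

text \<open>
  Cut the reached set at the finite set \<open>Z\<close>. A component that does not meet \<open>Z\<close> is mapped into a single
  component, and by transitivity every component returns to itself. Starting from the finitely many
  components that meet \<open>Z\<close> one therefore reaches only finitely many components, and the points of \<open>K\<close>
  that are not reached are end points of these.
\<close>

lemma finite_not_reached:
  assumes Q: "{a<..<b} \<inter> K \<noteq> {}"
  shows "finite (K - reach {a..b})"
proof -
  define R where "R = reach {a..b}"
  obtain Z where Z: "finite Z" "crit \<subseteq> Z" "\<And>X. connected X \<Longrightarrow> X \<inter> Z = {} \<Longrightarrow> X \<inter> K \<noteq> {} \<Longrightarrow> X \<subseteq> nbhd K r"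
    using grid by blast
  define V where "V = K \<inter> {a<..<b}"
  have V: "openin (top_of_set K) V" "V \<noteq> {}" using Q by (auto simp: V_def openin_K)
  have step: "f y \<in> R" if "y \<in> R" "y \<in> nbhd K r" "y \<notin> Z" for y
    unfolding R_def by (rule reach_step) (use that critI Z(2) in \<open>auto simp: R_def\<close>)
  have abR: "{a<..<b} \<subseteq> R"
  proof
    fix y assume "y \<in> {a<..<b}"
    moreover have "covers 0 {a..b} {a..b}" using Q by (intro coversI[of a b]) auto
    ultimately show "y \<in> R" unfolding R_def reach_def by auto
  qed
  define comp where "comp y = connected_component_set R y" for y
  have comp_self: "y \<in> comp y" if "y \<in> R" for y using that by (simp add: comp_def connected_component_refl)
  have comp_conn: "connected (comp y)" and comp_sub: "comp y \<subseteq> R" for y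
    by (auto simp: comp_def connected_component_subset)
  have comp_eqI: "comp y = comp y'" if "connected X" "X \<subseteq> R" "y \<in> X" "y' \<in> X" for X y y'
  proof -
    have "connected_component R y y'" unfolding connected_component_def using that by blast
    then show ?thesis unfolding comp_def using connected_component_eq_eq that by blast
  qed
  \<comment> \<open>The reached points of \<open>K\<close> at which \<open>reach_step\<close>
    applies. The graph \<open>E\<close> below records the components visited in one such
    step.\<close>
  define Y where "Y = (K \<inter> R) - Z"
  have YN: "y \<in> nbhd K r" if "y \<in> Y" for y using that K_nbhd by (auto simp: Y_def)
  have fY: "f y \<in> K \<inter> R" if "y \<in> Y" for y
    using step[of y] that YN[OF that] f_K by (auto simp: Y_def)
  define E where "E = {(comp y, comp (f y)) | y. y \<in> Y}"
  \<comment> \<open>The image of such a set \<open>X\<close> is connected and reached, so it lies in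
    one component.\<close>
  have same: "comp (f y) = comp (f y')"
    if "y \<in> Y" "y' \<in> Y" "connected X" "X \<subseteq> R" "X \<inter> Z = {}" "y \<in> X" "y' \<in> X" for y y' X
  proof (rule comp_eqI[of "f ` X"])
    have "X \<inter> K \<noteq> {}" using that by (auto simp: Y_def)
    then have XN: "X \<subseteq> nbhd K r" using Z(3) that by blast
    show "connected (f ` X)"
      by (rule connected_continuous_image[OF continuous_on_subset[OF f_cont] that(3)]) (use XN nbhd_D in blast)
    show "f ` X \<subseteq> R" using step XN that(4,5) by blast
  qed (use that in auto)
  obtain k0 where k0: "k0 \<in> V" using V(2) by blast
  have Vcomp: "comp y = comp k0" if "y \<in> V" for y
    by (rule comp_eqI[of "{a<..<b}"]) (use abR that k0 in \<open>auto simp: V_def\<close>)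
  define B where "B = insert (comp k0) (comp ` (Z \<inter> R))"
  have path: "(comp v, comp ((f ^^ n) v)) \<in> E\<^sup>* \<and> (0 < n \<longrightarrow> (comp v, comp ((f ^^ n) v)) \<in> E\<^sup>+)"
    if v: "v \<in> K \<inter> R" "\<And>i. i < n \<Longrightarrow> (f ^^ i) v \<notin> Z" for v n
  proof -
    have "(f ^^ n) v \<in> R \<and> (comp v, comp ((f ^^ n) v)) \<in> E\<^sup>* \<and> (0 < n \<longrightarrow> (comp v, comp ((f ^^ n) v)) \<in> E\<^sup>+)"
      using v(2)
    proof (induction n)
      case (Suc n)
      then have IH: "(f ^^ n) v \<in> R" "(comp v, comp ((f ^^ n) v)) \<in> E\<^sup>*" by auto
      have y: "(f ^^ n) v \<in> Y" using IH(1) Suc(2)[of n] iter_K v(1) by (auto simp: Y_def)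
      then have "(comp ((f ^^ n) v), comp (f ((f ^^ n) v))) \<in> E" unfolding E_def by blast
      then have "(comp v, comp ((f ^^ Suc n) v)) \<in> E\<^sup>+" using IH(2) by (simp add: rtrancl_into_trancl1)
      then show ?case using fY[OF y] by (auto intro: trancl_into_rtrancl)
    qed (use v in simp)
    then show ?thesis by blast
  qed
  have comp_openK: "openin (top_of_set K) (K \<inter> comp y)" for y
    unfolding comp_def by (intro openin_K open_connected_component) (simp add: R_def open_reach)
  \<comment> \<open>The orbit segments given by transitivity may be chosen to avoid
    \<open>Z\<close>, hence to consist of edges of \<open>E\<close>.\<close>
  have reachable: "(comp k0, comp y) \<in> E\<^sup>*" if y: "y \<in> K \<inter> R" for y
  proof -
    have "K \<inter> comp y \<noteq> {}" using y comp_self by blast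
    then obtain n v where n: "v \<in> V" "(f ^^ n) v \<in> K \<inter> comp y" "\<And>i. i < n \<Longrightarrow> (f ^^ i) v \<notin> Z"
      using generic_path[OF V(1) comp_openK[of y] V(2) _ Z(1,2)] by metis
    have "v \<in> K \<inter> R" using n(1) abR by (auto simp: V_def)
    then have "(comp v, comp ((f ^^ n) v)) \<in> E\<^sup>*" using path[of v n] n(3) by blast
    moreover have "comp ((f ^^ n) v) = comp y"
      by (rule comp_eqI[of "comp y"]) (use n(2) y comp_self comp_sub comp_conn in auto)
    ultimately show ?thesis using Vcomp[OF n(1)] by simp
  qed
  have only: "\<exists>y\<in>K \<inter> R. C = comp y" if "(comp k0, C) \<in> E\<^sup>*" for C
    using that
  proof (cases rule: rtranclE)
    case base
    then show ?thesis using k0 abR by (auto simp: V_def)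
  next
    case (step y)
    then show ?thesis using fY by (auto simp: E_def)
  qed
  have "finite (E\<^sup>* `` {comp k0})"
  proof (rule finite_reachable_of_recurrent[of B])
    show "finite B" "comp k0 \<in> B" using Z(1) by (auto simp: B_def)
    show "finite (E `` {C})" for C
    proof -
      \<comment> \<open>The points of \<open>Z\<close> cut a component into finitely many pieces,
        and the edge depends only on the piece. The piece of \<open>y\<close> is encoded by the set
        of points of \<open>Z\<close> to its left.\<close>
      define g where "g W = comp (f (SOME y. y \<in> Y \<and> comp y = C \<and> Z \<inter> {..<y} = W))" for W
      have "E `` {C} \<subseteq> g ` Pow Z"
      proof
        fix C' assume "C' \<in> E `` {C}"
        then obtain y where y: "y \<in> Y" "comp y = C" "C' = comp (f y)" by (auto simp: E_def)
        define y' where "y' = (SOME y'. y' \<in> Y \<and> comp y' = C \<and> Z \<inter> {..<y'} = Z \<inter> {..<y})"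
        have y': "y' \<in> Y \<and> comp y' = C \<and> Z \<inter> {..<y'} = Z \<inter> {..<y}"
          unfolding y'_def by (rule someI[of _ y]) (use y in auto)
        have inC: "y \<in> C" "y' \<in> C" using comp_self y y' by (auto simp: Y_def)
        have Cc: "connected C" "C \<subseteq> R" using comp_conn comp_sub y(2) by auto
        have "comp (f y) = comp (f y')"
        proof (rule same[of y y' "closed_segment y y'"])
          show "closed_segment y y' \<subseteq> R"
            using connected_contains_Icc[OF Cc(1)] inC Cc(2) unfolding closed_segment_eq_real_ivl by auto
          show "closed_segment y y' \<inter> Z = {}"
          proof (rule ccontr)
            assume "closed_segment y y' \<inter> Z \<noteq> {}"
            then obtain z where z: "z \<in> Z" "z \<in> closed_segment y y'" by blast
            have "z \<noteq> y" "z \<noteq> y'" using z(1) y(1) y' by (auto simp: Y_def)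
            then have "y < z \<and> z < y' \<or> y' < z \<and> z < y"
              using z(2) by (auto simp: closed_segment_eq_real_ivl split: if_splits)
            then have "(z \<in> Z \<inter> {..<y}) \<noteq> (z \<in> Z \<inter> {..<y'})" using z(1) by auto
            then show False using y' by blast
          qed
        qed (use y y' in auto)
        then have "C' = g (Z \<inter> {..<y})" unfolding y(3) g_def y'_def .
        then show "C' \<in> g ` Pow Z" by blast
      qed
      then show ?thesis using Z(1) finite_subset by blast
    qed
    show "D' = D''" if C: "C \<notin> B" and D: "(C, D') \<in> E" "(C, D'') \<in> E" for C D' D''
    proof -
      obtain y y' where y: "y \<in> Y" "C = comp y" "D' = comp (f y)" "y' \<in> Y" "C = comp y'" "D'' = comp (f y')"
        using D by (auto simp: E_def)
      have "C \<inter> Z = {}"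
      proof (rule ccontr)
        assume "C \<inter> Z \<noteq> {}"
        then obtain z where z: "z \<in> C" "z \<in> Z" by blast
        then have "z \<in> R" using comp_sub y(2) by blast
        moreover have "comp z = C" unfolding y(2)
          by (rule comp_eqI[of C]) (use z(1) y comp_conn comp_sub comp_self in \<open>auto simp: Y_def\<close>)
        ultimately show False using C z(2) unfolding B_def by blast
      qed
      then show ?thesis unfolding y(3,6)
        using y comp_conn comp_sub comp_self by (intro same[of y y' C]) (auto simp: Y_def)
    qed
    show "(C, C) \<in> E\<^sup>+" if "(comp k0, C) \<in> E\<^sup>*" for C
    proof -
      from only[OF that] obtain y where y: "y \<in> K \<inter> R" "C = comp y" by blast
      have ne: "K \<inter> comp y \<noteq> {}" using y comp_self by blast
      obtain n v where n: "1 \<le> n" "v \<in> K \<inter> comp y" "(f ^^ n) v \<in> K \<inter> comp y" "\<And>i. i < n \<Longrightarrow> (f ^^ i) v \<notin> Z"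
        using generic_path[OF comp_openK[of y] comp_openK[of y] ne ne Z(1,2)] by metis
      have "v \<in> K \<inter> R" using n(2) comp_sub by blast
      then have "(comp v, comp ((f ^^ n) v)) \<in> E\<^sup>+" using path[of v n] n(1,4) by auto
      moreover have "comp ((f ^^ n) v) = comp y" "comp v = comp y"
        by (rule comp_eqI[of "comp y"]; use n(2,3) y comp_self comp_sub comp_conn in auto)+
      ultimately show ?thesis using y(2) by simp
    qed
  qed
  moreover have "comp ` (K \<inter> R) \<subseteq> E\<^sup>* `` {comp k0}" using reachable by blast
  ultimately have finC: "finite (comp ` (K \<inter> R))" using finite_subset by blast
  \<comment> \<open>Reached points are dense in \<open>K\<close>, since generic paths from
    \<open>V\<close> stay reached, and finitely many components have finitely many end
    points.\<close>
  have "K - R \<subseteq> Inf ` comp ` (K \<inter> R) \<union> Sup ` comp ` (K \<inter> R)"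
  proof
    fix e assume e: "e \<in> K - R"
    have "e \<in> closure (K \<inter> R)"
      unfolding closure_approachable
    proof (intro allI impI)
      fix \<epsilon> :: real assume \<epsilon>: "0 < \<epsilon>"
      have ne: "K \<inter> ball e \<epsilon> \<noteq> {}" using e \<epsilon> by auto
      have op: "openin (top_of_set K) (K \<inter> ball e \<epsilon>)" by (rule openin_K) simp
      obtain n v where n: "v \<in> V" "(f ^^ n) v \<in> K \<inter> ball e \<epsilon>" "\<And>i. i < n \<Longrightarrow> (f ^^ i) v \<notin> Z"
        using generic_path[OF V(1) op V(2) ne Z(1,2)] by metis
      have "(f ^^ i) v \<in> K \<inter> R" if "i \<le> n" for i
        using that
      proof (induction i)
        case (Suc i)
        then have "(f ^^ i) v \<in> Y" using n(3)[of i] by (auto simp: Y_def)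
        then show ?case using fY by simp
      qed (use n(1) abR in \<open>auto simp: V_def\<close>)
      then show "\<exists>y\<in>K \<inter> R. dist y e < \<epsilon>" using n(2) by (intro bexI[of _ "(f ^^ n) v"]) (auto simp: dist_commute)
    qed
    moreover have "K \<inter> R \<subseteq> \<Union> (comp ` (K \<inter> R))" using comp_self by blast
    ultimately have "e \<in> closure (\<Union> (comp ` (K \<inter> R)))" using closure_mono by blast
    then obtain y where y: "y \<in> K \<inter> R" "e \<in> closure (comp y)"
    proof -
      have "\<Union> (comp ` (K \<inter> R)) \<subseteq> (\<Union>C\<in>comp ` (K \<inter> R). closure C)" using closure_subset by blast
      then have "closure (\<Union> (comp ` (K \<inter> R))) \<subseteq> (\<Union>C\<in>comp ` (K \<inter> R). closure C)"
        using finC by (intro closure_minimal closed_UN) auto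
      then show ?thesis using \<open>e \<in> closure (\<Union> (comp ` (K \<inter> R)))\<close> that by blast
    qed
    have "e \<notin> comp y" using e comp_sub by blast
    then show "e \<in> Inf ` comp ` (K \<inter> R) \<union> Sup ` comp ` (K \<inter> R)"
      using closure_connected_real[OF comp_conn y(2)] y(1) by blast
  qed
  then show ?thesis unfolding R_def[symmetric] using finC finite_subset by blast
qed

text \<open>The orbit of \<open>x\<close> is infinite and only finitely many points of
  \<open>K\<close> are missed, so it enters each reached set; it stays there because it avoids
  critical points. A finite \<open>\<delta> / 2\<close>-net of \<open>K\<close> gives one time
  \<open>i\<^sub>0\<close>, one bound \<open>q\<^sub>0\<close> and one radius for all
  \<open>k\<close>.\<close>

lemma covers_orbit_uniformly:
  assumes x: "x \<in> K" "inj (\<lambda>i. (f ^^ i) x)" "\<And>i. (f ^^ i) x \<notin> crit" and \<delta>: "0 < \<delta>"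
  obtains i\<^sub>0 q\<^sub>0 \<rho> where "0 < \<rho>"
    "\<forall>k\<in>K. \<exists>q\<le>q\<^sub>0. covers q {k - \<delta>..k + \<delta>} {(f ^^ i\<^sub>0) x - \<rho>..(f ^^ i\<^sub>0) x + \<rho>}"
proof -
  obtain F where F: "finite F" "F \<subseteq> K" "K \<subseteq> (\<Union>k\<in>F. ball k (\<delta> / 2))"
    using compactE_image[OF K_compact, of K "\<lambda>k. ball k (\<delta> / 2)"] \<delta> by force
  define Q where "Q k = {k - \<delta> / 2..k + \<delta> / 2}" for k
  have "\<exists>i. (f ^^ i) x \<in> reach (Q k)" if "k \<in> F" for k
  proof (rule ccontr)
    assume *: "\<nexists>i. (f ^^ i) x \<in> reach (Q k)"
    have "k \<in> {k - \<delta> / 2<..<k + \<delta> / 2} \<inter> K" using that F(2) \<delta> by auto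
    then have "finite (K - reach (Q k))" unfolding Q_def by (intro finite_not_reached) blast
    moreover have "range (\<lambda>i. (f ^^ i) x) \<subseteq> K - reach (Q k)" using * iter_K[OF x(1)] by blast
    ultimately show False using x(2) finite_subset finite_imageD infinite_UNIV_nat by blast
  qed
  then obtain i where i: "\<And>k. k \<in> F \<Longrightarrow> (f ^^ i k) x \<in> reach (Q k)" by metis
  define i\<^sub>0 where "i\<^sub>0 = Max (insert 0 (i ` F))"
  have i0: "i k \<le> i\<^sub>0" if "k \<in> F" for k unfolding i\<^sub>0_def using F(1) that by (intro Max_ge) auto
  have later: "(f ^^ (j + i k)) x \<in> reach (Q k)" if "k \<in> F" for j k
  proof (induction j)
    case (Suc j)
    define y where "y = (f ^^ (j + i k)) x"
    have "y \<in> K" "y \<notin> crit" using x iter_K by (auto simp: y_def)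
    then have "f y \<in> reach (Q k)" using Suc K_nbhd by (intro reach_step) (auto simp: y_def crit_def)
    then show ?case by (simp add: y_def)
  qed (use i that in simp)
  define y where "y = (f ^^ i\<^sub>0) x"
  have "y \<in> reach (Q k)" if "k \<in> F" for k
    using later[OF that, of "i\<^sub>0 - i k"] i0[OF that] by (simp add: y_def)
  then have "\<forall>k\<in>F. \<exists>n c d. c < y \<and> y < d \<and> covers n (Q k) {c..d}" by (auto simp: reach_def)
  then obtain n c d where ncd: "\<And>k. k \<in> F \<Longrightarrow> c k < y \<and> y < d k \<and> covers (n k) (Q k) {c k..d k}" by metis
  define q\<^sub>0 where "q\<^sub>0 = Max (insert 0 (n ` F))"
  define \<rho> where "\<rho> = Min (insert 1 ((\<lambda>k. min (y - c k) (d k - y)) ` F))"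
  show thesis
  proof (rule that[of \<rho> q\<^sub>0 i\<^sub>0])
    show \<rho>: "0 < \<rho>" unfolding \<rho>_def using F(1) ncd by (subst Min_gr_iff) auto
    show "\<forall>k\<in>K. \<exists>q\<le>q\<^sub>0. covers q {k - \<delta>..k + \<delta>} {(f ^^ i\<^sub>0) x - \<rho>..(f ^^ i\<^sub>0) x + \<rho>}"
    proof
      fix k assume "k \<in> K"
      then obtain k' where k': "k' \<in> F" "\<bar>k' - k\<bar> < \<delta> / 2" using F(3) by (auto simp: dist_real_def)
      have "\<rho> \<le> min (y - c k') (d k' - y)" unfolding \<rho>_def using F(1) k'(1) by (intro Min_le) auto
      then have "{y - \<rho>..y + \<rho>} \<subseteq> {c k'..d k'}" by auto
      then have "covers (n k') (Q k') {y - \<rho>..y + \<rho>}" using ncd[OF k'(1)] \<rho> covers_subset by auto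
      moreover have "Q k' \<subseteq> {k - \<delta>..k + \<delta>}" using k'(2) by (auto simp: Q_def abs_if split: if_splits)
      ultimately have "covers (n k') {k - \<delta>..k + \<delta>} {y - \<rho>..y + \<rho>}" by (rule covers_mono)
      moreover have "n k' \<le> q\<^sub>0" unfolding q\<^sub>0_def using F(1) k'(1) by (intro Max_ge) auto
      ultimately show "\<exists>q\<le>q\<^sub>0. covers q {k - \<delta>..k + \<delta>} {(f ^^ i\<^sub>0) x - \<rho>..(f ^^ i\<^sub>0) x + \<rho>}"
        unfolding y_def by blast
    qed
  qed
qed


section \<open>Gaps of the invariant set\<close>

text \<open>Adding \<open>z\<close> to \<open>K\<close> gives a compact forward invariant set in
  \<open>IK\<close>, so maximality puts it in \<open>K\<close>.\<close>

lemma K_backward: "z \<in> IK \<Longrightarrow> f z \<in> K \<Longrightarrow> z \<in> K"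
proof -
  assume z: "z \<in> IK" "f z \<in> K"
  have "compact (insert z K)" using K_compact by simp
  moreover have "insert z K \<subseteq> IK" using z gmD(10) by blast
  moreover have "f ` insert z K \<subseteq> insert z K" using z(2) f_K by blast
  ultimately show "z \<in> K" using gmD(12) by blast
qed

lemma K_backward_iter: "(\<And>l. l < i \<Longrightarrow> (f ^^ l) z \<in> IK) \<Longrightarrow> (f ^^ i) z \<in> K \<Longrightarrow> z \<in> K"
proof (induction i)
  case (Suc i)
  have "(f ^^ i) z \<in> K" using K_backward[of "(f ^^ i) z"] Suc.prems by simp
  then show ?case using Suc by simp
qed simp

lemma connected_segment:
  fixes X :: "real set"
  shows "connected X \<Longrightarrow> x \<in> X \<Longrightarrow> y \<in> X \<Longrightarrow> closed_segment x y \<subseteq> X"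
  using connected_contains_Icc[of X x y] connected_contains_Icc[of X y x]
  by (auto simp: closed_segment_eq_real_ivl)

text \<open>The gap next to \<open>a\<close> on the side of \<open>b\<close> ends at the first point
  of \<open>K\<close> from \<open>b\<close> on; it exists because the end \<open>\<alpha>\<close> or
  \<open>\<beta>\<close> on that side belongs to \<open>K\<close>.\<close>

lemma next_point_of_K:
  assumes a: "a \<in> K" "\<alpha> < a" "a < \<beta>" "\<alpha> \<in> K" "\<beta> \<in> K" and b: "b \<noteq> a" "open_segment a b \<inter> K = {}"
  obtains b' where "b' \<in> K" "b' \<noteq> a" "open_segment a b' \<inter> K = {}" "closed_segment a b' \<subseteq> {\<alpha>..\<beta>}"
proof (cases "a < b")
  case True
  have "\<not> \<beta> < b" using b(2) a(3,5) by (auto simp: open_segment_eq_real_ivl)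
  have cl: "closed (K \<inter> {b..})" using K_compact by (intro closed_Int compact_imp_closed) auto
  have ne: "K \<inter> {b..} \<noteq> {}" using a(5) \<open>\<not> \<beta> < b\<close> by auto
  have bd: "bdd_below (K \<inter> {b..})" by (intro bdd_belowI[of _ b]) auto
  define b' where "b' = Inf (K \<inter> {b..})"
  have b': "b' \<in> K" "b \<le> b'" using closed_contains_Inf[OF ne bd cl] by (auto simp: b'_def)
  have le: "b' \<le> y" if "y \<in> K" "b \<le> y" for y
    unfolding b'_def using bd that by (intro cInf_lower) auto
  show thesis
  proof (rule that[OF b'(1)])
    show "open_segment a b' \<inter> K = {}"
    proof (rule ccontr)
      assume "open_segment a b' \<inter> K \<noteq> {}"
      then obtain y where y: "a < y" "y < b'" "y \<in> K" using True b'(2) by (auto simp: open_segment_eq_real_ivl)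
      then have "y < b" using le[of y] by force
      then show False using y True b(2) by (auto simp: open_segment_eq_real_ivl)
    qed
    show "closed_segment a b' \<subseteq> {\<alpha>..\<beta>}"
      using le[OF a(5)] \<open>\<not> \<beta> < b\<close> a True b'(2) by (auto simp: closed_segment_eq_real_ivl)
  qed (use True b' in simp)
next
  case False
  then have lt: "b < a" using b(1) by simp
  have "\<not> b < \<alpha>" using b(2) a(2,4) by (auto simp: open_segment_eq_real_ivl)
  have cl: "closed (K \<inter> {..b})" using K_compact by (intro closed_Int compact_imp_closed) auto
  have ne: "K \<inter> {..b} \<noteq> {}" using a(4) \<open>\<not> b < \<alpha>\<close> by auto
  have bd: "bdd_above (K \<inter> {..b})" by (intro bdd_aboveI[of _ b]) auto
  define b' where "b' = Sup (K \<inter> {..b})"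
  have b': "b' \<in> K" "b' \<le> b" using closed_contains_Sup[OF ne bd cl] by (auto simp: b'_def)
  have le: "y \<le> b'" if "y \<in> K" "y \<le> b" for y
    unfolding b'_def using bd that by (intro cSup_upper) auto
  show thesis
  proof (rule that[OF b'(1)])
    show "open_segment a b' \<inter> K = {}"
    proof (rule ccontr)
      assume "open_segment a b' \<inter> K \<noteq> {}"
      then obtain y where y: "b' < y" "y < a" "y \<in> K" using lt b'(2) by (auto simp: open_segment_eq_real_ivl split: if_splits)
      then have "b < y" using le[of y] by force
      then show False using y lt b(2) by (auto simp: open_segment_eq_real_ivl)
    qed
    show "closed_segment a b' \<subseteq> {\<alpha>..\<beta>}"
      using le[OF a(4)] \<open>\<not> b < \<alpha>\<close> a lt b'(2) by (auto simp: closed_segment_eq_real_ivl)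
  qed (use lt b' in simp)
qed

text \<open>
  If the orbit of \<open>a\<close> avoided the end points of the intervals forming \<open>IK\<close>, the images of the gap next to
  \<open>a\<close> would stay in \<open>IK\<close>, and adding them to \<open>K\<close> would contradict the maximality of \<open>K\<close>.
\<close>

lemma gap_end_hits_boundary:
  obtains ES where "finite ES"
    "\<forall>a b. a \<in> K \<longrightarrow> b \<noteq> a \<longrightarrow> open_segment a b \<inter> K = {} \<longrightarrow> (\<exists>i. (f ^^ i) a \<in> ES)"
proof -
  obtain m :: nat and \<alpha> \<beta> where IK: "IK = (\<Union>j<m. {\<alpha> j..\<beta> j})"
    and ends: "\<forall>j<m. \<alpha> j \<le> \<beta> j \<and> \<alpha> j \<in> K \<and> \<beta> j \<in> K"
    using generalized_multimodal_intervals(1)[OF gm] by blast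
  have KIK: "K \<subseteq> IK" by (rule gmD(10))
  define ES where "ES = \<alpha> ` {..<m} \<union> \<beta> ` {..<m}"
  have inner: "\<exists>j<m. \<alpha> j < p \<and> p < \<beta> j" if p: "p \<in> K" "p \<notin> ES" for p
  proof -
    obtain j where j: "j < m" "p \<in> {\<alpha> j..\<beta> j}" using p(1) KIK IK by auto
    then have "p \<noteq> \<alpha> j" "p \<noteq> \<beta> j" using p(2) by (auto simp: ES_def)
    then show ?thesis using j by force
  qed
  have "\<exists>i. (f ^^ i) a \<in> ES" if a: "a \<in> K" and b: "b \<noteq> a" "open_segment a b \<inter> K = {}" for a b
  proof (rule ccontr)
    assume "\<nexists>i. (f ^^ i) a \<in> ES"
    then have notES: "(f ^^ i) a \<notin> ES" for i by blast
    obtain j where j: "j < m" "\<alpha> j < a" "a < \<beta> j" using inner[OF a] notES[of 0] by auto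
    obtain b' where b': "b' \<in> K" "b' \<noteq> a" "open_segment a b' \<inter> K = {}" "closed_segment a b' \<subseteq> {\<alpha> j..\<beta> j}"
      using next_point_of_K[OF a j(2,3) _ _ b] ends j(1) by blast
    define S where "S = closed_segment a b'"
    have SIK: "S \<subseteq> IK" using b'(4) j(1) IK by (auto simp: S_def)
    have SK: "S \<inter> K \<subseteq> {a, b'}" using b'(3) by (auto simp: S_def open_segment_def)
    have I: "(f ^^ i) ` S \<subseteq> IK" for i
    proof (induction i rule: less_induct)
      case (less i)
      then have IHz: "(f ^^ l) z \<in> IK" if "l < i" "z \<in> S" for l z using that by blast
      show ?case
      proof
        fix y assume "y \<in> (f ^^ i) ` S"
        then obtain z where z: "z \<in> S" "y = (f ^^ i) z" by blast
        show "y \<in> IK"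
        proof (rule ccontr)
          assume y: "y \<notin> IK"
          \<comment> \<open>If an image leaves \<open>IK\<close>, the image of a piece of the gap
            passes through an end point \<open>e\<close> of the interval of \<open>IK\<close>
            containing \<open>p\<close>. As \<open>e\<close> is in \<open>K\<close>, it pulls back
            to a point of \<open>K\<close> in that piece, which can only be \<open>a\<close>; but
            \<open>p\<close> is not an end point.\<close>
          define p where "p = (f ^^ i) a"
          have p: "p \<in> K" "p \<notin> ES" using iter_K[OF a] notES by (auto simp: p_def)
          obtain l where l: "l < m" "\<alpha> l < p" "p < \<beta> l" using inner[OF p] by blast
          have "z \<noteq> b'" using y z(2) iter_K[OF b'(1)] KIK by blast
          have sub: "closed_segment a z \<subseteq> S" using z(1) unfolding S_def by (simp add: subset_closed_segment)
          have "b' \<notin> closed_segment a z"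
            using z(1) \<open>z \<noteq> b'\<close> by (auto simp: S_def closed_segment_eq_real_ivl split: if_splits)
          have "connected ((f ^^ i) ` closed_segment a z)"
            by (rule connected_continuous_image[OF iter_cont]) (use IHz sub gmD(11) in blast, simp)
          moreover have "p \<in> (f ^^ i) ` closed_segment a z" "y \<in> (f ^^ i) ` closed_segment a z"
            using z(2) by (auto simp: p_def)
          moreover have "y < \<alpha> l \<or> \<beta> l < y" using y l(1) IK by force
          ultimately have "\<alpha> l \<in> (f ^^ i) ` closed_segment a z \<or> \<beta> l \<in> (f ^^ i) ` closed_segment a z"
            using l(2,3) by (meson connectedD_interval less_imp_le)
          then obtain e w where w: "e = \<alpha> l \<or> e = \<beta> l" "w \<in> closed_segment a z" "e = (f ^^ i) w" by blast
          have "e \<in> K" using w(1) ends l(1) by blast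
          then have "w \<in> K" using K_backward_iter[of i w] IHz sub w(2,3) by blast
          then have "w = a" using SK sub w(2) \<open>b' \<notin> closed_segment a z\<close> by blast
          then show False using w(1,3) l(2,3) by (auto simp: p_def)
        qed
      qed
    qed
    \<comment> \<open>Forward invariant but perhaps not closed; its closure stays in the compact set
      \<open>IK\<close>, where \<open>f\<close> is continuous.\<close>
    define X where "X = K \<union> (\<Union>i. (f ^^ i) ` S)"
    have XIK: "X \<subseteq> IK" using KIK I by (auto simp: X_def)
    have cIK: "compact IK" unfolding IK by (intro compact_UN) auto
    have clX: "closure X \<subseteq> IK" using XIK compact_imp_closed[OF cIK] closure_minimal by blast
    have "f ` X \<subseteq> X"
    proof
      fix y assume "y \<in> f ` X"
      then obtain z where z: "z \<in> X" "y = f z" by blast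
      then consider "z \<in> K" | i where "z \<in> (f ^^ i) ` S" by (auto simp: X_def)
      then show "y \<in> X"
      proof cases
        case 2
        then have "y \<in> (f ^^ Suc i) ` S" using z(2) by (auto simp: image_comp)
        then show ?thesis unfolding X_def by blast
      qed (use z(2) f_K in \<open>auto simp: X_def\<close>)
    qed
    then have "f ` X \<subseteq> closure X" using closure_subset by blast
    then have "f ` closure X \<subseteq> closure X"
      using clX gmD(11) by (intro image_closure_subset[OF continuous_on_subset[OF f_cont]]) auto
    moreover have "compact (closure X)"
      using compact_imp_bounded[OF cIK] XIK bounded_subset compact_closure by blast
    ultimately have "closure X \<subseteq> K" using gmD(12) clX by blast
    moreover have "S \<subseteq> X"
    proof
      fix z assume "z \<in> S"
      then have "z \<in> (f ^^ 0) ` S" by simp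
      then show "z \<in> X" unfolding X_def by blast
    qed
    ultimately have "S \<subseteq> K" using closure_subset[of X] by blast
    then have "open_segment a b' \<subseteq> K" by (auto simp: S_def open_segment_def)
    then have "open_segment a b' = {}" using b'(3) by blast
    then show False using b'(2) by simp
  qed
  then show thesis by (intro that[of ES]) (auto simp: ES_def)
qed

text \<open>Constancy on an interval would produce infinitely many critical points.\<close>

lemma image_nondegenerate:
  assumes "u < v" "{u..v} \<subseteq> nbhd K r"
  shows "\<exists>y\<in>{u..v}. f y \<noteq> f u"
proof (rule ccontr)
  assume "\<not> ?thesis"
  then have const: "f y = f u" if "y \<in> {u..v}" for y using that by blast
  have "{u<..<v} \<subseteq> crit"
  proof
    fix y assume y: "y \<in> {u<..<v}"
    have "((\<lambda>_. f u) has_real_derivative 0) (at y)" by simp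
    then have "(f has_real_derivative 0) (at y)"
      by (rule has_field_derivative_transform_within_open[OF _ open_greaterThanLessThan y]) (rule const[symmetric], simp)
    then have "deriv f y = 0" by (rule DERIV_imp_deriv)
    then show "y \<in> crit" using y assms(2) by (intro critI) auto
  qed
  then show False using finite_crit finite_subset assms(1) infinite_Ioo by blast
qed

lemma iter_interval_nondegenerate:
  assumes "u < v" "\<And>l. l < i \<Longrightarrow> (f ^^ l) ` {u..v} \<subseteq> nbhd K r"
  shows "\<exists>c d. c < d \<and> (f ^^ i) ` {u..v} = {c..d}"
  using assms(2)
proof (induction i)
  case (Suc i)
  then obtain c d where cd: "c < d" "(f ^^ i) ` {u..v} = {c..d}" by auto
  have N: "{c..d} \<subseteq> nbhd K r" using Suc.prems[of i] cd(2) by simp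
  then obtain y where y: "y \<in> {c..d}" "f y \<noteq> f c" using image_nondegenerate[OF cd(1)] by blast
  have "\<exists>c' d'. c' \<le> d' \<and> f ` {c..d} = {c'..d'}"
    using continuous_image_closed_interval[of c d f] cd(1) continuous_on_subset[OF f_cont] N nbhd_D by fastforce
  then obtain c' d' where c': "c' \<le> d'" "f ` {c..d} = {c'..d'}" by blast
  have "f y \<in> {c'..d'}" "f c \<in> {c'..d'}" using c'(2) y(1) cd(1) by auto
  then have "c' < d'" using y(2) by force
  then show ?case using c'(2) cd(2) by (metis image_funpow_Suc)
qed (use assms in auto)

lemma orbit_nbhd_near:
  assumes "a \<in> K"
  obtains d where "0 < d" "\<And>l y. l \<le> i \<Longrightarrow> \<bar>y - a\<bar> < d \<Longrightarrow> (f ^^ l) y \<in> nbhd K r"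
proof -
  have "\<exists>d>0. \<forall>y. \<bar>y - a\<bar> < d \<longrightarrow> (f ^^ l) y \<in> nbhd K r" for l
  proof -
    have "(f ^^ l) a \<in> nbhd K r" using iter_K[OF assms] K_nbhd by blast
    then obtain e where e: "0 < e" "ball ((f ^^ l) a) e \<subseteq> nbhd K r" using open_nbhd open_contains_ball by blast
    obtain d where "0 < d" "\<And>y. dist y a < d \<Longrightarrow> dist ((f ^^ l) y) ((f ^^ l) a) < e"
      using isCont_iter[OF assms, of l] e(1) unfolding continuous_at_eps_delta by blast
    then show ?thesis using e(2) by (intro exI[of _ d]) (force simp: dist_real_def)
  qed
  then obtain d where d: "\<And>l. 0 < d l \<and> (\<forall>y. \<bar>y - a\<bar> < d l \<longrightarrow> (f ^^ l) y \<in> nbhd K r)" by metis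
  define d' where "d' = Min (d ` {..i})"
  have "0 < d'" unfolding d'_def using d by (subst Min_gr_iff) auto
  moreover have "d' \<le> d l" if "l \<le> i" for l unfolding d'_def using that by (intro Min_le) auto
  ultimately show thesis using that[of d'] d by (meson less_le_trans)
qed

text \<open>If no image of the gap next to \<open>a\<close> contains a point of \<open>K\<close> in
  its interior, every iterate of \<open>a\<close> is again the end of a gap. Then the orbit of
  \<open>a\<close> meets the finite set of \<open>gap_end_hits_boundary\<close> infinitely often and
  so repeats a value.\<close>

lemma gap_germ_dichotomy:
  assumes a: "a \<in> K" and b: "b \<noteq> a" "open_segment a b \<inter> K = {}"
  shows "(\<exists>i j. i < j \<and> (f ^^ i) a = (f ^^ j) a) \<or>
    (\<exists>i k \<delta>. k \<in> K \<and> 0 < \<delta> \<and> covers i (closed_segment a b) {k - \<delta>..k + \<delta>})"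
proof (rule disjCI)
  assume no: "\<not> (\<exists>i k \<delta>. k \<in> K \<and> 0 < \<delta> \<and> covers i (closed_segment a b) {k - \<delta>..k + \<delta>})"
  obtain ES where ES: "finite ES"
    "\<forall>a b. a \<in> K \<longrightarrow> b \<noteq> a \<longrightarrow> open_segment a b \<inter> K = {} \<longrightarrow> (\<exists>i. (f ^^ i) a \<in> ES)"
    by (rule gap_end_hits_boundary)
  have "\<exists>i'\<ge>i. (f ^^ i') a \<in> ES" for i
  proof -
    obtain d where d: "0 < d" "\<And>l y. l \<le> i \<Longrightarrow> \<bar>y - a\<bar> < d \<Longrightarrow> (f ^^ l) y \<in> nbhd K r"
      using orbit_nbhd_near[OF a] by blast
    \<comment> \<open>A piece of the gap so short that its images up to time \<open>i\<close> stay
      near \<open>K\<close>.\<close>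
    define t where "t = min (d / 2) \<bar>b - a\<bar>"
    have t: "0 < t" "t < d" "t \<le> \<bar>b - a\<bar>" using d(1) b(1) by (auto simp: t_def min_def)
    define u v where "u = (if a < b then a else a - t)" and "v = (if a < b then a + t else a)"
    have uv: "u < v" "{u..v} \<subseteq> closed_segment a b" "a = u \<or> a = v"
      using t b(1) by (auto simp: u_def v_def closed_segment_eq_real_ivl)
    have N: "(f ^^ l) ` {u..v} \<subseteq> nbhd K r" if "l \<le> i" for l
      using d(2)[OF that] t by (auto simp: u_def v_def split: if_splits)
    obtain c e where ce: "c < e" "(f ^^ i) ` {u..v} = {c..e}"
      using iter_interval_nondegenerate[OF uv(1), of i] N by auto
    define p where "p = (f ^^ i) a"
    have pK: "p \<in> K" using iter_K[OF a] by (simp add: p_def)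
    have inner: "k \<notin> K" if k: "c < k" "k < e" for k
    proof
      assume kK: "k \<in> K"
      define \<delta> where "\<delta> = min (k - c) (e - k)"
      have "0 < \<delta>" "{k - \<delta>..k + \<delta>} \<subseteq> {c..e}" using k by (auto simp: \<delta>_def)
      then have "covers i (closed_segment a b) {k - \<delta>..k + \<delta>}"
        using uv N ce(2) by (intro coversI[of u v]) auto
      then show False using no kK \<open>0 < \<delta>\<close> by blast
    qed
    have "p \<in> {c..e}" using ce(2) uv by (auto simp: p_def)
    then have "p = c \<or> p = e" using inner pK by force
    then have "\<exists>q. q \<noteq> p \<and> open_segment p q \<inter> K = {}"
    proof
      assume "p = c"
      then show ?thesis using ce(1) inner by (intro exI[of _ e]) (auto simp: open_segment_eq_real_ivl)
    next
      assume "p = e"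
      then show ?thesis using ce(1) inner by (intro exI[of _ c]) (auto simp: open_segment_eq_real_ivl)
    qed
    then obtain i' where "(f ^^ i') p \<in> ES" using ES(2) pK by blast
    then show ?thesis by (intro exI[of _ "i' + i"]) (simp add: p_def funpow_add_apply)
  qed
  then have "infinite {i. (f ^^ i) a \<in> ES}" unfolding infinite_nat_iff_unbounded_le by auto
  moreover have "(\<lambda>i. (f ^^ i) a) ` {i. (f ^^ i) a \<in> ES} \<subseteq> ES" by auto
  ultimately have "\<not> inj_on (\<lambda>i. (f ^^ i) a) {i. (f ^^ i) a \<in> ES}"
    using ES(1) finite_subset finite_imageD by blast
  then obtain i j where "i \<noteq> j" "(f ^^ i) a = (f ^^ j) a" unfolding inj_on_def by blast
  then show "\<exists>i j. i < j \<and> (f ^^ i) a = (f ^^ j) a" by (metis linorder_neqE_nat)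
qed

section \<open>Enlargement along repelling periodic orbits\<close>

lemma covers_segmentI:
  assumes "\<And>l. l < n \<Longrightarrow> (f ^^ l) ` closed_segment p e \<subseteq> nbhd K r"
    and "closed_segment c d \<subseteq> (f ^^ n) ` closed_segment p e"
  shows "covers n (closed_segment p e) (closed_segment c d)"
proof -
  have eq: "closed_segment x y = {min x y..max x y}" for x y :: real
    by (auto simp: closed_segment_eq_real_ivl)
  show ?thesis unfolding eq by (rule coversI[of "min p e" "max p e"]) (use assms in \<open>auto simp: eq\<close>)
qed

text \<open>Each turn pushes points away from \<open>p\<close> by a factor of at least
  \<open>\<mu>\<close>, chosen between 1 and the multiplier. The multiplier is positive, not just
  large in modulus, so that the segment keeps its side of \<open>p\<close>. Prescribing the factor
  \<open>\<tau>\<close> lets the growth stop exactly at size \<open>R\<close>.\<close>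

lemma repelling_expansion:
  assumes p: "p \<in> K" "0 < t" "(f ^^ t) p = p" and rep: "1 < dn f t p"
  obtains R \<mu> where "0 < R" "R \<le> 1" "1 < \<mu>"
    "\<forall>e \<tau> n. 0 < \<bar>e - p\<bar> \<longrightarrow> \<bar>e - p\<bar> \<le> R \<longrightarrow> 0 < \<tau> \<longrightarrow> \<tau> \<le> \<mu> ^ n \<longrightarrow> \<tau> * \<bar>e - p\<bar> \<le> R \<longrightarrow>
      covers (t * n) (closed_segment p e) (closed_segment p (p + \<tau> * (e - p)))"
proof -
  define \<mu> where "\<mu> = (1 + dn f t p) / 2"
  have \<mu>: "1 < \<mu>" "\<mu> < dn f t p" using rep by (auto simp: \<mu>_def)
  have "((\<lambda>y. ((f ^^ t) y - (f ^^ t) p) / (y - p)) \<longlongrightarrow> dn f t p) (at p)"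
    using iter_deriv[of t p] iter_K_D[OF p(1)] by (simp add: has_field_derivative_iff)
  then have "\<forall>\<^sub>F y in at p. \<mu> < ((f ^^ t) y - (f ^^ t) p) / (y - p)"
    using order_tendstoD(1) \<mu>(2) by blast
  then obtain d1 where d1: "0 < d1" "\<And>y. y \<noteq> p \<Longrightarrow> \<bar>y - p\<bar> < d1 \<Longrightarrow> \<mu> < ((f ^^ t) y - p) / (y - p)"
    unfolding eventually_at p(3) by (auto simp: dist_real_def)
  obtain d2 where d2: "0 < d2" "\<And>l y. l \<le> t \<Longrightarrow> \<bar>y - p\<bar> < d2 \<Longrightarrow> (f ^^ l) y \<in> nbhd K r"
    using orbit_nbhd_near[OF p(1)] by blast
  define R where "R = min 1 (min (d1 / 2) (d2 / 2))"
  have R: "0 < R" "R \<le> 1" "R < d1" "R < d2" using d1(1) d2(1) by (auto simp: R_def min_def)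
  have one: "covers t (closed_segment p e) (closed_segment p (p + \<mu> * (e - p)))"
    if e: "0 < \<bar>e - p\<bar>" "\<bar>e - p\<bar> \<le> R" for e
  proof (rule covers_segmentI)
    have sm: "\<bar>y - p\<bar> \<le> R" if "y \<in> closed_segment p e" for y
      using that e(2) by (auto simp: closed_segment_eq_real_ivl split: if_splits)
    then show N: "(f ^^ l) ` closed_segment p e \<subseteq> nbhd K r" if "l < t" for l
      using d2(2)[of l] that R(4) by force
    have "connected ((f ^^ t) ` closed_segment p e)"
      by (rule connected_continuous_image[OF iter_cont]) (use N nbhd_D in blast, simp)
    moreover have "p \<in> (f ^^ t) ` closed_segment p e" using p(3) by (metis ends_in_segment(1) imageI)
    moreover have "(f ^^ t) e \<in> (f ^^ t) ` closed_segment p e" by simp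
    ultimately have sub: "closed_segment p ((f ^^ t) e) \<subseteq> (f ^^ t) ` closed_segment p e"
      by (rule connected_segment)
    define s where "s = ((f ^^ t) e - p) / (e - p)"
    have s: "\<mu> < s" unfolding s_def using d1(2)[of e] e R(3) by auto
    have "(f ^^ t) e = p + s * (e - p)" using e(1) by (simp add: s_def)
    moreover have "p + \<mu> * (e - p) \<in> closed_segment p (p + s * (e - p))"
    proof -
      have "p + \<mu> * (e - p) = (1 - \<mu> / s) *\<^sub>R p + (\<mu> / s) *\<^sub>R (p + s * (e - p))"
        using s \<mu>(1) by (simp add: algebra_simps)
      then show ?thesis using s \<mu>(1) unfolding closed_segment_def
        by (intro CollectI exI[of _ "\<mu> / s"]) auto
    qed
    ultimately have "closed_segment p (p + \<mu> * (e - p)) \<subseteq> closed_segment p ((f ^^ t) e)"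
      by (simp add: subset_closed_segment)
    then show "closed_segment p (p + \<mu> * (e - p)) \<subseteq> (f ^^ t) ` closed_segment p e" using sub by blast
  qed
  have "covers (t * n) (closed_segment p e) (closed_segment p (p + \<tau> * (e - p)))"
    if e: "0 < \<bar>e - p\<bar>" "\<bar>e - p\<bar> \<le> R" and "0 < \<tau>" "\<tau> \<le> \<mu> ^ n" "\<tau> * \<bar>e - p\<bar> \<le> R" for e \<tau> n
    using that(3-)
  proof (induction n arbitrary: \<tau>)
    case 0
    have "p + \<tau> * (e - p) = (1 - \<tau>) *\<^sub>R p + \<tau> *\<^sub>R e" by (simp add: algebra_simps)
    then have "p + \<tau> * (e - p) \<in> closed_segment p e" unfolding closed_segment_def using 0 by auto
    then have "closed_segment p (p + \<tau> * (e - p)) \<subseteq> closed_segment p e" by (simp add: subset_closed_segment)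
    then show ?case using covers_segmentI[of 0 p e p "p + \<tau> * (e - p)"] by (simp add: id_def)
  next
    case (Suc n)
    \<comment> \<open>Reach the factor \<open>\<tau> / \<mu>\<close> in \<open>n\<close> turns; one
      more turn then covers the segment longer by exactly \<open>\<mu>\<close>.\<close>
    define \<tau>' where "\<tau>' = \<tau> / \<mu>"
    have \<tau>': "0 < \<tau>'" "\<tau>' \<le> \<mu> ^ n" "\<tau>' * \<bar>e - p\<bar> \<le> R" "\<mu> * \<tau>' = \<tau>"
    proof -
      show "0 < \<tau>'" "\<mu> * \<tau>' = \<tau>" using Suc.prems \<mu> by (auto simp: \<tau>'_def)
      show "\<tau>' \<le> \<mu> ^ n" using Suc.prems(2) \<mu> by (simp add: \<tau>'_def pos_divide_le_eq mult.commute)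
      have "\<tau>' \<le> \<tau>" using Suc.prems(1) \<mu> by (simp add: \<tau>'_def pos_divide_le_eq)
      then have "\<tau>' * \<bar>e - p\<bar> \<le> \<tau> * \<bar>e - p\<bar>" by (intro mult_right_mono) auto
      then show "\<tau>' * \<bar>e - p\<bar> \<le> R" using Suc.prems(3) by linarith
    qed
    define e' where "e' = p + \<tau>' * (e - p)"
    have e': "0 < \<bar>e' - p\<bar>" "\<bar>e' - p\<bar> \<le> R" "\<mu> * (e' - p) = \<tau> * (e - p)"
      using \<tau>' e by (auto simp: e'_def abs_mult mult.assoc[symmetric])
    have "covers (t + t * n) (closed_segment p e) (closed_segment p (p + \<mu> * (e' - p)))"
      using covers_trans[OF Suc.IH[OF \<tau>'(1-3)] one[of e', unfolded e'_def]] e' by (simp add: e'_def)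
    then show ?case unfolding e'(3) by simp
  qed
  then show thesis using that[OF R(1,2) \<mu>(1)] by blast
qed

text \<open>The image under \<open>f ^^ j\<close> contains a segment from the periodic point to
  beyond a point of \<open>K\<close>, of length at least \<open>min s R\<close>. A number of turns
  of order \<open>1 + ln (1 / s)\<close> enlarges it to length \<open>R\<close>, where it contains a
  fixed neighbourhood of a point of \<open>K\<close> on that side.\<close>

lemma preperiodic_expansion:
  assumes a: "a \<in> K" and t: "0 < t" and per: "(f ^^ t) ((f ^^ j) a) = (f ^^ j) a"
    and rep: "1 < \<bar>dn f t ((f ^^ j) a)\<bar>"
  obtains \<delta>\<^sub>a \<delta>' C where "0 < \<delta>\<^sub>a" "0 < \<delta>'" "0 \<le> C"
    "\<forall>y s\<^sub>1 s\<^sub>2 s. y \<in> K \<longrightarrow> \<bar>y - a\<bar> < \<delta>\<^sub>a \<longrightarrow> (f ^^ j) y \<noteq> (f ^^ j) a \<longrightarrow> a \<in> {s\<^sub>1..s\<^sub>2} \<longrightarrow>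
      {s\<^sub>1..s\<^sub>2} \<subseteq> ball a \<delta>\<^sub>a \<longrightarrow> 0 < s \<longrightarrow> s \<le> 1 \<longrightarrow>
      {(f ^^ j) y - s..(f ^^ j) y + s} \<subseteq> (f ^^ j) ` {s\<^sub>1..s\<^sub>2} \<longrightarrow>
      (\<exists>n \<kappa>. real n \<le> C * (1 + ln (1 / s)) \<and> \<kappa> \<in> K \<and> covers n {s\<^sub>1..s\<^sub>2} {\<kappa> - \<delta>'..\<kappa> + \<delta>'})"
proof -
  define p where "p = (f ^^ j) a"
  have pK: "p \<in> K" using iter_K[OF a] by (simp add: p_def)
  \<comment> \<open>Two turns make the multiplier positive.\<close>
  define T where "T = t * 2"
  have T: "0 < T" "(f ^^ T) p = p" using t funpow_period[OF per, of 2] by (auto simp: T_def p_def)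
  have "dn f T p = dn f t p ^ 2" unfolding T_def p_def by (rule dn_period[OF per])
  moreover have "1 < \<bar>dn f t p\<bar> ^ 2" using rep by (intro one_less_power) (auto simp: p_def)
  ultimately have "1 < dn f T p" by simp
  from repelling_expansion[OF pK T this] obtain R \<mu> where R: "0 < R" "R \<le> 1" and \<mu>: "1 < \<mu>" and
    cov: "\<forall>e \<tau> n. 0 < \<bar>e - p\<bar> \<longrightarrow> \<bar>e - p\<bar> \<le> R \<longrightarrow> 0 < \<tau> \<longrightarrow> \<tau> \<le> \<mu> ^ n \<longrightarrow> \<tau> * \<bar>e - p\<bar> \<le> R \<longrightarrow>
      covers (T * n) (closed_segment p e) (closed_segment p (p + \<tau> * (e - p)))" .
  \<comment> \<open>One target in \<open>K\<close> is fixed on each side of the periodic point. On a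
    side without points of \<open>K\<close> closer than \<open>R\<close> the claim is
    vacuous.\<close>
  have side: "\<exists>\<delta>>0. \<forall>e\<in>K. sgn (e - p) = \<sigma> \<longrightarrow> \<bar>e - p\<bar> < R \<longrightarrow>
      (\<exists>\<kappa>\<in>K. {\<kappa> - \<delta>..\<kappa> + \<delta>} \<subseteq> closed_segment p (p + \<sigma> * R))" if \<sigma>: "\<bar>\<sigma>\<bar> = 1" for \<sigma>
  proof (cases "\<exists>\<kappa>\<in>K. sgn (\<kappa> - p) = \<sigma> \<and> \<bar>\<kappa> - p\<bar> < R")
    case True
    then obtain \<kappa> where \<kappa>: "\<kappa> \<in> K" "sgn (\<kappa> - p) = \<sigma>" "\<bar>\<kappa> - p\<bar> < R" by blast
    define \<delta> where "\<delta> = min \<bar>\<kappa> - p\<bar> (R - \<bar>\<kappa> - p\<bar>)"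
    have "0 < \<delta>" using \<kappa> \<sigma> by (auto simp: \<delta>_def sgn_if split: if_splits)
    moreover have "{\<kappa> - \<delta>..\<kappa> + \<delta>} \<subseteq> closed_segment p (p + \<sigma> * R)"
      using \<kappa>(2,3) R(1) \<sigma> by (auto simp: \<delta>_def sgn_if closed_segment_eq_real_ivl split: if_splits)
    ultimately show ?thesis using \<kappa>(1) by blast
  qed (auto intro: exI[of _ 1])
  obtain \<delta>1 where \<delta>1: "0 < \<delta>1" "\<forall>e\<in>K. sgn (e - p) = 1 \<longrightarrow> \<bar>e - p\<bar> < R \<longrightarrow>
      (\<exists>\<kappa>\<in>K. {\<kappa> - \<delta>1..\<kappa> + \<delta>1} \<subseteq> closed_segment p (p + 1 * R))" using side[of 1] by auto
  obtain \<delta>2 where \<delta>2: "0 < \<delta>2" "\<forall>e\<in>K. sgn (e - p) = -1 \<longrightarrow> \<bar>e - p\<bar> < R \<longrightarrow>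
      (\<exists>\<kappa>\<in>K. {\<kappa> - \<delta>2..\<kappa> + \<delta>2} \<subseteq> closed_segment p (p + (-1) * R))" using side[of "-1"] by auto
  define \<delta>' where "\<delta>' = min \<delta>1 \<delta>2"
  have \<delta>': "0 < \<delta>'" using \<delta>1 \<delta>2 by (simp add: \<delta>'_def)
  have target: "\<exists>\<kappa>\<in>K. {\<kappa> - \<delta>'..\<kappa> + \<delta>'} \<subseteq> closed_segment p (p + sgn (e - p) * R)"
    if e: "e \<in> K" "e \<noteq> p" "\<bar>e - p\<bar> < R" for e
  proof (cases "p < e")
    case True
    then have "sgn (e - p) = 1" by simp
    then obtain \<kappa> where "\<kappa> \<in> K" "{\<kappa> - \<delta>1..\<kappa> + \<delta>1} \<subseteq> closed_segment p (p + sgn (e - p) * R)"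
      using \<delta>1(2) e by auto
    moreover have "{\<kappa> - \<delta>'..\<kappa> + \<delta>'} \<subseteq> {\<kappa> - \<delta>1..\<kappa> + \<delta>1}" by (auto simp: \<delta>'_def)
    ultimately show ?thesis by blast
  next
    case False
    then have "sgn (e - p) = -1" using e(2) by auto
    then obtain \<kappa> where "\<kappa> \<in> K" "{\<kappa> - \<delta>2..\<kappa> + \<delta>2} \<subseteq> closed_segment p (p + sgn (e - p) * R)"
      using \<delta>2(2) e by auto
    moreover have "{\<kappa> - \<delta>'..\<kappa> + \<delta>'} \<subseteq> {\<kappa> - \<delta>2..\<kappa> + \<delta>2}" by (auto simp: \<delta>'_def)
    ultimately show ?thesis by blast
  qed
  obtain d1 where d1: "0 < d1" "\<And>l y. l \<le> j \<Longrightarrow> \<bar>y - a\<bar> < d1 \<Longrightarrow> (f ^^ l) y \<in> nbhd K r"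
    using orbit_nbhd_near[OF a] by blast
  obtain d2 where d2: "0 < d2" "\<And>y. \<bar>y - a\<bar> < d2 \<Longrightarrow> \<bar>(f ^^ j) y - p\<bar> < R"
    using isCont_iter[OF a, of j] R(1) unfolding continuous_at_eps_delta p_def dist_real_def by blast
  define C where "C = real T / ln \<mu> + real T + real j"
  have C0: "0 \<le> C" "0 \<le> real T / ln \<mu>" using \<mu> by (auto simp: C_def)
  show thesis
  proof (rule that[of "min d1 d2" \<delta>' C], goal_cases)
    case 4
    show ?case
    proof (intro allI impI)
      fix y s\<^sub>1 s\<^sub>2 s assume y: "y \<in> K" "\<bar>y - a\<bar> < min d1 d2" "(f ^^ j) y \<noteq> (f ^^ j) a"
        and S: "a \<in> {s\<^sub>1..s\<^sub>2}" "{s\<^sub>1..s\<^sub>2} \<subseteq> ball a (min d1 d2)" and s: "0 < s" "s \<le> 1"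
        and sub: "{(f ^^ j) y - s..(f ^^ j) y + s} \<subseteq> (f ^^ j) ` {s\<^sub>1..s\<^sub>2}"
      define e where "e = (f ^^ j) y"
      have e: "e \<in> K" "e \<noteq> p" "\<bar>e - p\<bar> < R" using iter_K y d2(2) by (auto simp: e_def p_def)
      define \<sigma> where "\<sigma> = sgn (e - p)"
      have \<sigma>: "\<bar>\<sigma>\<bar> = 1" "e - p = \<sigma> * \<bar>e - p\<bar>" using e(2) by (auto simp: \<sigma>_def sgn_if)
      \<comment> \<open>The length of the segment from \<open>p\<close> known to lie in the image,
        cut at \<open>R\<close>.\<close>
      define m where "m = min (\<bar>e - p\<bar> + s) R"
      have m: "min s R \<le> m" "m \<le> R" "0 < m" "m \<le> \<bar>e - p\<bar> + s" using s R e by (auto simp: m_def)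
      define e'' where "e'' = p + \<sigma> * m"
      have e'': "\<bar>e'' - p\<bar> = m" using \<sigma> m by (simp add: e''_def abs_mult)
      have N: "(f ^^ l) ` {s\<^sub>1..s\<^sub>2} \<subseteq> nbhd K r" if "l \<le> j" for l
        using d1(2)[OF that] S(2) by (auto simp: dist_real_def abs_minus_commute subset_iff)
      have conn: "connected ((f ^^ j) ` {s\<^sub>1..s\<^sub>2})"
        by (rule connected_continuous_image[OF iter_cont]) (use N nbhd_D less_imp_le in blast, simp)
      have "p \<in> (f ^^ j) ` {s\<^sub>1..s\<^sub>2}" using S(1) by (auto simp: p_def)
      moreover have "e + \<sigma> * s \<in> (f ^^ j) ` {s\<^sub>1..s\<^sub>2}"
        using sub s(1) \<sigma>(1) unfolding e_def[symmetric] by (intro subsetD[OF sub]) (auto simp: e_def abs_if split: if_splits)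
      moreover have "closed_segment p e'' \<subseteq> closed_segment p (e + \<sigma> * s)"
      proof -
        have eq: "e + \<sigma> * s = p + \<sigma> * (\<bar>e - p\<bar> + s)" using \<sigma>(2) by (simp add: algebra_simps)
        show ?thesis unfolding eq e''_def using \<sigma>(1) m
          by (auto simp: closed_segment_eq_real_ivl abs_if split: if_splits)
      qed
      ultimately have "closed_segment p e'' \<subseteq> (f ^^ j) ` {s\<^sub>1..s\<^sub>2}"
        using connected_segment[OF conn, of p "e + \<sigma> * s"] by blast
      then have cov1: "covers j {s\<^sub>1..s\<^sub>2} (closed_segment p e'')"
      proof -
        assume A: "closed_segment p e'' \<subseteq> (f ^^ j) ` {s\<^sub>1..s\<^sub>2}"
        have eq: "closed_segment p e'' = {min p e''..max p e''}" by (auto simp: closed_segment_eq_real_ivl)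
        show ?thesis unfolding eq
          by (rule coversI[of s\<^sub>1 s\<^sub>2]) (use S N A eq in auto)
      qed
      \<comment> \<open>The least number of turns with \<open>\<mu> ^ n \<ge> R / m\<close>.\<close>
      define n where "n = nat \<lceil>ln (R / m) / ln \<mu>\<rceil>"
      have lnRm: "0 \<le> ln (R / m)" "ln (R / m) \<le> ln (1 / s)"
      proof -
        show "0 \<le> ln (R / m)" using m by simp
        have "R / m \<le> 1 / s"
        proof (cases "s \<le> R")
          case True
          then have "R * s \<le> 1 * m" using m(1) R s by (intro mult_mono) auto
          then show ?thesis using m(3) s by (simp add: field_simps)
        next
          case False
          then have "R / m = 1" using m by auto
          then show ?thesis using s by simp
        qed
        then show "ln (R / m) \<le> ln (1 / s)" using m R by (intro ln_mono) auto
      qed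
      have n1: "ln (R / m) / ln \<mu> \<le> real n" unfolding n_def by linarith
      have n2: "real n \<le> ln (R / m) / ln \<mu> + 1"
        unfolding n_def using lnRm(1) \<mu> by simp
      have "R / m \<le> \<mu> ^ n"
      proof -
        have "ln (R / m) \<le> real n * ln \<mu>" using n1 \<mu> by (simp add: pos_divide_le_eq)
        also have "\<dots> = ln (\<mu> ^ n)" using \<mu> by (simp add: ln_realpow)
        finally show ?thesis using \<mu> m R by (subst (asm) ln_le_cancel_iff) auto
      qed
      then have "covers (T * n) (closed_segment p e'') (closed_segment p (p + R / m * (e'' - p)))"
        using e'' m R by (intro cov[rule_format]) auto
      moreover have "R / m * (e'' - p) = \<sigma> * R" using m(3) by (simp add: e''_def)
      ultimately have "covers (T * n) (closed_segment p e'') (closed_segment p (p + \<sigma> * R))" by simp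
      then have cov2: "covers (T * n + j) {s\<^sub>1..s\<^sub>2} (closed_segment p (p + \<sigma> * R))"
        by (rule covers_trans[OF cov1])
      obtain \<kappa> where \<kappa>: "\<kappa> \<in> K" "{\<kappa> - \<delta>'..\<kappa> + \<delta>'} \<subseteq> closed_segment p (p + \<sigma> * R)"
        using target[OF e] unfolding \<sigma>_def by blast
      have "covers (T * n + j) {s\<^sub>1..s\<^sub>2} {\<kappa> - \<delta>'..\<kappa> + \<delta>'}"
        using covers_subset[OF cov2 \<kappa>(2)] \<delta>' by simp
      moreover have "real (T * n + j) \<le> C * (1 + ln (1 / s))"
      proof -
        have l0: "0 \<le> ln (1 / s)" using lnRm by linarith
        have "real n \<le> ln (1 / s) / ln \<mu> + 1"
          using n2 lnRm(2) \<mu> divide_right_mono[of "ln (R / m)" "ln (1 / s)" "ln \<mu>"] by simp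
        then have "real T * real n \<le> real T * (ln (1 / s) / ln \<mu> + 1)" by (intro mult_left_mono) auto
        then have "real (T * n + j) \<le> (real T / ln \<mu>) * ln (1 / s) + real T + real j" by (simp add: algebra_simps)
        also have "\<dots> \<le> C * ln (1 / s) + C"
        proof -
          have "(real T / ln \<mu>) * ln (1 / s) \<le> C * ln (1 / s)"
            using l0 by (intro mult_right_mono) (auto simp: C_def)
          moreover have "real T + real j \<le> C" using C0(2) by (simp add: C_def)
          ultimately show ?thesis by linarith
        qed
        finally show ?thesis by (simp add: algebra_simps)
      qed
      ultimately show "\<exists>n \<kappa>. real n \<le> C * (1 + ln (1 / s)) \<and> \<kappa> \<in> K \<and> covers n {s\<^sub>1..s\<^sub>2} {\<kappa> - \<delta>'..\<kappa> + \<delta>'}"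
        using \<kappa>(1) by blast
    qed
  qed (use d1 d2 \<delta>' C0 in auto)
qed


section \<open>Orbits with an exponent\<close>

lemma deriv_funpow: "x \<in> K \<Longrightarrow> deriv (f ^^ n) x = dn f n x"
  by (rule DERIV_imp_deriv[OF iter_deriv]) (rule iter_K_D)

text \<open>The limit in finite-time form, with one constant for all \<open>n\<close>. Both bounds
  matter: the upper one keeps images short, the lower one bounds f' along the orbit and the size of
  images from below.\<close>

definition lyapunov :: "real \<Rightarrow> real \<Rightarrow> bool" where
  "lyapunov x \<Lambda> \<longleftrightarrow> (\<forall>\<epsilon>>0. \<exists>C. \<forall>n. exp ((\<Lambda> - \<epsilon>) * real n - C) \<le> \<bar>dn f n x\<bar> \<and>
     \<bar>dn f n x\<bar> \<le> exp ((\<Lambda> + \<epsilon>) * real n + C))"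

lemma lyapunovD:
  assumes "lyapunov x \<Lambda>" "0 < \<epsilon>"
  obtains C where "0 \<le> C" "\<forall>n. exp ((\<Lambda> - \<epsilon>) * real n - C) \<le> \<bar>dn f n x\<bar>"
    "\<forall>n. \<bar>dn f n x\<bar> \<le> exp ((\<Lambda> + \<epsilon>) * real n + C)"
proof -
  obtain C where C: "\<forall>n. exp ((\<Lambda> - \<epsilon>) * real n - C) \<le> \<bar>dn f n x\<bar> \<and> \<bar>dn f n x\<bar> \<le> exp ((\<Lambda> + \<epsilon>) * real n + C)"
    using assms unfolding lyapunov_def by blast
  then have "0 \<le> C" using C[rule_format, of 0] by simp
  then show thesis using that C by blast
qed

lemma lyapunov_nonzero: "lyapunov x \<Lambda> \<Longrightarrow> dn f n x \<noteq> 0"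
  using lyapunovD[of x \<Lambda> 1] by (metis abs_zero exp_gt_zero linorder_not_less zero_less_one)

text \<open>A zero derivative would make the quotients eventually minus infinity, so a finite limit
  excludes it. The constant absorbs the finitely many times before the quotient is
  \<open>\<epsilon>\<close>-close to its limit.\<close>

lemma lyapunovI:
  assumes x: "x \<in> K" and ex: "has_exponent_at f x (ereal \<Lambda>)"
  shows "lyapunov x \<Lambda>"
proof -
  have lim: "(\<lambda>n. eln \<bar>dn f n x\<bar> / ereal (real n)) \<longlonglongrightarrow> ereal \<Lambda>"
    using ex deriv_funpow[OF x] by (simp add: has_exponent_at_def)
  have nz: "dn f n x \<noteq> 0" for n
  proof
    assume 0: "dn f n x = 0"
    have zero: "dn f (m + n) x = 0" for m using 0 by (simp add: dn_add)
    have "eln \<bar>dn f m x\<bar> / ereal (real m) = - \<infinity>" if "m \<ge> Suc n" for m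
    proof -
      have "m - n + n = m" using that by simp
      then have "dn f m x = 0" using zero[of "m - n"] by simp
      then show ?thesis using that by (simp add: eln_def divide_ereal_def)
    qed
    then have "\<forall>\<^sub>F m in sequentially. eln \<bar>dn f m x\<bar> / ereal (real m) = - \<infinity>"
      unfolding eventually_sequentially by blast
    then have "(\<lambda>m. eln \<bar>dn f m x\<bar> / ereal (real m)) \<longlonglongrightarrow> - \<infinity>" by (rule tendsto_eventually)
    from LIMSEQ_unique[OF lim this] show False by simp
  qed
  have "(\<lambda>n. ereal (ln \<bar>dn f n x\<bar> / real n)) \<longlonglongrightarrow> ereal \<Lambda>"
  proof (rule Lim_transform_eventually[OF lim])
    show "\<forall>\<^sub>F n in sequentially. eln \<bar>dn f n x\<bar> / ereal (real n) = ereal (ln \<bar>dn f n x\<bar> / real n)"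
      using eventually_gt_at_top[of 0] by eventually_elim (simp add: eln_def nz)
  qed
  then have lim': "(\<lambda>n. ln \<bar>dn f n x\<bar> / real n) \<longlonglongrightarrow> \<Lambda>" by simp
  have "\<exists>C. \<forall>n. \<bar>ln \<bar>dn f n x\<bar> - \<Lambda> * real n\<bar> \<le> \<epsilon> * real n + C" if \<epsilon>: "0 < \<epsilon>" for \<epsilon>
  proof -
    obtain N where N: "\<And>n. n \<ge> N \<Longrightarrow> \<bar>ln \<bar>dn f n x\<bar> / real n - \<Lambda>\<bar> < \<epsilon>"
      using LIMSEQ_D[OF lim' \<epsilon>] by auto
    define g where "g n = \<bar>ln \<bar>dn f n x\<bar> - \<Lambda> * real n\<bar>" for n
    define C where "C = Max (g ` {..N})"
    have "g n \<le> \<epsilon> * real n + C" for n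
    proof (cases "n \<le> N")
      case True
      then have "g n \<le> C" unfolding C_def by (intro Max_ge) auto
      moreover have "0 \<le> \<epsilon> * real n" using \<epsilon> by simp
      ultimately show ?thesis by linarith
    next
      case False
      then have n: "0 < real n" by simp
      have "g n = real n * \<bar>ln \<bar>dn f n x\<bar> / real n - \<Lambda>\<bar>"
      proof -
        have "ln \<bar>dn f n x\<bar> - \<Lambda> * real n = real n * (ln \<bar>dn f n x\<bar> / real n - \<Lambda>)"
          using n by (simp add: right_diff_distrib)
        then show ?thesis unfolding g_def by (simp add: abs_mult)
      qed
      also have "\<dots> \<le> real n * \<epsilon>" using N[of n] False by (intro mult_left_mono) auto
      finally have "g n \<le> \<epsilon> * real n" by (simp add: mult.commute)
      moreover have "0 \<le> C"
      proof -
        have "0 \<le> g 0" by (simp add: g_def)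
        also have "\<dots> \<le> C" unfolding C_def by (intro Max_ge) auto
        finally show ?thesis .
      qed
      ultimately show ?thesis by linarith
    qed
    then show ?thesis unfolding g_def by (intro exI allI)
  qed
  then have "\<exists>C. \<forall>n. exp ((\<Lambda> - \<epsilon>) * real n - C) \<le> \<bar>dn f n x\<bar> \<and> \<bar>dn f n x\<bar> \<le> exp ((\<Lambda> + \<epsilon>) * real n + C)"
    if \<epsilon>: "0 < \<epsilon>" for \<epsilon>
  proof -
    obtain C where C: "\<forall>n. \<bar>ln \<bar>dn f n x\<bar> - \<Lambda> * real n\<bar> \<le> \<epsilon> * real n + C"
      using \<epsilon> \<open>\<And>\<epsilon>. 0 < \<epsilon> \<Longrightarrow> \<exists>C. \<forall>n. \<bar>ln \<bar>dn f n x\<bar> - \<Lambda> * real n\<bar> \<le> \<epsilon> * real n + C\<close> by blast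
    have "(\<Lambda> - \<epsilon>) * real n - C \<le> ln \<bar>dn f n x\<bar>" "ln \<bar>dn f n x\<bar> \<le> (\<Lambda> + \<epsilon>) * real n + C" for n
      using C[rule_format, of n] unfolding distrib_right left_diff_distrib by linarith+
    then have "exp ((\<Lambda> - \<epsilon>) * real n - C) \<le> exp (ln \<bar>dn f n x\<bar>)"
      "exp (ln \<bar>dn f n x\<bar>) \<le> exp ((\<Lambda> + \<epsilon>) * real n + C)" for n by simp_all
    then show ?thesis using nz by (intro exI[of _ C]) simp
  qed
  then show ?thesis by (simp add: lyapunov_def)
qed

lemma lyapunov_shift:
  assumes ly: "lyapunov x \<Lambda>"
  shows "lyapunov ((f ^^ i) x) \<Lambda>"
  unfolding lyapunov_def
proof (intro allI impI)
  fix \<epsilon> :: real assume "0 < \<epsilon>"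
  with ly obtain C where C: "\<forall>n. exp ((\<Lambda> - \<epsilon>) * real n - C) \<le> \<bar>dn f n x\<bar>"
    "\<forall>n. \<bar>dn f n x\<bar> \<le> exp ((\<Lambda> + \<epsilon>) * real n + C)" by (rule lyapunovD)
  \<comment> \<open>The upper and lower bounds for \<open>\<bar>dn f i x\<bar>\<close> differ by
    exactly the factor \<open>exp C'\<close>.\<close>
  define C' where "C' = 2 * C + 2 * \<epsilon> * real i"
  define a where "a = \<bar>dn f i x\<bar>"
  have a: "exp ((\<Lambda> - \<epsilon>) * real i - C) \<le> a" "a \<le> exp ((\<Lambda> + \<epsilon>) * real i + C)" using C by (auto simp: a_def)
  have a0: "0 < a" using lyapunov_nonzero[OF ly] by (simp add: a_def)
  have "exp ((\<Lambda> - \<epsilon>) * real n - C') \<le> \<bar>dn f n ((f ^^ i) x)\<bar> \<and> \<bar>dn f n ((f ^^ i) x)\<bar> \<le> exp ((\<Lambda> + \<epsilon>) * real n + C')" for n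
  proof -
    define b where "b = \<bar>dn f n ((f ^^ i) x)\<bar>"
    have ab: "\<bar>dn f (n + i) x\<bar> = a * b" by (simp add: dn_add abs_mult a_def b_def)
    have "a * exp ((\<Lambda> - \<epsilon>) * real n - C') \<le> exp ((\<Lambda> + \<epsilon>) * real i + C) * exp ((\<Lambda> - \<epsilon>) * real n - C')"
      using a(2) by simp
    also have "\<dots> = exp ((\<Lambda> - \<epsilon>) * real (n + i) - C)" by (simp add: exp_add[symmetric] C'_def algebra_simps)
    also have "\<dots> \<le> a * b" using C(1)[rule_format, of "n + i"] by (simp only: ab)
    finally have 1: "exp ((\<Lambda> - \<epsilon>) * real n - C') \<le> b" using a0 by simp
    have "a * b \<le> exp ((\<Lambda> + \<epsilon>) * real (n + i) + C)" using C(2)[rule_format, of "n + i"] by (simp only: ab)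
    also have "\<dots> = exp ((\<Lambda> - \<epsilon>) * real i - C) * exp ((\<Lambda> + \<epsilon>) * real n + C')"
      by (simp add: exp_add[symmetric] C'_def algebra_simps)
    also have "\<dots> \<le> a * exp ((\<Lambda> + \<epsilon>) * real n + C')" using a(1) by simp
    finally have "b \<le> exp ((\<Lambda> + \<epsilon>) * real n + C')" using a0 by simp
    then show ?thesis using 1 by (simp add: b_def)
  qed
  then show "\<exists>C. \<forall>n. exp ((\<Lambda> - \<epsilon>) * real n - C) \<le> \<bar>dn f n ((f ^^ i) x)\<bar> \<and>
      \<bar>dn f n ((f ^^ i) x)\<bar> \<le> exp ((\<Lambda> + \<epsilon>) * real n + C)" by (intro exI allI)
qed

lemma lyapunov_not_crit:
  assumes "lyapunov x \<Lambda>"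
  shows "(f ^^ i) x \<notin> crit"
proof
  assume "(f ^^ i) x \<in> crit"
  then have "dn f (Suc i) x = 0" by (simp add: dn_Suc crit_def)
  then show False using lyapunov_nonzero[OF assms] by blast
qed

text \<open>Closeness and distortion are proved in one induction. While \<open>f ^^ l\<close> keeps
  the interval within \<open>2 * \<rho> * \<bar>dn f l x\<bar>\<close> of the orbit of
  \<open>x\<close>, the Lipschitz bound changes the \<open>l\<close>-th factor by a relative amount
  of at most \<open>\<eta> l\<close>. These sum to at most 1/2, so the derivative ratio stays in
  [1/2, 2], and a derivative bound gives the next distance.\<close>

lemma push_forward:
  assumes x: "x \<in> K" and nz: "\<And>k. dn f k x \<noteq> 0" and \<rho>: "0 < \<rho>"
    and small': "\<forall>k<n. 2 * \<rho> * \<bar>dn f k x\<bar> < r"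
    and \<eta>': "\<forall>k<n. L * (2 * \<rho> * \<bar>dn f k x\<bar>) \<le> \<eta> k * \<bar>deriv f ((f ^^ k) x)\<bar>"
    and sum: "(\<Sum>k<n. \<eta> k) \<le> 1 / 2"
  shows "k \<le> n \<Longrightarrow> z \<in> {x - \<rho>..x + \<rho>} \<Longrightarrow> 1 / 2 \<le> dn f k z / dn f k x \<and> dn f k z / dn f k x \<le> 2"
    and "k \<le> n \<Longrightarrow> z \<in> {x - \<rho>..x + \<rho>} \<Longrightarrow> \<bar>(f ^^ k) z - (f ^^ k) x\<bar> \<le> 2 * \<rho> * \<bar>dn f k x\<bar>"
    and "k \<le> n \<Longrightarrow> {(f ^^ k) x - \<rho> * \<bar>dn f k x\<bar> / 2..(f ^^ k) x + \<rho> * \<bar>dn f k x\<bar> / 2} \<subseteq> (f ^^ k) ` {x - \<rho>..x + \<rho>}"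
proof -
  note small = small'[rule_format] and \<eta> = \<eta>'[rule_format]
  define B where "B = {x - \<rho>..x + \<rho>}"
  have xB: "x \<in> B" using \<rho> by (simp add: B_def)
  have d0: "deriv f ((f ^^ k) x) \<noteq> 0" for k using nz[of "Suc k"] by (simp add: dn_Suc)
  have \<eta>0: "0 \<le> \<eta> k" if "k < n" for k
  proof -
    have "0 \<le> L * (2 * \<rho> * \<bar>dn f k x\<bar>)" using L_pos \<rho> by simp
    then have "0 \<le> \<eta> k * \<bar>deriv f ((f ^^ k) x)\<bar>" using \<eta>[OF that] by linarith
    then show ?thesis using d0[of k] by (simp add: zero_le_mult_iff)
  qed
  have expS: "exp (1 / 2) \<le> (2::real)"
  proof -
    have "exp (1 / 2 :: real) ^ 2 = exp 1" by (simp add: power2_eq_square exp_add[symmetric])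
    then show ?thesis using exp_le by - (rule power2_le_imp_le, simp_all)
  qed
  have S_le: "(\<Sum>i<k. \<eta> i) \<le> 1 / 2" if "k \<le> n" for k
  proof -
    have "(\<Sum>i<k. \<eta> i) \<le> (\<Sum>i<n. \<eta> i)" using that \<eta>0 by (intro sum_mono2) auto
    then show ?thesis using sum by linarith
  qed
  have main: "\<forall>z\<in>B. 1 - (\<Sum>i<k. \<eta> i) \<le> dn f k z / dn f k x \<and> dn f k z / dn f k x \<le> exp (\<Sum>i<k. \<eta> i) \<and>
      \<bar>(f ^^ k) z - (f ^^ k) x\<bar> \<le> 2 * \<rho> * \<bar>dn f k x\<bar>" if "k \<le> n" for k
    using that
  proof (induction k rule: less_induct)
    case (less k)
    have ratio: "1 - (\<Sum>i<k. \<eta> i) \<le> dn f k z / dn f k x \<and> dn f k z / dn f k x \<le> exp (\<Sum>i<k. \<eta> i)"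
      if z: "z \<in> B" for z
    proof (cases k)
      case (Suc l)
      define S where "S = (\<Sum>i<l. \<eta> i)"
      have l: "l < n" using less.prems Suc by simp
      define q where "q = dn f l z / dn f l x"
      have IH: "1 - S \<le> q" "q \<le> exp S" "\<bar>(f ^^ l) z - (f ^^ l) x\<bar> \<le> 2 * \<rho> * \<bar>dn f l x\<bar>"
        using less.IH[of l] l Suc z by (auto simp: q_def S_def)
      define y y' where "y = (f ^^ l) x" and "y' = (f ^^ l) z"
      have yK: "y \<in> K" using iter_K[OF x] by (simp add: y_def)
      have "\<bar>w - y\<bar> < r" if "w \<in> closed_segment y' y" for w
        using that IH(3) small[OF l] by (auto simp: y_def y'_def closed_segment_eq_real_ivl split: if_splits)
      then have "closed_segment y' y \<subseteq> nbhd K r" using ball_nbhd[OF yK] by blast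
      then have "\<bar>deriv f y' - deriv f y\<bar> \<le> L * \<bar>y' - y\<bar>" by (rule deriv_lipschitz)
      also have "\<dots> \<le> L * (2 * \<rho> * \<bar>dn f l x\<bar>)" using IH(3) L_pos by (simp add: y_def y'_def)
      also have "\<dots> \<le> \<eta> l * \<bar>deriv f y\<bar>" using \<eta>[OF l] by (simp add: y_def)
      finally have "\<bar>deriv f y' / deriv f y - 1\<bar> \<le> \<eta> l"
      proof -
        assume A: "\<bar>deriv f y' - deriv f y\<bar> \<le> \<eta> l * \<bar>deriv f y\<bar>"
        have "deriv f y' / deriv f y - 1 = (deriv f y' - deriv f y) / deriv f y"
          using d0[of l] by (simp add: y_def diff_divide_distrib)
        then show ?thesis using A d0[of l] by (simp add: y_def abs_divide pos_divide_le_eq)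
      qed
      then have e: "1 - \<eta> l \<le> deriv f y' / deriv f y" "deriv f y' / deriv f y \<le> 1 + \<eta> l" by linarith+
      have qk: "dn f k z / dn f k x = q * (deriv f y' / deriv f y)"
        by (simp add: Suc dn_Suc q_def y_def y'_def)
      have Sl: "S \<le> 1 / 2" "\<eta> l \<le> 1" "0 \<le> S"
      proof -
        show "S \<le> 1 / 2" unfolding S_def by (rule S_le) (use l in simp)
        show "0 \<le> S" unfolding S_def using \<eta>0 l by (intro sum_nonneg) auto
        have "S + \<eta> l \<le> 1 / 2" using S_le[of k] less.prems by (simp add: Suc S_def)
        then show "\<eta> l \<le> 1" using \<open>0 \<le> S\<close> by linarith
      qed
      have S_Suc: "(\<Sum>i<k. \<eta> i) = S + \<eta> l" by (simp add: Suc S_def)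
      \<comment> \<open>The lower bound is kept additive and the upper one exponential; for a sum of
        at most 1/2 both stay within [1/2, 2].\<close>
      have "1 - (S + \<eta> l) \<le> (1 - S) * (1 - \<eta> l)" using Sl \<eta>0[OF l] by (simp add: algebra_simps)
      also have "\<dots> \<le> q * (deriv f y' / deriv f y)" using IH(1) e Sl by (intro mult_mono) auto
      finally have A: "1 - (S + \<eta> l) \<le> q * (deriv f y' / deriv f y)" .
      have "q * (deriv f y' / deriv f y) \<le> exp S * exp (\<eta> l)"
      proof (rule mult_mono)
        show "deriv f y' / deriv f y \<le> exp (\<eta> l)" using e(2) exp_ge_add_one_self[of "\<eta> l"] by linarith
      qed (use IH e Sl in auto)
      then show ?thesis using A unfolding qk S_Suc by (simp add: exp_add)
    qed (use nz in simp)
    have le2: "\<bar>dn f k w\<bar> \<le> 2 * \<bar>dn f k x\<bar>" if "w \<in> B" for w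
    proof -
      have S: "(\<Sum>i<k. \<eta> i) \<le> 1 / 2" using S_le less.prems by blast
      then have "exp (\<Sum>i<k. \<eta> i) \<le> 2" using expS order_trans[of "exp (\<Sum>i<k. \<eta> i)" "exp (1/2)" 2] by simp
      then have "0 \<le> dn f k w / dn f k x" "dn f k w / dn f k x \<le> 2" using ratio[OF that] S by linarith+
      then have "\<bar>dn f k w / dn f k x\<bar> \<le> 2" by linarith
      then show ?thesis using nz[of k] by (simp add: abs_divide pos_divide_le_eq)
    qed
    have orbD: "(f ^^ i) w \<in> D" if "i < k" "w \<in> B" for i w
    proof -
      have "\<bar>(f ^^ i) w - (f ^^ i) x\<bar> \<le> 2 * \<rho> * \<bar>dn f i x\<bar>" using less.IH[of i] that less.prems by auto
      also have "\<dots> < r" using that less.prems by (intro small) auto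
      finally show ?thesis using ball_nbhd[OF iter_K[OF x]] nbhd_D by blast
    qed
    have "\<bar>(f ^^ k) z - (f ^^ k) x\<bar> \<le> 2 * \<rho> * \<bar>dn f k x\<bar>" if z: "z \<in> B" for z
    proof -
      have "norm ((f ^^ k) z - (f ^^ k) x) \<le> (2 * \<bar>dn f k x\<bar>) * norm (z - x)"
      proof (rule field_differentiable_bound[of B])
        show "convex B" by (simp add: B_def)
        show "((f ^^ k) has_field_derivative dn f k w) (at w within B)" if "w \<in> B" for w
          by (rule has_field_derivative_at_within[OF iter_deriv]) (use orbD that in blast)
        show "norm (dn f k w) \<le> 2 * \<bar>dn f k x\<bar>" if "w \<in> B" for w using le2[OF that] by simp
      qed (use z xB in auto)
      also have "\<dots> \<le> (2 * \<bar>dn f k x\<bar>) * \<rho>" using z by (intro mult_left_mono) (auto simp: B_def)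
      finally show ?thesis by (simp add: mult_ac)
    qed
    then show ?case using ratio by blast
  qed
  show 1: "1 / 2 \<le> dn f k z / dn f k x \<and> dn f k z / dn f k x \<le> 2" if "k \<le> n" "z \<in> {x - \<rho>..x + \<rho>}" for k z
  proof -
    have "(\<Sum>i<k. \<eta> i) \<le> 1 / 2" using S_le that by blast
    moreover from this have "exp (\<Sum>i<k. \<eta> i) \<le> 2" using expS order_trans[of "exp (\<Sum>i<k. \<eta> i)" "exp (1/2)" 2] by simp
    moreover have "1 - (\<Sum>i<k. \<eta> i) \<le> dn f k z / dn f k x" "dn f k z / dn f k x \<le> exp (\<Sum>i<k. \<eta> i)"
      using main[OF that(1)] that(2) unfolding B_def by blast+
    ultimately show ?thesis by linarith
  qed
  show 2: "\<bar>(f ^^ k) z - (f ^^ k) x\<bar> \<le> 2 * \<rho> * \<bar>dn f k x\<bar>" if "k \<le> n" "z \<in> {x - \<rho>..x + \<rho>}" for k z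
    using main[OF that(1)] that(2) unfolding B_def by blast
  show "{(f ^^ k) x - \<rho> * \<bar>dn f k x\<bar> / 2..(f ^^ k) x + \<rho> * \<bar>dn f k x\<bar> / 2} \<subseteq> (f ^^ k) ` {x - \<rho>..x + \<rho>}"
    if k: "k \<le> n" for k
  proof -
    have orbD: "(f ^^ i) w \<in> D" if "i < k" "w \<in> B" for i w
    proof -
      have "\<bar>(f ^^ i) w - (f ^^ i) x\<bar> \<le> 2 * \<rho> * \<bar>dn f i x\<bar>" using 2[of i w] that k by (simp add: B_def)
      also have "\<dots> < r" using that k by (intro small) auto
      finally show ?thesis using ball_nbhd[OF iter_K[OF x]] nbhd_D by blast
    qed
    have der: "((f ^^ k) has_real_derivative dn f k w) (at w)" if "w \<in> B" for w
      by (rule iter_deriv) (use orbD that in blast)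
    have conn: "connected ((f ^^ k) ` B)"
      by (rule connected_continuous_image[OF iter_cont]) (use orbD in \<open>auto simp: B_def\<close>)
    \<comment> \<open>The mean value theorem on each half: with a ratio of at least 1/2 the two ends
      move to opposite sides of the centre, by at least half of
      \<open>\<rho> * \<bar>dn f k x\<bar>\<close>.\<close>
    obtain u where u: "x < u" "u < x + \<rho>" "(f ^^ k) (x + \<rho>) - (f ^^ k) x = \<rho> * dn f k u"
      using MVT2[of x "x + \<rho>" "f ^^ k" "dn f k"] der \<rho> by (force simp: B_def)
    obtain v where v: "x - \<rho> < v" "v < x" "(f ^^ k) x - (f ^^ k) (x - \<rho>) = \<rho> * dn f k v"
      using MVT2[of "x - \<rho>" x "f ^^ k" "dn f k"] der \<rho> by (force simp: B_def)
    define a where "a = dn f k x"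
    define q\<^sub>1 where "q\<^sub>1 = dn f k u / a"
    define q\<^sub>2 where "q\<^sub>2 = dn f k v / a"
    have q: "1 / 2 \<le> q\<^sub>1" "1 / 2 \<le> q\<^sub>2" using 1[OF k, of u] 1[OF k, of v] u v by (auto simp: q\<^sub>1_def q\<^sub>2_def a_def)
    have a: "a \<noteq> 0" using nz by (simp add: a_def)
    have e1: "(f ^^ k) (x + \<rho>) = (f ^^ k) x + \<rho> * a * q\<^sub>1" using u(3) a by (simp add: q\<^sub>1_def)
    have e2: "(f ^^ k) (x - \<rho>) = (f ^^ k) x - \<rho> * a * q\<^sub>2" using v(3) a by (simp add: q\<^sub>2_def)
    have m1: "(f ^^ k) x + \<rho> * a * q\<^sub>1 \<in> (f ^^ k) ` B" unfolding e1[symmetric] using \<rho> by (auto simp: B_def)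
    have m2: "(f ^^ k) x - \<rho> * a * q\<^sub>2 \<in> (f ^^ k) ` B" unfolding e2[symmetric] using \<rho> by (auto simp: B_def)
    have seg: "{min s t..max s t} \<subseteq> (f ^^ k) ` B" if "s \<in> (f ^^ k) ` B" "t \<in> (f ^^ k) ` B" for s t
      using connected_segment[OF conn that] by (auto simp: closed_segment_eq_real_ivl split: if_splits)
    have b1: "\<rho> * \<bar>a\<bar> / 2 \<le> \<rho> * \<bar>a\<bar> * q\<^sub>1" "\<rho> * \<bar>a\<bar> / 2 \<le> \<rho> * \<bar>a\<bar> * q\<^sub>2"
      using mult_left_mono[OF q(1), of "\<rho> * \<bar>a\<bar>"] mult_left_mono[OF q(2), of "\<rho> * \<bar>a\<bar>"] \<rho> by auto
    have "{(f ^^ k) x - \<rho> * \<bar>a\<bar> / 2..(f ^^ k) x + \<rho> * \<bar>a\<bar> / 2} \<subseteq>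
        {min ((f ^^ k) x + \<rho> * a * q\<^sub>1) ((f ^^ k) x - \<rho> * a * q\<^sub>2)..max ((f ^^ k) x + \<rho> * a * q\<^sub>1) ((f ^^ k) x - \<rho> * a * q\<^sub>2)}"
      using b1 by (cases "0 \<le> a") (auto simp: abs_if)
    also have "\<dots> \<subseteq> (f ^^ k) ` B" by (rule seg[OF m1 m2])
    finally show ?thesis by (simp add: a_def B_def)
  qed
qed


section \<open>Escape of long intervals\<close>

text \<open>One shape for both alternatives of \<open>gap_germ_dichotomy\<close>:
  \<open>{s\<^sub>1..s\<^sub>2}\<close> is a small interval around \<open>a\<close> that is enlarged
  when \<open>a\<close> is preperiodic, while \<open>closed_segment a b\<close> is the piece of gap
  whose own images meet \<open>K\<close> otherwise. \<open>T\<close> stands for the long interval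
  containing both.\<close>

definition germ_escapes :: "real \<Rightarrow> real \<Rightarrow> real \<Rightarrow> real \<Rightarrow> nat \<Rightarrow> bool" where
  "germ_escapes a b \<delta> C j \<longleftrightarrow> (\<forall>T y s\<^sub>1 s\<^sub>2 s. closed_segment a b \<subseteq> T \<longrightarrow> {s\<^sub>1..s\<^sub>2} \<subseteq> T \<longrightarrow> y \<in> K \<longrightarrow>
     inj (\<lambda>i. (f ^^ i) y) \<longrightarrow> \<bar>y - a\<bar> < \<delta> \<longrightarrow> a \<in> {s\<^sub>1..s\<^sub>2} \<longrightarrow> {s\<^sub>1..s\<^sub>2} \<subseteq> ball a \<delta> \<longrightarrow> 0 < s \<longrightarrow> s \<le> 1 \<longrightarrow>
     {(f ^^ j) y - s..(f ^^ j) y + s} \<subseteq> (f ^^ j) ` {s\<^sub>1..s\<^sub>2} \<longrightarrow>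
     (\<exists>n \<kappa>. real n \<le> C * (1 + ln (1 / s)) \<and> \<kappa> \<in> K \<and> covers n T {\<kappa> - \<delta>..\<kappa> + \<delta>}))"

lemma germ_escape:
  assumes rep: "\<And>p t. p \<in> K \<Longrightarrow> 0 < t \<Longrightarrow> (f ^^ t) p = p \<Longrightarrow> 1 < \<bar>dn f t p\<bar>"
    and a: "a \<in> K" and b: "b \<noteq> a" "open_segment a b \<inter> K = {}"
  shows "\<exists>\<delta> C j. 0 < \<delta> \<and> 0 \<le> C \<and> germ_escapes a b \<delta> C j"
  using gap_germ_dichotomy[OF a b]
proof
  assume "\<exists>i j. i < j \<and> (f ^^ i) a = (f ^^ j) a"
  then obtain i j where ij: "i < j" "(f ^^ i) a = (f ^^ j) a" by blast
  define t where "t = j - i"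
  have "t + i = j" using ij(1) by (simp add: t_def)
  then have "(f ^^ t) ((f ^^ i) a) = (f ^^ j) a" by (simp only: funpow_add_apply[symmetric])
  then have t: "0 < t" "(f ^^ t) ((f ^^ i) a) = (f ^^ i) a"
    using ij by (simp_all add: t_def)
  have "1 < \<bar>dn f t ((f ^^ i) a)\<bar>" using rep[OF iter_K[OF a] t] .
  from preperiodic_expansion[OF a t this] obtain \<delta>\<^sub>a \<delta>' C where \<delta>: "0 < \<delta>\<^sub>a" "0 < \<delta>'" "0 \<le> C" and
    exp: "\<forall>y s\<^sub>1 s\<^sub>2 s. y \<in> K \<longrightarrow> \<bar>y - a\<bar> < \<delta>\<^sub>a \<longrightarrow> (f ^^ i) y \<noteq> (f ^^ i) a \<longrightarrow> a \<in> {s\<^sub>1..s\<^sub>2} \<longrightarrow>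
      {s\<^sub>1..s\<^sub>2} \<subseteq> ball a \<delta>\<^sub>a \<longrightarrow> 0 < s \<longrightarrow> s \<le> 1 \<longrightarrow>
      {(f ^^ i) y - s..(f ^^ i) y + s} \<subseteq> (f ^^ i) ` {s\<^sub>1..s\<^sub>2} \<longrightarrow>
      (\<exists>n \<kappa>. real n \<le> C * (1 + ln (1 / s)) \<and> \<kappa> \<in> K \<and> covers n {s\<^sub>1..s\<^sub>2} {\<kappa> - \<delta>'..\<kappa> + \<delta>'})" .
  define \<delta> where "\<delta> = min \<delta>\<^sub>a \<delta>'"
  show ?thesis
    unfolding germ_escapes_def
  proof (rule exI[of _ \<delta>], rule exI[of _ C], rule exI[of _ i], intro conjI allI impI)
    fix T y s\<^sub>1 s\<^sub>2 s
    assume *: "closed_segment a b \<subseteq> T" "{s\<^sub>1..s\<^sub>2} \<subseteq> T" "y \<in> K" "inj (\<lambda>i. (f ^^ i) y)" "\<bar>y - a\<bar> < \<delta>"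
      "a \<in> {s\<^sub>1..s\<^sub>2}" "{s\<^sub>1..s\<^sub>2} \<subseteq> ball a \<delta>" "0 < s" "s \<le> 1"
      "{(f ^^ i) y - s..(f ^^ i) y + s} \<subseteq> (f ^^ i) ` {s\<^sub>1..s\<^sub>2}"
    \<comment> \<open>If the orbit of \<open>y\<close> fell on that of the preperiodic point, it
      would repeat a value, against injectivity.\<close>
    have ne: "(f ^^ i) y \<noteq> (f ^^ i) a"
    proof
      assume eq: "(f ^^ i) y = (f ^^ i) a"
      have "(f ^^ (t + i)) y = (f ^^ i) y" using t(2) by (simp add: funpow_add_apply eq)
      then have "t + i = i" using injD[OF *(4)] by blast
      then show False using t(1) by simp
    qed
    have "{s\<^sub>1..s\<^sub>2} \<subseteq> ball a \<delta>\<^sub>a" using *(7) by (force simp: \<delta>_def)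
    then obtain n \<kappa> where n: "real n \<le> C * (1 + ln (1 / s))" "\<kappa> \<in> K" "covers n {s\<^sub>1..s\<^sub>2} {\<kappa> - \<delta>'..\<kappa> + \<delta>'}"
      using exp[rule_format, of y s\<^sub>1 s\<^sub>2 s] * ne by (auto simp: \<delta>_def)
    have "covers n {s\<^sub>1..s\<^sub>2} {\<kappa> - \<delta>..\<kappa> + \<delta>}"
      by (rule covers_subset[OF n(3)]) (use \<delta> in \<open>auto simp: \<delta>_def\<close>)
    then show "\<exists>n \<kappa>. real n \<le> C * (1 + ln (1 / s)) \<and> \<kappa> \<in> K \<and> covers n T {\<kappa> - \<delta>..\<kappa> + \<delta>}"
      using n(1,2) covers_mono[OF _ *(2)] by blast
  qed (use \<delta> in \<open>auto simp: \<delta>_def\<close>)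
next
  assume "\<exists>i k \<delta>. k \<in> K \<and> 0 < \<delta> \<and> covers i (closed_segment a b) {k - \<delta>..k + \<delta>}"
  then obtain i k \<delta> where k: "k \<in> K" "0 < \<delta>" "covers i (closed_segment a b) {k - \<delta>..k + \<delta>}" by blast
  show ?thesis
    unfolding germ_escapes_def
  proof (rule exI[of _ \<delta>], rule exI[of _ "real i"], rule exI[of _ 0], intro conjI allI impI)
    fix T :: "real set" and s :: real assume T: "closed_segment a b \<subseteq> T" and s: "0 < s" "s \<le> 1"
    have "0 \<le> ln (1 / s)" using s by simp
    \<comment> \<open>The escape time \<open>i\<close> does not depend on \<open>s\<close>; as
      \<open>1 + ln (1 / s)\<close> is at least 1, it serves as the constant.\<close>
    then have "real i * 1 \<le> real i * (1 + ln (1 / s))" by (intro mult_left_mono) auto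
    then show "\<exists>n \<kappa>. real n \<le> real i * (1 + ln (1 / s)) \<and> \<kappa> \<in> K \<and> covers n T {\<kappa> - \<delta>..\<kappa> + \<delta>}"
      using k(1) covers_mono[OF k(3) T] by (intro exI[of _ i] exI[of _ k]) simp
  qed (use k(2) in auto)
qed

text \<open>Starting points of such gaps on the same side are at least \<open>l\<close> apart in a
  bounded set. Cutting the gap at length exactly \<open>l\<close> leaves two choices of
  \<open>b\<close> for each \<open>a\<close>.\<close>

lemma finite_long_gaps:
  assumes "0 < l"
  shows "finite {(a, b). a \<in> K \<and> \<bar>b - a\<bar> = l \<and> open_segment a b \<inter> K = {}}"
proof -
  obtain B where B: "\<And>k. k \<in> K \<Longrightarrow> \<bar>k\<bar> \<le> B" using compact_imp_bounded[OF K_compact] by (auto simp: bounded_iff)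
  have sep: "finite A" if A: "A \<subseteq> K" "\<And>a a'. a \<in> A \<Longrightarrow> a' \<in> A \<Longrightarrow> a < a' \<Longrightarrow> a + l \<le> a'" for A
  proof -
    define h where "h a = \<lfloor>a / l\<rfloor>" for a
    have "inj_on h A"
    proof (rule linorder_inj_onI)
      fix a a' assume "a < a'" "a \<in> A" "a' \<in> A"
      then have "a + l \<le> a'" using A(2) by blast
      then have "(a + l) / l \<le> a' / l" using assms by (intro divide_right_mono) auto
      then have "a / l + 1 \<le> a' / l" using assms by (simp add: add_divide_distrib)
      then show "h a \<noteq> h a'" unfolding h_def by linarith
    qed auto
    moreover have "h ` A \<subseteq> {\<lfloor>- B / l\<rfloor>..\<lfloor>B / l\<rfloor>}"
    proof
      fix i assume "i \<in> h ` A"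
      then obtain a where a: "a \<in> A" "i = h a" by blast
      then have "- B \<le> a" "a \<le> B" using B[of a] A(1) by auto
      then have "- B / l \<le> a / l" "a / l \<le> B / l" using assms by (intro divide_right_mono; simp)+
      then show "i \<in> {\<lfloor>- B / l\<rfloor>..\<lfloor>B / l\<rfloor>}" unfolding a(2) h_def by (auto intro: floor_mono)
    qed
    ultimately show ?thesis using finite_subset finite_imageD by blast
  qed
  define A1 where "A1 = {a \<in> K. open_segment a (a + l) \<inter> K = {}}"
  define A2 where "A2 = {a \<in> K. open_segment a (a - l) \<inter> K = {}}"
  have "finite A1"
  proof (rule sep)
    fix a a' assume "a \<in> A1" "a' \<in> A1" "a < a'"
    then show "a + l \<le> a'" using assms by (force simp: A1_def open_segment_eq_real_ivl)
  qed (auto simp: A1_def)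
  moreover have "finite A2"
  proof (rule sep)
    fix a a' assume "a \<in> A2" "a' \<in> A2" "a < a'"
    then show "a + l \<le> a'" using assms by (force simp: A2_def open_segment_eq_real_ivl)
  qed (auto simp: A2_def)
  moreover have "{(a, b). a \<in> K \<and> \<bar>b - a\<bar> = l \<and> open_segment a b \<inter> K = {}} \<subseteq>
      (\<lambda>a. (a, a + l)) ` A1 \<union> (\<lambda>a. (a, a - l)) ` A2"
  proof
    fix g assume "g \<in> {(a, b). a \<in> K \<and> \<bar>b - a\<bar> = l \<and> open_segment a b \<inter> K = {}}"
    then obtain a b where g: "g = (a, b)" "a \<in> K" "\<bar>b - a\<bar> = l" "open_segment a b \<inter> K = {}" by auto
    have "b = a + l \<or> b = a - l" using g(3) by linarith
    then show "g \<in> (\<lambda>a. (a, a + l)) ` A1 \<union> (\<lambda>a. (a, a - l)) ` A2"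
      using g by (auto simp: A1_def A2_def)
  qed
  ultimately show ?thesis using finite_subset by blast
qed

text \<open>Either a point of \<open>K\<close> has room inside the long interval, or
  \<open>y\<close> is close to one of its ends and the last point of \<open>K\<close> near that end
  starts a gap of at least a fixed length. Only finitely many gaps are that long, so the constants
  of \<open>germ_escape\<close> become uniform.\<close>

lemma long_interval_escape:
  assumes rep: "\<And>p t. p \<in> K \<Longrightarrow> 0 < t \<Longrightarrow> (f ^^ t) p = p \<Longrightarrow> 1 < \<bar>dn f t p\<bar>" and r1: "0 < r\<^sub>1"
  obtains \<delta> C J where "0 < \<delta>" "0 \<le> C"
    "\<forall>\<alpha> \<beta> y s S. \<beta> - \<alpha> > r\<^sub>1 \<longrightarrow> y \<in> K \<longrightarrow> inj (\<lambda>i. (f ^^ i) y) \<longrightarrow> connected S \<longrightarrow> compact S \<longrightarrow> y \<in> S \<longrightarrow>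
      S \<subseteq> {\<alpha>..\<beta>} \<longrightarrow> S \<subseteq> ball y \<delta> \<longrightarrow> 0 < s \<longrightarrow> s \<le> 1 \<longrightarrow>
      (\<forall>j\<le>J. {(f ^^ j) y - s..(f ^^ j) y + s} \<subseteq> (f ^^ j) ` S) \<longrightarrow>
      (\<exists>n \<kappa>. real n \<le> C * (1 + ln (1 / s)) \<and> \<kappa> \<in> K \<and> covers n {\<alpha>..\<beta>} {\<kappa> - \<delta>..\<kappa> + \<delta>})"
proof -
  \<comment> \<open>Half of the minimal length: the gap still has this length after margins at both
    ends are removed.\<close>
  define l where "l = r\<^sub>1 / 2"
  have l: "0 < l" using r1 by (simp add: l_def)
  define G where "G = {(a, b). a \<in> K \<and> \<bar>b - a\<bar> = l \<and> open_segment a b \<inter> K = {}}"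
  have finG: "finite G" unfolding G_def by (rule finite_long_gaps[OF l])
  have "\<exists>\<delta> C j. 0 < \<delta> \<and> 0 \<le> C \<and> germ_escapes (fst g) (snd g) \<delta> C j" if "g \<in> G" for g
  proof -
    have g: "fst g \<in> K" "\<bar>snd g - fst g\<bar> = l" "open_segment (fst g) (snd g) \<inter> K = {}" using that by (auto simp: G_def)
    then have ne: "snd g \<noteq> fst g" using l by auto
    show ?thesis by (rule germ_escape[OF rep g(1) ne g(3)])
  qed
  then obtain \<delta> C j where gP: "\<And>g. g \<in> G \<Longrightarrow> 0 < \<delta> g \<and> 0 \<le> C g \<and> germ_escapes (fst g) (snd g) (\<delta> g) (C g) (j g)" by metis
  define d where "d = Min (insert (l / 4) (\<delta> ` G))"
  define C' where "C' = Max (insert 0 (C ` G))"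
  define J where "J = Max (insert 0 (j ` G))"
  have d: "0 < d" "d \<le> l / 4" "\<And>g. g \<in> G \<Longrightarrow> d \<le> \<delta> g"
  proof -
    show "0 < d" unfolding d_def using finG l gP by (subst Min_gr_iff) auto
    show "d \<le> l / 4" unfolding d_def by (rule Min_le) (use finG in auto)
    show "d \<le> \<delta> g" if "g \<in> G" for g unfolding d_def by (rule Min_le) (use finG that in auto)
  qed
  have C': "0 \<le> C'" "\<And>g. g \<in> G \<Longrightarrow> C g \<le> C'" unfolding C'_def using finG by (auto intro: Max_ge)
  have J: "\<And>g. g \<in> G \<Longrightarrow> j g \<le> J" unfolding J_def using finG by (auto intro: Max_ge)
  \<comment> \<open>A fraction of \<open>d\<close>, so that \<open>a\<close>, \<open>y\<close> and
    \<open>S\<close> together stay within \<open>d\<close> of \<open>a\<close>.\<close>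
  define w where "w = d / 4"
  have w: "0 < w" using d by (simp add: w_def)
  show thesis
  proof (rule that[of w C' J], goal_cases)
    case 3
    show ?case
    proof (intro allI impI)
      fix \<alpha> \<beta> y s S
      assume len: "\<beta> - \<alpha> > r\<^sub>1" and y: "y \<in> K" "inj (\<lambda>i. (f ^^ i) y)" and S: "connected S" "compact S" "y \<in> S"
        "S \<subseteq> {\<alpha>..\<beta>}" "S \<subseteq> ball y w" and s: "0 < s" "s \<le> 1"
        and img: "\<forall>j\<le>J. {(f ^^ j) y - s..(f ^^ j) y + s} \<subseteq> (f ^^ j) ` S"
      have l0: "0 \<le> ln (1 / s)" using s by simp
      show "\<exists>n \<kappa>. real n \<le> C' * (1 + ln (1 / s)) \<and> \<kappa> \<in> K \<and> covers n {\<alpha>..\<beta>} {\<kappa> - w..\<kappa> + w}"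
      proof (cases "\<exists>\<kappa>\<in>K. \<alpha> + w \<le> \<kappa> \<and> \<kappa> \<le> \<beta> - w")
        case True
        then obtain \<kappa> where \<kappa>: "\<kappa> \<in> K" "\<alpha> + w \<le> \<kappa>" "\<kappa> \<le> \<beta> - w" by blast
        have "covers 0 {\<alpha>..\<beta>} {\<kappa> - w..\<kappa> + w}"
          using \<kappa> w by (intro coversI[of "\<kappa> - w" "\<kappa> + w"]) auto
        moreover have "real 0 \<le> C' * (1 + ln (1 / s))" using C' l0 by simp
        ultimately show ?thesis using \<kappa>(1) by blast
      next
        case False
        have yT: "y \<in> {\<alpha>..\<beta>}" using S by blast
        have "\<exists>a b. (a, b) \<in> G \<and> closed_segment a b \<subseteq> {\<alpha>..\<beta>} \<and> \<bar>y - a\<bar> \<le> w"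
        proof (cases "y < \<alpha> + w")
          case left: True
          \<comment> \<open>Its last point \<open>a\<close> is followed by no point of
            \<open>K\<close> until the right margin, hence by a gap of length at least
            \<open>l\<close>.\<close>
          define X where "X = K \<inter> {\<alpha>..\<alpha> + w}"
          have "compact X" unfolding X_def using K_compact by (intro compact_Int) auto
          moreover have yX: "y \<in> X" using left yT y(1) by (auto simp: X_def)
          ultimately obtain a where a: "a \<in> X" "\<And>x. x \<in> X \<Longrightarrow> x \<le> a"
            using compact_attains_sup[of X] by blast
          have aX: "a \<in> K" "\<alpha> \<le> a" "a \<le> \<alpha> + w" "y \<le> a" using a yX by (auto simp: X_def)
          have "k \<notin> K" if "a < k" "k < a + l" for k
          proof
            assume "k \<in> K"
            show False
            proof (cases "k \<le> \<alpha> + w")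
              case True
              then have "k \<in> X" using \<open>k \<in> K\<close> that aX by (auto simp: X_def)
              then show False using a(2)[of k] that by auto
            next
              case False
              then show False using \<open>k \<in> K\<close> \<open>\<not> (\<exists>\<kappa>\<in>K. \<alpha> + w \<le> \<kappa> \<and> \<kappa> \<le> \<beta> - w)\<close> that aX len d(2) l
                by (force simp: l_def w_def)
            qed
          qed
          then have "open_segment a (a + l) \<inter> K = {}" using l by (auto simp: open_segment_eq_real_ivl)
          then have "(a, a + l) \<in> G" using aX l by (simp add: G_def)
          moreover have "closed_segment a (a + l) \<subseteq> {\<alpha>..\<beta>}"
            using aX len d l by (auto simp: closed_segment_eq_real_ivl l_def w_def)
          moreover have "\<bar>y - a\<bar> \<le> w" using aX yT by auto
          ultimately show ?thesis by blast
        next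
          case right: False
          then have yr: "\<beta> - w < y" using False y(1) by force
          define X where "X = K \<inter> {\<beta> - w..\<beta>}"
          have "compact X" unfolding X_def using K_compact by (intro compact_Int) auto
          moreover have yX: "y \<in> X" using yr yT y(1) by (auto simp: X_def)
          ultimately obtain a where a: "a \<in> X" "\<And>x. x \<in> X \<Longrightarrow> a \<le> x"
            using compact_attains_inf[of X] by blast
          have aX: "a \<in> K" "a \<le> \<beta>" "\<beta> - w \<le> a" "a \<le> y" using a yX by (auto simp: X_def)
          have "k \<notin> K" if "k < a" "a - l < k" for k
          proof
            assume "k \<in> K"
            show False
            proof (cases "\<beta> - w \<le> k")
              case True
              then have "k \<in> X" using \<open>k \<in> K\<close> that aX by (auto simp: X_def)
              then show False using a(2)[of k] that by auto
            next
              case False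
              then show False using \<open>k \<in> K\<close> \<open>\<not> (\<exists>\<kappa>\<in>K. \<alpha> + w \<le> \<kappa> \<and> \<kappa> \<le> \<beta> - w)\<close> that aX len d(2) l
                by (force simp: l_def w_def)
            qed
          qed
          then have "open_segment a (a - l) \<inter> K = {}" using l by (auto simp: open_segment_eq_real_ivl)
          then have "(a, a - l) \<in> G" using aX l by (simp add: G_def)
          moreover have "closed_segment a (a - l) \<subseteq> {\<alpha>..\<beta>}"
            using aX len d l by (auto simp: closed_segment_eq_real_ivl l_def w_def)
          moreover have "\<bar>y - a\<bar> \<le> w" using aX yT by auto
          ultimately show ?thesis by blast
        qed
        then obtain a b where ab: "(a, b) \<in> G" "closed_segment a b \<subseteq> {\<alpha>..\<beta>}" "\<bar>y - a\<bar> \<le> w" by blast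
        define \<delta>\<^sub>0 j\<^sub>0 where "\<delta>\<^sub>0 = \<delta> (a, b)" and "j\<^sub>0 = j (a, b)"
        have P: "germ_escapes a b \<delta>\<^sub>0 (C (a, b)) j\<^sub>0" and d0: "d \<le> \<delta>\<^sub>0" "j\<^sub>0 \<le> J" "0 \<le> C (a, b)" "C (a, b) \<le> C'"
          using gP[OF ab(1)] d(3)[OF ab(1)] J[OF ab(1)] C'(2)[OF ab(1)] by (auto simp: \<delta>\<^sub>0_def j\<^sub>0_def)
        obtain u v where uv: "S = {u..v}" using S(1,2) connected_compact_interval_1 by blast
        \<comment> \<open>\<open>S\<close> is extended to contain \<open>a\<close>, because the
          enlargement starts at the end of the gap.\<close>
        define s\<^sub>1 s\<^sub>2 where "s\<^sub>1 = min u a" and "s\<^sub>2 = max v a"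
        have uvy: "u \<le> y" "y \<le> v" using S(3) uv by auto
        have SS: "S \<subseteq> {s\<^sub>1..s\<^sub>2}" by (auto simp: uv s\<^sub>1_def s\<^sub>2_def)
        have uS: "u \<in> S" "v \<in> S" using uv uvy by auto
        have aT: "a \<in> {\<alpha>..\<beta>}" using ab(2) by auto
        have 1: "{s\<^sub>1..s\<^sub>2} \<subseteq> {\<alpha>..\<beta>}" using uS S(4) aT by (auto simp: s\<^sub>1_def s\<^sub>2_def)
        have 2: "{s\<^sub>1..s\<^sub>2} \<subseteq> ball a \<delta>\<^sub>0"
        proof -
          have "\<bar>u - y\<bar> < w" "\<bar>v - y\<bar> < w" using uS S(5) by (auto simp: dist_real_def abs_minus_commute)
          moreover have "2 * w < d" using d(1) by (simp add: w_def)
          ultimately have "\<bar>u - a\<bar> < d" "\<bar>v - a\<bar> < d" using ab(3) by linarith+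
          then show ?thesis using d0(1) d(1) by (auto simp: s\<^sub>1_def s\<^sub>2_def dist_real_def)
        qed
        have 3: "{(f ^^ j\<^sub>0) y - s..(f ^^ j\<^sub>0) y + s} \<subseteq> (f ^^ j\<^sub>0) ` {s\<^sub>1..s\<^sub>2}"
          using img d0(2) SS by (meson image_mono subset_trans)
        have "\<bar>y - a\<bar> < \<delta>\<^sub>0" using ab(3) d0(1) d(1) by (auto simp: w_def)
        moreover have "a \<in> {s\<^sub>1..s\<^sub>2}" by (auto simp: s\<^sub>1_def s\<^sub>2_def)
        ultimately obtain n \<kappa> where n: "real n \<le> C (a, b) * (1 + ln (1 / s))" "\<kappa> \<in> K" "covers n {\<alpha>..\<beta>} {\<kappa> - \<delta>\<^sub>0..\<kappa> + \<delta>\<^sub>0}"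
          using P[unfolded germ_escapes_def, rule_format, of "{\<alpha>..\<beta>}" s\<^sub>1 s\<^sub>2 y s] ab(2) 1 2 3 y s by auto
        have "covers n {\<alpha>..\<beta>} {\<kappa> - w..\<kappa> + w}"
          by (rule covers_subset[OF n(3)]) (use w d0 in \<open>auto simp: w_def\<close>)
        moreover have "C (a, b) * (1 + ln (1 / s)) \<le> C' * (1 + ln (1 / s))"
          using d0(4) l0 by (intro mult_right_mono) auto
        ultimately show ?thesis using n(1,2) by (meson order_trans)
      qed
    qed
  qed (use w C' in auto)
qed


section \<open>Comparison with periodic orbits\<close>

text \<open>
  With \<open>d k = \<bar>dn f k x\<bar>\<close> the distortion of the \<open>k\<close>-th step is of order \<open>\<rho> (d k)\<^sup>2 / d (k + 1)\<close>, where
  \<open>(d k)\<^sup>2 / d (k + 1) \<le> e\<^bsup>(\<Lambda>+3\<epsilon>)k+C\<^esup>\<close>; the radius \<open>\<rho> = e\<^bsup>-(\<Lambda>+6\<epsilon>)n\<^esup>\<close> makes the sum over \<open>k < n\<close> small.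
\<close>

lemma push_nonneg_exponent:
  assumes x: "x \<in> K" and ly: "lyapunov x \<Lambda>" and \<Lambda>: "0 \<le> \<Lambda>" and \<epsilon>: "0 < \<epsilon>" and \<tau>: "0 < \<tau>"
  shows "\<exists>n\<^sub>0. \<forall>n\<ge>n\<^sub>0. let \<rho> = exp (- (\<Lambda> + 6 * \<epsilon>) * real n) in
    (\<forall>k\<le>n. \<forall>z\<in>{x - \<rho>..x + \<rho>}. \<bar>(f ^^ k) z - (f ^^ k) x\<bar> \<le> \<tau>) \<and>
    {(f ^^ n) x - exp (- 8 * \<epsilon> * real n)..(f ^^ n) x + exp (- 8 * \<epsilon> * real n)} \<subseteq> (f ^^ n) ` {x - \<rho>..x + \<rho>}"
proof -
  note nz = lyapunov_nonzero[OF ly]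
  define d where "d k = \<bar>dn f k x\<bar>" for k
  obtain C where C0: "0 \<le> C" and bounds: "\<forall>k. exp ((\<Lambda> - \<epsilon>) * real k - C) \<le> d k"
    "\<forall>k. d k \<le> exp ((\<Lambda> + \<epsilon>) * real k + C)"
    unfolding d_def by (rule lyapunovD[OF ly \<epsilon>])
  note d_ge = bounds(1)[rule_format] and d_le = bounds(2)[rule_format]
  have d0: "0 < d k" for k using nz by (simp add: d_def)
  \<comment> \<open>The upper bound for \<open>d k\<close> enters twice and the lower bound for
    \<open>d (Suc k)\<close> once, hence \<open>3 * C\<close>; the \<open>\<epsilon>\<close> comes
    from the shift in \<open>Suc k\<close>.\<close>
  define C' where "C' = 3 * C + \<epsilon>"
  define \<eta> where "\<eta> n = 2 * L * exp C' * exp (- 3 * \<epsilon> * real n)" for n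
  \<comment> \<open>The distortion of all \<open>n\<close> steps together: exponential smallness
    beats the factor \<open>n\<close>.\<close>
  have "(\<lambda>n. real n * \<eta> n) \<longlonglongrightarrow> 0"
  proof -
    have "(\<lambda>n. 2 * L * exp C' * (real n * exp (- 3 * \<epsilon>) ^ n)) \<longlonglongrightarrow> 2 * L * exp C' * 0"
      by (intro tendsto_mult tendsto_const powser_times_n_limit_0) (use \<epsilon> in simp)
    moreover have "(\<lambda>n. real n * \<eta> n) = (\<lambda>n. 2 * L * exp C' * (real n * exp (- 3 * \<epsilon>) ^ n))"
      by (auto simp: \<eta>_def exp_of_nat_mult[symmetric] mult_ac)
    ultimately show ?thesis by simp
  qed
  then have "\<forall>\<^sub>F n in sequentially. real n * \<eta> n < 1 / 2" by (rule order_tendstoD) simp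
  moreover define \<sigma> where "\<sigma> = min \<tau> (r / 2)"
  have \<sigma>: "0 < \<sigma>" "\<sigma> \<le> \<tau>" "\<sigma> < r" using \<tau> r_pos by (auto simp: \<sigma>_def)
  have e0: "(\<lambda>n. c * exp (- b * real n)) \<longlonglongrightarrow> 0" if "0 < b" for b c :: real
  proof -
    have "(\<lambda>n. c * exp (- b) ^ n) \<longlonglongrightarrow> c * 0"
      by (intro tendsto_mult tendsto_const LIMSEQ_power_zero) (use that in simp)
    then show ?thesis by (simp add: exp_of_nat_mult[symmetric] mult.commute)
  qed
  have "\<forall>\<^sub>F n in sequentially. 2 * exp C * exp (- (5 * \<epsilon>) * real n) < \<sigma>"
    by (rule order_tendstoD(2)[OF e0]) (use \<epsilon> \<sigma> in auto)
  moreover have "\<forall>\<^sub>F n in sequentially. 2 * exp C * exp (- \<epsilon> * real n) < 1"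
    by (rule order_tendstoD(2)[OF e0]) (use \<epsilon> in auto)
  ultimately have "\<forall>\<^sub>F n in sequentially. real n * \<eta> n < 1 / 2 \<and> 2 * exp C * exp (- (5 * \<epsilon>) * real n) < \<sigma> \<and>
      2 * exp C * exp (- \<epsilon> * real n) < 1"
    by eventually_elim blast
  then obtain n\<^sub>0 where n0: "\<And>n. n \<ge> n\<^sub>0 \<Longrightarrow> real n * \<eta> n < 1 / 2 \<and> 2 * exp C * exp (- (5 * \<epsilon>) * real n) < \<sigma> \<and>
      2 * exp C * exp (- \<epsilon> * real n) < 1"
    unfolding eventually_sequentially by blast
  show ?thesis
  proof (intro exI[of _ n\<^sub>0] allI impI)
    fix n assume n: "n \<ge> n\<^sub>0"
    define \<rho> where "\<rho> = exp (- (\<Lambda> + 6 * \<epsilon>) * real n)"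
    have \<rho>: "0 < \<rho>" by (simp add: \<rho>_def)
    have small: "2 * \<rho> * d k < \<sigma>" if "k \<le> n" for k
    proof -
      have "2 * \<rho> * d k \<le> 2 * \<rho> * exp ((\<Lambda> + \<epsilon>) * real k + C)" using d_le[of k] \<rho> by simp
      also have "\<dots> \<le> 2 * \<rho> * exp ((\<Lambda> + \<epsilon>) * real n + C)"
        using \<rho> \<Lambda> \<epsilon> that by (intro mult_left_mono) (auto intro!: mult_left_mono)
      also have "\<dots> = 2 * exp C * exp (- (5 * \<epsilon>) * real n)"
        by (simp add: \<rho>_def exp_add[symmetric] algebra_simps)
      finally show ?thesis using n0[OF n] by linarith
    qed
    have \<eta>_ok: "L * (2 * \<rho> * d k) \<le> \<eta> n * \<bar>deriv f ((f ^^ k) x)\<bar>" if "k < n" for k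
    proof -
      have ds: "d (Suc k) = d k * \<bar>deriv f ((f ^^ k) x)\<bar>" by (simp add: d_def dn_Suc abs_mult)
      have "d k * d k \<le> exp ((\<Lambda> + \<epsilon>) * real k + C) * exp ((\<Lambda> + \<epsilon>) * real k + C)"
        using d_le[of k] d0[of k] by (intro mult_mono) auto
      also have "\<dots> = exp (2 * ((\<Lambda> + \<epsilon>) * real k + C))" by (simp add: exp_add[symmetric])
      also have "\<dots> \<le> exp (((\<Lambda> + 3 * \<epsilon>) * real n + C') + ((\<Lambda> - \<epsilon>) * real (Suc k) - C))"
      proof -
        have "(\<Lambda> + 3 * \<epsilon>) * real k \<le> (\<Lambda> + 3 * \<epsilon>) * real n" using that \<Lambda> \<epsilon> by (intro mult_left_mono) auto
        then have "2 * ((\<Lambda> + \<epsilon>) * real k + C) \<le> ((\<Lambda> + 3 * \<epsilon>) * real n + C') + ((\<Lambda> - \<epsilon>) * real (Suc k) - C)"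
          using \<Lambda> by (simp add: C'_def algebra_simps)
        then show ?thesis by simp
      qed
      also have "\<dots> \<le> exp ((\<Lambda> + 3 * \<epsilon>) * real n + C') * d (Suc k)"
        using d_ge[of "Suc k"] by (simp only: exp_add) simp
      finally have "d k * d k \<le> d k * (exp ((\<Lambda> + 3 * \<epsilon>) * real n + C') * \<bar>deriv f ((f ^^ k) x)\<bar>)"
        by (simp add: ds mult_ac)
      then have "d k \<le> exp ((\<Lambda> + 3 * \<epsilon>) * real n + C') * \<bar>deriv f ((f ^^ k) x)\<bar>" using d0[of k] by simp
      then have "L * (2 * \<rho> * d k) \<le> L * (2 * \<rho> * (exp ((\<Lambda> + 3 * \<epsilon>) * real n + C') * \<bar>deriv f ((f ^^ k) x)\<bar>))"
        using L_pos \<rho> by simp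
      also have "\<dots> = \<eta> n * \<bar>deriv f ((f ^^ k) x)\<bar>"
      proof -
        have "\<rho> * exp ((\<Lambda> + 3 * \<epsilon>) * real n + C') = exp C' * exp (- 3 * \<epsilon> * real n)"
          by (simp add: \<rho>_def exp_add[symmetric] algebra_simps)
        then show ?thesis by (simp add: \<eta>_def mult_ac)
      qed
      finally show ?thesis .
    qed
    have sum: "(\<Sum>k<n. \<eta> n) \<le> 1 / 2" using n0[OF n] by simp
    have sm: "\<forall>k<n. 2 * \<rho> * d k < r" using small \<sigma>(3) by (meson less_imp_le less_trans)
    have "\<forall>k<n. L * (2 * \<rho> * d k) \<le> \<eta> n * \<bar>deriv f ((f ^^ k) x)\<bar>" using \<eta>_ok by blast
    note push = push_forward[OF x nz \<rho>, of n "\<lambda>_. \<eta> n", folded d_def, OF sm this sum]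
    have A: "\<bar>(f ^^ k) z - (f ^^ k) x\<bar> \<le> \<tau>" if "k \<le> n" "z \<in> {x - \<rho>..x + \<rho>}" for k z
      using push(2)[OF that] small[OF that(1)] \<sigma>(2) by linarith
    \<comment> \<open>The radius loses \<open>6 * \<epsilon>\<close> and the lower bound for
      \<open>d n\<close> one more \<open>\<epsilon>\<close>; the eighth absorbs the factors 2 and
      \<open>exp C\<close> for large \<open>n\<close>.\<close>
    have B: "exp (- 8 * \<epsilon> * real n) \<le> \<rho> * d n / 2"
    proof -
      have "\<rho> * exp ((\<Lambda> - \<epsilon>) * real n - C) \<le> \<rho> * d n" using d_ge[of n] \<rho> by simp
      moreover have "\<rho> * exp ((\<Lambda> - \<epsilon>) * real n - C) = exp (- 7 * \<epsilon> * real n - C)"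
        by (simp add: \<rho>_def exp_add[symmetric] algebra_simps)
      moreover have "2 * exp (- 8 * \<epsilon> * real n) \<le> exp (- 7 * \<epsilon> * real n - C)"
      proof -
        have "2 * exp (- 8 * \<epsilon> * real n) = (2 * exp C * exp (- \<epsilon> * real n)) * exp (- 7 * \<epsilon> * real n - C)"
          by (simp add: mult.assoc exp_add[symmetric] algebra_simps)
        also have "\<dots> \<le> 1 * exp (- 7 * \<epsilon> * real n - C)" using n0[OF n] by (intro mult_right_mono) auto
        finally show ?thesis by simp
      qed
      ultimately show ?thesis by linarith
    qed
    have "{(f ^^ n) x - exp (- 8 * \<epsilon> * real n)..(f ^^ n) x + exp (- 8 * \<epsilon> * real n)}
        \<subseteq> {(f ^^ n) x - \<rho> * d n / 2..(f ^^ n) x + \<rho> * d n / 2}"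
      using B by auto
    also have "\<dots> \<subseteq> (f ^^ n) ` {x - \<rho>..x + \<rho>}" using push(3)[of n] by simp
    finally show "let \<rho> = exp (- (\<Lambda> + 6 * \<epsilon>) * real n) in
      (\<forall>k\<le>n. \<forall>z\<in>{x - \<rho>..x + \<rho>}. \<bar>(f ^^ k) z - (f ^^ k) x\<bar> \<le> \<tau>) \<and>
      {(f ^^ n) x - exp (- 8 * \<epsilon> * real n)..(f ^^ n) x + exp (- 8 * \<epsilon> * real n)} \<subseteq> (f ^^ n) ` {x - \<rho>..x + \<rho>}"
      unfolding Let_def \<rho>_def[symmetric] using A by blast
  qed
qed

text \<open>For negative \<open>\<Lambda>\<close> the distortions form a geometric series, so one
  interval around \<open>x\<close> has short images and bounded distortion at all times. A periodic
  point in one of its images inherits the contraction along \<open>x\<close>, up to a constant that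
  powers remove.\<close>

lemma negative_exponent_periodic:
  assumes x: "x \<in> K" and ly: "lyapunov x \<Lambda>" and \<Lambda>: "\<Lambda> < c" "c < 0"
  obtains p s where "p \<in> K" "0 < s" "(f ^^ s) p = p" "\<bar>dn f s p\<bar> \<le> exp (c * real s)"
proof -
  \<comment> \<open>Since \<open>\<Lambda> < c < 0\<close>, this gives both
    \<open>\<Lambda> + 3 * \<epsilon> < 0\<close>, the rate of the distortion series, and
    \<open>\<Lambda> + \<epsilon> \<le> c\<close>.\<close>
  define \<epsilon> where "\<epsilon> = (c - \<Lambda>) / 4"
  have \<epsilon>: "0 < \<epsilon>" "\<Lambda> + 3 * \<epsilon> < 0" "\<Lambda> + \<epsilon> \<le> c" "\<Lambda> + \<epsilon> < 0" using \<Lambda> by (auto simp: \<epsilon>_def field_simps)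
  note nz = lyapunov_nonzero[OF ly]
  define d where "d k = \<bar>dn f k x\<bar>" for k
  obtain C where C0: "0 \<le> C" and bounds: "\<forall>k. exp ((\<Lambda> - \<epsilon>) * real k - C) \<le> d k"
    "\<forall>k. d k \<le> exp ((\<Lambda> + \<epsilon>) * real k + C)"
    unfolding d_def by (rule lyapunovD[OF ly \<epsilon>(1)])
  note d_ge = bounds(1)[rule_format] and d_le = bounds(2)[rule_format]
  have d0: "0 < d k" for k using nz by (simp add: d_def)
  define C' where "C' = 3 * C + \<epsilon> - \<Lambda>"
  define q where "q = exp (\<Lambda> + 3 * \<epsilon>)"
  have q: "0 < q" "q < 1" using \<epsilon> by (auto simp: q_def)
  \<comment> \<open>The first bound makes the distortions sum to at most 1/2, the second keeps all
    images within \<open>r\<close> of the orbit.\<close>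
  define \<rho> where "\<rho> = min ((1 - q) / (4 * L * exp C')) (r / (4 * exp C))"
  have \<rho>: "0 < \<rho>" using q L_pos r_pos by (simp add: \<rho>_def)
  define \<eta> where "\<eta> k = 2 * L * \<rho> * exp C' * q ^ k" for k
  have small: "2 * \<rho> * d k < r" for k
  proof -
    have "(\<Lambda> + \<epsilon>) * real k \<le> 0" using \<epsilon>(4) by (simp add: mult_nonpos_nonneg)
    then have "d k \<le> exp C" using d_le[of k] order_trans by fastforce
    then have "2 * \<rho> * d k \<le> 2 * \<rho> * exp C" using \<rho> by simp
    also have "\<dots> \<le> 2 * (r / (4 * exp C)) * exp C" by (intro mult_right_mono mult_left_mono) (auto simp: \<rho>_def)
    also have "\<dots> < r" using r_pos by simp
    finally show ?thesis .
  qed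
  have \<eta>_ok: "L * (2 * \<rho> * d k) \<le> \<eta> k * \<bar>deriv f ((f ^^ k) x)\<bar>" for k
  proof -
    have ds: "d (Suc k) = d k * \<bar>deriv f ((f ^^ k) x)\<bar>" by (simp add: d_def dn_Suc abs_mult)
    have "d k * d k \<le> exp ((\<Lambda> + \<epsilon>) * real k + C) * exp ((\<Lambda> + \<epsilon>) * real k + C)"
      using d_le[of k] d0[of k] by (intro mult_mono) auto
    also have "\<dots> = exp (((\<Lambda> + 3 * \<epsilon>) * real k + C') + ((\<Lambda> - \<epsilon>) * real (Suc k) - C))"
      by (simp add: exp_add[symmetric] C'_def algebra_simps)
    also have "\<dots> \<le> exp ((\<Lambda> + 3 * \<epsilon>) * real k + C') * d (Suc k)"
      using d_ge[of "Suc k"] by (simp only: exp_add) simp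
    finally have "d k * d k \<le> d k * (exp ((\<Lambda> + 3 * \<epsilon>) * real k + C') * \<bar>deriv f ((f ^^ k) x)\<bar>)"
      by (simp add: ds mult_ac)
    then have "d k \<le> exp ((\<Lambda> + 3 * \<epsilon>) * real k + C') * \<bar>deriv f ((f ^^ k) x)\<bar>" using d0[of k] by simp
    then have "L * (2 * \<rho> * d k) \<le> L * (2 * \<rho> * (exp ((\<Lambda> + 3 * \<epsilon>) * real k + C') * \<bar>deriv f ((f ^^ k) x)\<bar>))"
      using L_pos \<rho> by simp
    also have "exp ((\<Lambda> + 3 * \<epsilon>) * real k + C') = q ^ k * exp C'"
    proof -
      have "q ^ k = exp (real k * (\<Lambda> + 3 * \<epsilon>))" by (simp only: q_def exp_of_nat_mult)
      then show ?thesis by (simp add: exp_add mult.commute)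
    qed
    finally show ?thesis by (simp add: \<eta>_def mult_ac)
  qed
  have sum: "(\<Sum>k<n. \<eta> k) \<le> 1 / 2" for n
  proof -
    have "(\<Sum>k<n. q ^ k) \<le> 1 / (1 - q)"
      using q by (simp add: sum_gp_strict divide_right_mono)
    then have "2 * L * \<rho> * exp C' * (\<Sum>k<n. q ^ k) \<le> 2 * L * \<rho> * exp C' * (1 / (1 - q))"
      using L_pos \<rho> by (intro mult_left_mono) auto
    also have "\<dots> \<le> 2 * L * ((1 - q) / (4 * L * exp C')) * exp C' * (1 / (1 - q))"
      using L_pos q by (intro mult_right_mono mult_left_mono) (auto simp: \<rho>_def)
    also have "\<dots> = 1 / 2" using L_pos q by simp
    finally show ?thesis by (simp add: \<eta>_def sum_distrib_left)
  qed
  define B where "B = {x - \<rho>..x + \<rho>}"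
  have "\<forall>k<n. 2 * \<rho> * d k < r" "\<forall>k<n. L * (2 * \<rho> * d k) \<le> \<eta> k * \<bar>deriv f ((f ^^ k) x)\<bar>" for n
    using small \<eta>_ok by blast+
  note push = push_forward[OF x nz \<rho>, of _ \<eta>, folded d_def, OF this sum order_refl, folded B_def]
  have "x \<in> {x - \<rho><..<x + \<rho>} \<inter> K" using x \<rho> by simp
  then have ne: "{x - \<rho><..<x + \<rho>} \<inter> K \<noteq> {}" by blast
  have orb: "(f ^^ i) ` {x - \<rho>..x + \<rho>} \<subseteq> nbhd K r" for i
  proof
    fix y assume "y \<in> (f ^^ i) ` {x - \<rho>..x + \<rho>}"
    then obtain z where z: "z \<in> B" "y = (f ^^ i) z" by (auto simp: B_def)
    have "\<bar>y - (f ^^ i) x\<bar> < r" using push(2)[OF z(1), of i] small[of i] z(2) by linarith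
    then show "y \<in> nbhd K r" using ball_nbhd[OF iter_K[OF x]] by blast
  qed
  obtain k s p where p: "0 < s" "p \<in> (f ^^ k) ` {x - \<rho>..x + \<rho>}" "(f ^^ s) p = p" "p \<in> K"
    by (rule recurrent_interval_periodic[OF ne orb])
  then obtain z where z: "z \<in> B" "p = (f ^^ k) z" by (auto simp: B_def)
  have ratio: "1 / 2 * d i \<le> \<bar>dn f i z\<bar> \<and> \<bar>dn f i z\<bar> \<le> 2 * d i" for i
  proof -
    have "1 / 2 \<le> \<bar>dn f i z / dn f i x\<bar> \<and> \<bar>dn f i z / dn f i x\<bar> \<le> 2" using push(1)[OF z(1), of i] by linarith
    then show ?thesis using d0[of i] by (simp add: d_def abs_divide pos_le_divide_eq pos_divide_le_eq)
  qed
  \<comment> \<open>The cost of following \<open>x\<close> for \<open>k\<close> steps before the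
    turns of the orbit of \<open>p\<close> begin.\<close>
  define C'' where "C'' = 2 * exp ((\<Lambda> + \<epsilon>) * real k + C) / (d k / 2)"
  have "\<bar>dn f s p\<bar> ^ j \<le> C'' * exp ((\<Lambda> + \<epsilon>) * real s * real j)" for j
  proof -
    have "dn f (s * j + k) z = dn f k z * dn f s p ^ j"
      by (simp add: dn_add z(2)[symmetric] dn_period[OF p(3)])
    then have "(d k / 2) * \<bar>dn f s p\<bar> ^ j \<le> \<bar>dn f (s * j + k) z\<bar>"
    proof -
      assume eq: "dn f (s * j + k) z = dn f k z * dn f s p ^ j"
      have "(d k / 2) * \<bar>dn f s p\<bar> ^ j \<le> \<bar>dn f k z\<bar> * \<bar>dn f s p\<bar> ^ j"
        using ratio[of k] by (intro mult_right_mono) auto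
      then show ?thesis by (simp only: eq abs_mult power_abs)
    qed
    also have "\<dots> \<le> 2 * exp ((\<Lambda> + \<epsilon>) * real (s * j + k) + C)" using ratio[of "s * j + k"] d_le[of "s * j + k"] by linarith
    also have "\<dots> = (2 * exp ((\<Lambda> + \<epsilon>) * real k + C)) * exp ((\<Lambda> + \<epsilon>) * real s * real j)"
      by (simp add: mult.assoc exp_add[symmetric] algebra_simps)
    finally show ?thesis using d0[of k] by (simp add: C''_def field_simps)
  qed
  then have "\<bar>dn f s p\<bar> \<le> exp ((\<Lambda> + \<epsilon>) * real s)" by (rule abs_le_exp_of_powers)
  also have "\<dots> \<le> exp (c * real s)" using \<epsilon>(3) by (simp add: mult_right_mono)
  finally show thesis using that p by blast
qed

lemma nonneg_exponent_periodic:
  assumes x: "x \<in> K" and ly: "lyapunov x \<Lambda>" and \<Lambda>: "0 \<le> \<Lambda>" "\<Lambda> < c"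
  shows "\<exists>p\<in>K. \<exists>s>0. (f ^^ s) p = p \<and> \<bar>dn f s p\<bar> \<le> exp (c * real s)"
proof (rule ccontr)
  assume no: "\<not> ?thesis"
  have big: "exp (c * real s) < \<bar>dn f s p\<bar>" if "p \<in> K" "0 < s" "(f ^^ s) p = p" for p s
    using no that by force
  have c0: "0 < c" using \<Lambda> by linarith
  have rep: "1 < \<bar>dn f t p\<bar>" if "p \<in> K" "0 < t" "(f ^^ t) p = p" for p t
  proof -
    have "1 \<le> exp (c * real t)" using c0 by simp
    then show ?thesis using big[OF that] by linarith
  qed
  have nonper: "(f ^^ n) e \<noteq> e" if "e \<in> crit" "0 < n" for e n
  proof
    assume "(f ^^ n) e = e"
    then have "1 < \<bar>dn f n e\<bar>" using rep crit_K that by blast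
    moreover have "dn f n e = 0"
      using that by (auto simp: dn_def crit_def intro!: prod_zero bexI[of _ 0])
    ultimately show False by simp
  qed
  \<comment> \<open>A preperiodic orbit of exponent \<open>\<Lambda>\<close> would end in a periodic
    orbit of the same exponent, below \<open>c\<close>.\<close>
  have inj: "inj (\<lambda>i. (f ^^ i) y)" if y: "y \<in> K" "lyapunov y \<Lambda>" for y
  proof (rule linorder_injI)
    fix i j :: nat assume ij: "i < j"
    show "(f ^^ i) y \<noteq> (f ^^ j) y"
    proof
      assume eq: "(f ^^ i) y = (f ^^ j) y"
      define p t where "p = (f ^^ i) y" and "t = j - i"
      have "t + i = j" using ij by (simp add: t_def)
      then have "(f ^^ t) p = (f ^^ j) y" unfolding p_def by (simp only: funpow_add_apply[symmetric])
      then have p: "p \<in> K" "0 < t" "(f ^^ t) p = p" using iter_K[OF y(1)] eq ij by (auto simp: p_def t_def)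
      define \<epsilon> where "\<epsilon> = c - \<Lambda>"
      have "0 < \<epsilon>" using \<Lambda> by (simp add: \<epsilon>_def)
      have lp: "lyapunov p \<Lambda>" unfolding p_def by (rule lyapunov_shift[OF y(2)])
      then obtain C where C: "\<forall>n. \<bar>dn f n p\<bar> \<le> exp ((\<Lambda> + \<epsilon>) * real n + C)"
        using lyapunovD \<open>0 < \<epsilon>\<close> by metis
      have "\<bar>dn f t p\<bar> ^ k \<le> exp C * exp (c * real t * real k)" for k
      proof -
        have "\<bar>dn f t p ^ k\<bar> \<le> exp (c * real (t * k) + C)"
          using C[rule_format, of "t * k"] by (simp only: dn_period[OF p(3)] \<epsilon>_def) simp
        then show ?thesis by (simp add: power_abs exp_add mult_ac)
      qed
      then have "\<bar>dn f t p\<bar> \<le> exp (c * real t)" by (rule abs_le_exp_of_powers)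
      then show False using big[OF p] by simp
    qed
  qed
  \<comment> \<open>One \<open>\<theta>\<close> pays for \<open>growth\<close>, one for the choice
    of \<open>\<epsilon>\<close> below, one for the constants collected in \<open>C\<^sub>3\<close>;
    the total \<open>\<Lambda> + 3 * \<theta>\<close> is below \<open>c\<close>.\<close>
  define \<theta> where "\<theta> = (c - \<Lambda>) / 4"
  have "4 * \<theta> = c - \<Lambda>" by (simp only: \<theta>_def) simp
  then have \<theta>: "0 < \<theta>" "\<theta> \<le> c" "c = \<Lambda> + 4 * \<theta>" using \<Lambda> by linarith+
  obtain r\<^sub>1 C\<^sub>1 where r1: "0 < r\<^sub>1" "r\<^sub>1 < r" and
    growth: "\<forall>u v k z. u \<le> v \<longrightarrow> {u..v} \<inter> K \<noteq> {} \<longrightarrow> (\<forall>i<k. diameter ((f ^^ i) ` {u..v}) \<le> r\<^sub>1) \<longrightarrow>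
      z \<in> {u..v} \<longrightarrow> \<bar>dn f k z\<bar> * (v - u) \<le> exp (\<theta> * real k + C\<^sub>1) * diameter ((f ^^ k) ` {u..v})"
    by (rule growth[OF nonper \<theta>(1)])
  obtain \<delta> C\<^sub>2 J where \<delta>: "0 < \<delta>" "0 \<le> C\<^sub>2" and
    escape: "\<forall>\<alpha> \<beta> y s S. \<beta> - \<alpha> > r\<^sub>1 \<longrightarrow> y \<in> K \<longrightarrow> inj (\<lambda>i. (f ^^ i) y) \<longrightarrow> connected S \<longrightarrow> compact S \<longrightarrow> y \<in> S \<longrightarrow>
      S \<subseteq> {\<alpha>..\<beta>} \<longrightarrow> S \<subseteq> ball y \<delta> \<longrightarrow> 0 < s \<longrightarrow> s \<le> 1 \<longrightarrow>
      (\<forall>j\<le>J. {(f ^^ j) y - s..(f ^^ j) y + s} \<subseteq> (f ^^ j) ` S) \<longrightarrow>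
      (\<exists>n \<kappa>. real n \<le> C\<^sub>2 * (1 + ln (1 / s)) \<and> \<kappa> \<in> K \<and> covers n {\<alpha>..\<beta>} {\<kappa> - \<delta>..\<kappa> + \<delta>})"
    by (rule long_interval_escape[OF rep r1(1)])
  obtain i\<^sub>0 q\<^sub>0 \<rho>\<^sub>0 where \<rho>0: "0 < \<rho>\<^sub>0" and
    home: "\<forall>k\<in>K. \<exists>q\<le>q\<^sub>0. covers q {k - \<delta>..k + \<delta>} {(f ^^ i\<^sub>0) x - \<rho>\<^sub>0..(f ^^ i\<^sub>0) x + \<rho>\<^sub>0}"
    by (rule covers_orbit_uniformly[OF x inj[OF x ly] lyapunov_not_crit[OF ly] \<delta>(1)])
  define y where "y = (f ^^ i\<^sub>0) x"
  have y: "y \<in> K" "lyapunov y \<Lambda>" unfolding y_def by (rule iter_K[OF x], rule lyapunov_shift[OF ly])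
  have lnM: "0 \<le> ln M" using M_ge by simp
  \<comment> \<open>\<open>6 * \<epsilon>\<close> is the loss in the radius, and
    \<open>8 * \<epsilon> * C\<^sub>2 * ln M\<close> the growth per unit of \<open>N\<close> during
    the escape, as \<open>ln (1 / s)\<close> will be \<open>8 * \<epsilon> * N\<close> up to a
    constant.\<close>
  define \<epsilon> where "\<epsilon> = \<theta> / (6 + 8 * C\<^sub>2 * ln M)"
  have den: "0 < 6 + 8 * C\<^sub>2 * ln M" using \<delta>(2) lnM by (simp add: add_pos_nonneg)
  have \<epsilon>: "0 < \<epsilon>" "6 * \<epsilon> + 8 * \<epsilon> * C\<^sub>2 * ln M = \<theta>"
  proof -
    show "0 < \<epsilon>" using \<theta> den by (simp add: \<epsilon>_def)
    have "\<epsilon> * (6 + 8 * C\<^sub>2 * ln M) = \<theta>" using den by (simp add: \<epsilon>_def)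
    then show "6 * \<epsilon> + 8 * \<epsilon> * C\<^sub>2 * ln M = \<theta>" by (simp add: algebra_simps)
  qed
  \<comment> \<open>Small enough that \<open>N\<close> exceeds \<open>n\<close>, that
    \<open>S\<close> fits the escape estimate, and that \<open>J' n\<close> fits into the interval
    covered by \<open>home\<close>.\<close>
  define \<tau> where "\<tau> = min (min (r\<^sub>1 / 2) (\<delta> / 2)) \<rho>\<^sub>0"
  have \<tau>: "0 < \<tau>" "2 * \<tau> \<le> r\<^sub>1" "\<tau> < \<delta>" "\<tau> \<le> \<rho>\<^sub>0" using r1 \<delta> \<rho>0 by (auto simp: \<tau>_def)
  define \<rho> where "\<rho> n = exp (- (\<Lambda> + 6 * \<epsilon>) * real n)" for n
  define J' where "J' n = {y - \<rho> n..y + \<rho> n}" for n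
  obtain n\<^sub>0 where "\<forall>n\<ge>n\<^sub>0. (\<forall>k\<le>n. \<forall>z\<in>J' n. \<bar>(f ^^ k) z - (f ^^ k) y\<bar> \<le> \<tau>) \<and>
    {(f ^^ n) y - exp (- 8 * \<epsilon> * real n)..(f ^^ n) y + exp (- 8 * \<epsilon> * real n)} \<subseteq> (f ^^ n) ` J' n"
    using push_nonneg_exponent[OF y \<Lambda>(1) \<epsilon>(1) \<tau>(1)] unfolding Let_def J'_def \<rho>_def ..
  note n0 = this[THEN spec, THEN mp]
  have \<rho>p: "0 < \<rho> n" for n by (simp add: \<rho>_def)
  have \<rho>_anti: "\<rho> m \<le> \<rho> n" if "n \<le> m" for m n
  proof -
    have "(\<Lambda> + 6 * \<epsilon>) * real n \<le> (\<Lambda> + 6 * \<epsilon>) * real m" using that \<Lambda> \<epsilon> by (intro mult_left_mono) auto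
    then show ?thesis by (simp add: \<rho>_def algebra_simps)
  qed
  have J'_anti: "J' m \<subseteq> J' n" if "n \<le> m" for m n using \<rho>_anti[OF that] by (auto simp: J'_def)
  have yJ: "y \<in> J' n" for n using \<rho>p[of n] by (simp add: J'_def less_imp_le)
  define C\<^sub>3 where "C\<^sub>3 = ln M + C\<^sub>1 + ln r\<^sub>1 + (real q\<^sub>0 + C\<^sub>2 * (1 + 8 * \<epsilon> * real J)) * ln M"
  obtain n where n: "n \<ge> n\<^sub>0" "C\<^sub>3 \<le> \<theta> * real n"
  proof -
    obtain m :: nat where "C\<^sub>3 / \<theta> < real m" using reals_Archimedean2 by blast
    then have "C\<^sub>3 \<le> \<theta> * real m" using \<theta>(1) by (simp add: pos_divide_less_eq mult.commute)
    also have "\<dots> \<le> \<theta> * real (max m n\<^sub>0)" using \<theta>(1) by (intro mult_left_mono) auto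
    finally show thesis using that[of "max m n\<^sub>0"] by simp
  qed
  define u v where "u = y - \<rho> n" and "v = y + \<rho> n"
  have uv: "u < v" "J' n = {u..v}" "v - u = 2 * \<rho> n" using \<rho>p[of n] by (auto simp: u_def v_def J'_def)
  have uvK: "{u..v} \<inter> K \<noteq> {}" using yJ[of n] y(1) uv(2) by auto
  \<comment> \<open>Otherwise \<open>growth\<close> would apply at all times and bound the
    multiplier of a periodic point in an image by \<open>exp (\<theta> * s)\<close>, contrary to
    \<open>big\<close>.\<close>
  have "\<exists>N. r\<^sub>1 < diameter ((f ^^ N) ` {u..v})"
  proof (rule ccontr)
    assume "\<not> ?thesis"
    then have sh: "diameter ((f ^^ i) ` {u..v}) \<le> r\<^sub>1" for i by (meson not_less)
    have N: "(f ^^ i) ` {u..v} \<subseteq> nbhd K r" for i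
    proof (rule short_orbit[OF _ uvK])
      show "diameter ((f ^^ l) ` {u..v}) < r" if "l < Suc i" for l using sh[of l] r1 by linarith
    qed (use uv in auto)
    have "y \<in> {u<..<v} \<inter> K" using y(1) \<rho>p[of n] by (simp add: u_def v_def)
    then have "{u<..<v} \<inter> K \<noteq> {}" by blast
    from recurrent_interval_periodic[OF this N] obtain k s p where p: "0 < s" "p \<in> (f ^^ k) ` {u..v}" "(f ^^ s) p = p" "p \<in> K" .
    obtain a b where ab: "a < b" "(f ^^ k) ` {u..v} = {a..b}"
      using iter_interval_nondegenerate[OF uv(1), of k] N by blast
    have im: "(f ^^ i) ` {a..b} = (f ^^ (i + k)) ` {u..v}" for i
      by (simp only: funpow_add image_comp[symmetric] ab(2))
    have abK: "{a..b} \<inter> K \<noteq> {}"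
    proof -
      have "(f ^^ k) y \<in> {a..b}" unfolding ab(2)[symmetric] using yJ[of n] uv(2) by simp
      then show ?thesis using iter_K[OF y(1)] by blast
    qed
    have "\<bar>dn f s p\<bar> ^ j \<le> (exp C\<^sub>1 * r\<^sub>1 / (b - a)) * exp (\<theta> * real s * real j)" for j
    proof -
      have "\<bar>dn f (s * j) p\<bar> * (b - a) \<le> exp (\<theta> * real (s * j) + C\<^sub>1) * diameter ((f ^^ (s * j)) ` {a..b})"
        by (rule growth[rule_format]) (use ab abK p(2) sh im in auto)
      also have "\<dots> \<le> exp (\<theta> * real (s * j) + C\<^sub>1) * r\<^sub>1" unfolding im by (intro mult_left_mono sh) simp
      finally have "\<bar>dn f s p ^ j\<bar> * (b - a) \<le> exp (\<theta> * real (s * j) + C\<^sub>1) * r\<^sub>1"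
        by (simp only: dn_period[OF p(3)])
      then have "\<bar>dn f s p\<bar> ^ j \<le> exp (\<theta> * real (s * j) + C\<^sub>1) * r\<^sub>1 / (b - a)"
        using ab(1) by (simp add: power_abs pos_le_divide_eq)
      then show ?thesis by (simp add: exp_add mult_ac)
    qed
    then have "\<bar>dn f s p\<bar> \<le> exp (\<theta> * real s)" by (rule abs_le_exp_of_powers)
    also have "\<dots> \<le> exp (c * real s)" using \<theta>(2) by (simp add: mult_right_mono)
    finally show False using big[OF p(4,1,3)] by simp
  qed
  define N where "N = (LEAST N. r\<^sub>1 < diameter ((f ^^ N) ` {u..v}))"
  have N: "r\<^sub>1 < diameter ((f ^^ N) ` {u..v})"
    unfolding N_def using \<open>\<exists>N. r\<^sub>1 < diameter ((f ^^ N) ` {u..v})\<close> by (rule LeastI_ex)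
  have sh: "diameter ((f ^^ i) ` {u..v}) \<le> r\<^sub>1" if "i < N" for i
    using not_less_Least[of i] that unfolding N_def by (meson not_less)
  have orbN: "(f ^^ i) ` {u..v} \<subseteq> nbhd K r" if "i < N" for i
  proof (rule short_orbit[OF _ uvK _ that])
    show "diameter ((f ^^ l) ` {u..v}) < r" if "l < N" for l using sh[OF that] r1 by linarith
  qed (use uv in auto)
  have "n < N"
  proof (rule ccontr)
    assume "\<not> n < N"
    then have "\<forall>z\<in>J' n. \<bar>(f ^^ N) z - (f ^^ N) y\<bar> \<le> \<tau>" using n0[OF n(1)] by simp
    then have "diameter ((f ^^ N) ` J' n) \<le> 2 * \<tau>"
    proof (intro diameter_le)
      show "norm (w - w') \<le> 2 * \<tau>" if "w \<in> (f ^^ N) ` J' n" "w' \<in> (f ^^ N) ` J' n" for w w'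
      proof -
        have "\<bar>w - (f ^^ N) y\<bar> \<le> \<tau>" "\<bar>w' - (f ^^ N) y\<bar> \<le> \<tau>"
          using that \<open>\<forall>z\<in>J' n. \<bar>(f ^^ N) z - (f ^^ N) y\<bar> \<le> \<tau>\<close> by auto
        then show ?thesis unfolding real_norm_def by linarith
      qed
    qed (use \<tau> in auto)
    then show False using N \<tau>(2) uv(2) by simp
  qed
  obtain \<alpha> \<beta> where \<alpha>\<beta>: "\<alpha> < \<beta>" "(f ^^ N) ` {u..v} = {\<alpha>..\<beta>}"
    using iter_interval_nondegenerate[OF uv(1) orbN] by blast
  have long: "\<beta> - \<alpha> > r\<^sub>1" using N \<alpha>\<beta> by (simp add: diameter_closed_interval)
  have cov1: "covers N (J' n) {\<alpha>..\<beta>}"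
    by (rule coversI[of u v]) (use uv orbN \<alpha>\<beta> in auto)
  \<comment> \<open>The smaller interval \<open>J' N\<close>, of radius adapted to time
    \<open>N\<close>, keeps bounded distortion up to time \<open>N\<close>. The size
    \<open>s\<close> is taken at time \<open>N + J\<close> to serve the next \<open>J\<close> steps
    as well.\<close>
  define S where "S = (f ^^ N) ` J' N"
  define s where "s = exp (- 8 * \<epsilon> * real (N + J))"
  have s: "0 < s" "s \<le> 1" "ln (1 / s) = 8 * \<epsilon> * real (N + J)" using \<epsilon>(1) by (auto simp: s_def ln_div)
  have S: "connected S" "compact S" "(f ^^ N) y \<in> S" "S \<subseteq> {\<alpha>..\<beta>}" "S \<subseteq> ball ((f ^^ N) y) \<delta>"
  proof -
    have sub: "J' N \<subseteq> {u..v}" using J'_anti[of n N] \<open>n < N\<close> uv(2) by simp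
    then have cont: "continuous_on (J' N) (f ^^ N)"
      using orbN nbhd_D by (intro iter_cont) blast
    show "connected S" "compact S" unfolding S_def
      using cont by (auto intro!: connected_continuous_image compact_continuous_image simp: J'_def)
    show "(f ^^ N) y \<in> S" unfolding S_def using yJ by blast
    show "S \<subseteq> {\<alpha>..\<beta>}" unfolding S_def \<alpha>\<beta>(2)[symmetric] using sub by blast
    have "\<forall>z\<in>J' N. \<bar>(f ^^ N) z - (f ^^ N) y\<bar> \<le> \<tau>" using n0[of N] n(1) \<open>n < N\<close> by simp
    then show "S \<subseteq> ball ((f ^^ N) y) \<delta>" unfolding S_def using \<tau>(3) by (force simp: dist_real_def)
  qed
  have img: "\<forall>j\<le>J. {(f ^^ j) ((f ^^ N) y) - s..(f ^^ j) ((f ^^ N) y) + s} \<subseteq> (f ^^ j) ` S"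
  proof (intro allI impI)
    fix j assume j: "j \<le> J"
    define m where "m = j + N"
    have m: "n\<^sub>0 \<le> m" "N \<le> m" "(f ^^ j) ((f ^^ N) y) = (f ^^ m) y"
      using n(1) \<open>n < N\<close> by (simp_all add: m_def funpow_add_apply)
    have "s \<le> exp (- 8 * \<epsilon> * real m)" using j \<epsilon>(1) by (simp add: s_def m_def)
    then have "{(f ^^ m) y - s..(f ^^ m) y + s} \<subseteq>
        {(f ^^ m) y - exp (- 8 * \<epsilon> * real m)..(f ^^ m) y + exp (- 8 * \<epsilon> * real m)}" by auto
    also have "\<dots> \<subseteq> (f ^^ m) ` J' m" using n0[OF m(1)] by blast
    also have "\<dots> \<subseteq> (f ^^ m) ` J' N" using J'_anti[OF m(2)] by blast
    also have "\<dots> = (f ^^ j) ` S" by (simp only: S_def m_def funpow_add image_comp)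
    finally show "{(f ^^ j) ((f ^^ N) y) - s..(f ^^ j) ((f ^^ N) y) + s} \<subseteq> (f ^^ j) ` S" by (simp only: m(3))
  qed
  have "inj (\<lambda>i. (f ^^ i) ((f ^^ N) y))" by (rule inj[OF iter_K[OF y(1)] lyapunov_shift[OF y(2)]])
  then obtain m \<kappa> where m: "real m \<le> C\<^sub>2 * (1 + ln (1 / s))" "\<kappa> \<in> K" "covers m {\<alpha>..\<beta>} {\<kappa> - \<delta>..\<kappa> + \<delta>}"
    using escape[rule_format, OF long iter_K[OF y(1)] _ S s(1,2)] img by blast
  obtain q where q: "q \<le> q\<^sub>0" "covers q {\<kappa> - \<delta>..\<kappa> + \<delta>} {y - \<rho>\<^sub>0..y + \<rho>\<^sub>0}"
    using home m(2) unfolding y_def by blast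
  \<comment> \<open>The bound by \<open>\<tau>\<close> at time 0 is a bound for the radius
    itself.\<close>
  have "\<rho> n \<le> \<rho>\<^sub>0"
  proof -
    have "v \<in> J' n" using uv(1,2) by simp
    then have "\<bar>v - y\<bar> \<le> \<tau>" using n0[OF n(1)] by (metis funpow_0 le0)
    then show ?thesis using \<tau>(4) by (simp add: v_def)
  qed
  then have "covers q {\<kappa> - \<delta>..\<kappa> + \<delta>} {u..v}"
    using uv(1) by (intro covers_subset[OF q(2)]) (auto simp: u_def v_def)
  then have "covers (q + (m + N)) (J' n) {u..v}"
    using covers_trans[OF covers_trans[OF cov1 m(3)]] by blast
  then have "covers (q + (m + N)) {u..v} {u..v}" by (simp only: uv(2))
  then obtain p where p: "p \<in> {u..v}" "(f ^^ (q + (m + N))) p = p" "p \<in> K"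
    using covers_self_periodic[of "q + (m + N)" u v] \<open>n < N\<close> by auto
  define P where "P = q + (m + N)"
  have P: "0 < P" "N \<le> P" using \<open>n < N\<close> by (auto simp: P_def)
  \<comment> \<open>At time \<open>N\<close> the image is longer than \<open>r\<^sub>1\<close>, so
    \<open>growth\<close> is used up to the step before, when it is still short; the remaining steps
    cost at most the factor \<open>M\<close> each.\<close>
  obtain N' where N': "N = Suc N'" using \<open>n < N\<close> by (cases N) auto
  have dM: "\<bar>dn f k z\<bar> \<le> M ^ k" if "z \<in> K" for k z
  proof (induction k)
    case (Suc k)
    have "\<bar>deriv f ((f ^^ k) z)\<bar> \<le> M" using iter_K[OF that] K_nbhd by (intro deriv_bound) blast
    then have "\<bar>dn f k z\<bar> * \<bar>deriv f ((f ^^ k) z)\<bar> \<le> M ^ k * M" using Suc M_ge by (intro mult_mono) auto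
    then show ?case by (simp add: dn_Suc abs_mult mult.commute)
  qed simp
  have "\<bar>dn f N' p\<bar> * (2 * \<rho> n) \<le> exp (\<theta> * real N' + C\<^sub>1) * diameter ((f ^^ N') ` {u..v})"
    unfolding uv(3)[symmetric] by (rule growth[rule_format]) (use uv uvK p(1) sh N' in auto)
  also have "\<dots> \<le> exp (\<theta> * real N' + C\<^sub>1) * r\<^sub>1" using sh[of N'] N' by (intro mult_left_mono) auto
  also have "\<dots> \<le> exp (\<theta> * real N + C\<^sub>1) * r\<^sub>1" using r1 \<theta>(1) N' by simp
  finally have "\<bar>dn f N' p\<bar> * (2 * \<rho> n) \<le> exp (\<theta> * real N + C\<^sub>1) * r\<^sub>1" .
  moreover have "\<bar>dn f N' p\<bar> * \<rho> n \<le> \<bar>dn f N' p\<bar> * (2 * \<rho> n)"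
    using \<rho>p[of n] by (intro mult_left_mono) auto
  ultimately have 1: "\<bar>dn f N' p\<bar> * \<rho> n \<le> exp (\<theta> * real N + C\<^sub>1) * r\<^sub>1" by linarith
  have "1 / \<rho> n \<le> exp ((\<Lambda> + 6 * \<epsilon>) * real N)"
  proof -
    have "(\<Lambda> + 6 * \<epsilon>) * real n \<le> (\<Lambda> + 6 * \<epsilon>) * real N" using \<open>n < N\<close> \<Lambda> \<epsilon> by (intro mult_left_mono) auto
    then show ?thesis by (simp add: \<rho>_def exp_minus[symmetric] inverse_eq_divide[symmetric] algebra_simps)
  qed
  then have "\<bar>dn f N' p\<bar> * \<rho> n * (1 / \<rho> n) \<le> exp (\<theta> * real N + C\<^sub>1) * r\<^sub>1 * exp ((\<Lambda> + 6 * \<epsilon>) * real N)"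
    by (rule mult_mono[OF 1]) (use r1 \<rho>p[of n] in auto)
  then have 2: "\<bar>dn f N' p\<bar> \<le> exp (\<theta> * real N + C\<^sub>1) * r\<^sub>1 * exp ((\<Lambda> + 6 * \<epsilon>) * real N)"
    using \<rho>p[of n] by simp
  have "P = Suc (q + m) + N'" by (simp add: P_def N')
  then have "\<bar>dn f P p\<bar> = \<bar>dn f N' p\<bar> * \<bar>dn f (Suc (q + m)) ((f ^^ N') p)\<bar>"
    by (simp only: dn_add abs_mult)
  also have "\<dots> \<le> (exp (\<theta> * real N + C\<^sub>1) * r\<^sub>1 * exp ((\<Lambda> + 6 * \<epsilon>) * real N)) * M ^ Suc (q + m)"
    by (rule mult_mono[OF 2 dM[OF iter_K[OF p(3)]]]) (use r1 in auto)
  also have "\<dots> = exp (\<theta> * real N + C\<^sub>1 + ln r\<^sub>1 + (\<Lambda> + 6 * \<epsilon>) * real N + (1 + real q + real m) * ln M)"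
  proof -
    have "M ^ Suc (q + m) = exp (real (Suc (q + m)) * ln M)" using M_ge by (simp only: exp_of_nat_mult) simp
    also have "real (Suc (q + m)) = 1 + real q + real m" by simp
    finally show ?thesis using r1(1) by (simp only: exp_add exp_ln mult_ac)
  qed
  also have "\<dots> \<le> exp (c * real P)"
  proof -
    have "real q + real m \<le> real q\<^sub>0 + C\<^sub>2 * (1 + 8 * \<epsilon> * real (N + J))" using q(1) m(1) s(3) by simp
    then have "(real q + real m) * ln M \<le> (real q\<^sub>0 + C\<^sub>2 * (1 + 8 * \<epsilon> * real (N + J))) * ln M"
      using lnM by (intro mult_right_mono)
    also have "\<dots> = (real q\<^sub>0 + C\<^sub>2 * (1 + 8 * \<epsilon> * real J)) * ln M + (8 * \<epsilon> * C\<^sub>2 * ln M) * real N"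
      by (simp add: algebra_simps)
    finally have "\<theta> * real N + C\<^sub>1 + ln r\<^sub>1 + (\<Lambda> + 6 * \<epsilon>) * real N + (1 + real q + real m) * ln M
        \<le> C\<^sub>3 + (\<theta> + \<Lambda> + (6 * \<epsilon> + 8 * \<epsilon> * C\<^sub>2 * ln M)) * real N"
      unfolding C\<^sub>3_def by (simp add: algebra_simps)
    also have "\<dots> = C\<^sub>3 + (\<Lambda> + 2 * \<theta>) * real N" unfolding \<epsilon>(2) by (simp add: algebra_simps)
    also have "\<dots> \<le> \<theta> * real N + (\<Lambda> + 2 * \<theta>) * real N"
    proof -
      have "\<theta> * real n \<le> \<theta> * real N" using \<open>n < N\<close> \<theta>(1) by (intro mult_left_mono) auto
      then show ?thesis using n(2) by linarith
    qed
    also have "\<dots> \<le> c * real N"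
      using \<theta>(1) by (simp add: \<theta>(3) algebra_simps)
    also have "\<dots> \<le> c * real P" using c0 P(2) by simp
    finally show ?thesis by simp
  qed
  finally show False using big[OF p(3) P(1)] p(2) by (simp add: P_def)
qed

lemma chi_inf_le_exponent:
  assumes x: "x \<in> K" and ex: "has_exponent_at f x (ereal \<Lambda>)"
  shows "chi_inf f K \<le> ereal \<Lambda>"
proof (rule ccontr)
  assume "\<not> chi_inf f K \<le> ereal \<Lambda>"
  then have lt: "ereal \<Lambda> < chi_inf f K" by simp
  have ly: "lyapunov x \<Lambda>" by (rule lyapunovI[OF x ex])
  obtain b where b: "\<Lambda> < b" "ereal b < chi_inf f K" using ereal_dense2[OF lt] by auto
  \<comment> \<open>Strictly between \<open>\<Lambda>\<close> and the infimum, and negative whenever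
    \<open>\<Lambda>\<close> is, so that one of the two cases applies.\<close>
  define c where "c = (if \<Lambda> < 0 then min b (\<Lambda> / 2) else b)"
  have c: "\<Lambda> < c" "ereal c < chi_inf f K" "\<Lambda> < 0 \<Longrightarrow> c < 0"
  proof -
    have "c \<le> b" by (simp add: c_def)
    then show "ereal c < chi_inf f K" using b(2) by (metis ereal_less_eq(3) le_less_trans)
  qed (use b in \<open>auto simp: c_def\<close>)
  have "\<exists>p\<in>K. \<exists>s>0. (f ^^ s) p = p \<and> \<bar>dn f s p\<bar> \<le> exp (c * real s)"
  proof (cases "\<Lambda> < 0")
    case True
    show ?thesis using negative_exponent_periodic[OF x ly c(1) c(3)[OF True]] by blast
  next
    case False
    then show ?thesis using nonneg_exponent_periodic[OF x ly _ c(1)] by simp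
  qed
  then obtain p s where "p \<in> K" "s > 0" "(f ^^ s) p = p" "\<bar>dn f s p\<bar> \<le> exp (c * real s)" by blast
  then have "chi_inf f K \<le> ereal c" by (rule chi_inf_le_periodic)
  then show False using c(2) by simp
qed

end

theorem theorem5:
  fixes f :: "real \<Rightarrow> real" and D K IK U :: "real set"
  assumes "generalized_multimodal_pos_entropy D f K IK U"
    and "bounded_distortion D f K U"
    and "weak_isolation f K U"
  shows "\<forall>x\<in>K. \<forall>L::real. has_exponent_at f x (ereal L) \<longrightarrow> ereal L \<ge> chi_inf f K"
proof -
  have "generalized_multimodal D f K IK U"
    using assms(1) by (simp add: generalized_multimodal_pos_entropy_def)
  then obtain r M C where "multimodal_nbhd D f K IK U r M C"
    using multimodal_nbhd_exists assms(3) by blast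
  then interpret multimodal_nbhd D f K IK U r M C .
  show ?thesis using chi_inf_le_exponent by blast
qed

end
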